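(* Every cyclotomic pro-$2$ pair $\mathcal G=(G,\theta)\in\mathrm{ET}_2$ has logarithmic level $1$, $2$, $3$ or $\infty$.
   Context: A cyclotomic pro-$2$ pair is $(G,\theta)$ with $G$ a pro-$2$ group and $\theta\colon G\to\mathbb Z_2^\times$ a continuous homomorphism. Free product: $(G_1,\theta_1)*(G_2,\theta_2)=(G_1*_2G_2,\theta)$ with $\theta$ extending $\theta_1,\theta_2$. Extension: $\mathbb Z_2\rtimes(\bar G,\bar\theta)=(\mathbb Z_2\rtimes\bar G,\bar\theta\circ\pi)$ with $\bar g a\bar g^{-1}=\bar\theta(\bar g)a$. $\mathcal Z^\alpha=(\mathbb Z_2,1\mapsto\alpha)$ for $\alpha\in\mathbb Z_2^\times$; $\mathcal E=(\mathbb Z/2,\theta)$ with $\theta$ nontrivial onto $\{\pm1\}$. A pair is of $2$-adic type if isomorphic to $(G_K(2),\chi_K)$ (maximal pro-$2$ Galois group with pro-$2$ cyclotomic character) for a finite extension $K$ of $\mathbb Q_2$. $\mathrm{ET}_2$ is the smallest class of pairs (up to isomorphism) containing $(1,1)$, all $\mathcal Z^\alpha$, $\mathcal E$, and all pairs of $2$-adic type, and closed under free products and extensions $\bar{\mathcal G}\mapsto\mathbb Z_2\rtimes\bar{\mathcal G}$. For a pair $\mathcal G$, let $\varepsilon_{\mathcal G}\in H^1(G,\mathbb Z/2)$ be the composition of $\theta$ with the projection $\mathbb Z_2^\times=\{\pm1\}\times(1+4\mathbb Z_2)\to\{\pm1\}\cong\mathbb Z/2$. The logarithmic level of $\mathcal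 G$ is the least positive integer $m$ such that the $m$-fold cup product $\varepsilon_{\mathcal G}\cup\cdots\cup\varepsilon_{\mathcal G}$ is $0$ in $H^m(G,\mathbb Z/2)$, and $\infty$ if no such $m$ exists. *)

theory Defs
  imports
    "HOL-Analysis.Analysis"
    "HOL-Algebra.Algebra"
    "HOL-Algebra.Algebraic_Closure_Type"
    "HOL-Computational_Algebra.Fraction_Field"
    "HOL-Library.Z2"
    "HOL-Library.Extended_Nat"
begin

section \<open>The 2-adic integers\<close>

text \<open>
  $\mathbb{Z}_2$ as the inverse limit of the rings $\mathbb{Z}/2^n$: the component
  \<open>res a n\<close> is the representative of $a$ modulo $2^n$ in $\{0,\dots,2^n-1\}$.
\<close>

typedef two_adic = "{a :: nat \<Rightarrow> int. \<forall>n. a n = a (Suc n) mod 2 ^ n}"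
  morphisms res Abs_two_adic
  by (rule exI[of _ "\<lambda>_. 0"]) simp

setup_lifting type_definition_two_adic

lemma two_adic_eqI: "(\<And>n. res a n = res b n) \<Longrightarrow> a = b"
  by (simp add: res_inject[symmetric] fun_eq_iff)

lemma mod_pow_Suc: "(x :: int) mod 2 ^ Suc n mod 2 ^ n = x mod 2 ^ n"
  by (rule mod_mod_cancel) simp

lemma res_Suc: "res a n = res a (Suc n) mod 2 ^ n"
  using res[of a] by blast

lemma res_mod [simp]: "res a n mod 2 ^ n = res a n"
  by (subst (1 2) res_Suc) simp

instantiation two_adic :: comm_ring_1
begin

lift_definition zero_two_adic :: two_adic is "\<lambda>_. 0"
  by simp

lift_definition one_two_adic :: two_adic is "\<lambda>n. 1 mod 2 ^ n"
  by (auto simp only: mod_pow_Suc)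

lift_definition plus_two_adic :: "two_adic \<Rightarrow> two_adic \<Rightarrow> two_adic"
  is "\<lambda>a b n. (a n + b n) mod 2 ^ n"
proof -
  fix a b :: "nat \<Rightarrow> int" and n
  assume "\<And>n. a n = a (Suc n) mod 2 ^ n" "\<And>n. b n = b (Suc n) mod 2 ^ n"
  from this[of n] show "(a n + b n) mod 2 ^ n = (a (Suc n) + b (Suc n)) mod 2 ^ Suc n mod 2 ^ n"
    by (simp only: mod_pow_Suc mod_add_eq)
qed

lift_definition minus_two_adic :: "two_adic \<Rightarrow> two_adic \<Rightarrow> two_adic"
  is "\<lambda>a b n. (a n - b n) mod 2 ^ n"
proof -
  fix a b :: "nat \<Rightarrow> int" and n
  assume "\<And>n. a n = a (Suc n) mod 2 ^ n" "\<And>n. b n = b (Suc n) mod 2 ^ n"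
  from this[of n] show "(a n - b n) mod 2 ^ n = (a (Suc n) - b (Suc n)) mod 2 ^ Suc n mod 2 ^ n"
    by (simp only: mod_pow_Suc mod_diff_eq)
qed

lift_definition uminus_two_adic :: "two_adic \<Rightarrow> two_adic"
  is "\<lambda>a n. (- a n) mod 2 ^ n"
proof -
  fix a :: "nat \<Rightarrow> int" and n
  assume "\<And>n. a n = a (Suc n) mod 2 ^ n"
  from this[of n] show "(- a n) mod 2 ^ n = (- a (Suc n)) mod 2 ^ Suc n mod 2 ^ n"
    by (simp only: mod_pow_Suc mod_minus_eq)
qed

lift_definition times_two_adic :: "two_adic \<Rightarrow> two_adic \<Rightarrow> two_adic"
  is "\<lambda>a b n. (a n * b n) mod 2 ^ n"
proof -
  fix a b :: "nat \<Rightarrow> int" and n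
  assume "\<And>n. a n = a (Suc n) mod 2 ^ n" "\<And>n. b n = b (Suc n) mod 2 ^ n"
  from this[of n] show "(a n * b n) mod 2 ^ n = (a (Suc n) * b (Suc n)) mod 2 ^ Suc n mod 2 ^ n"
    by (simp only: mod_pow_Suc mod_mult_eq)
qed

instance
proof
  fix a b c :: two_adic
  show "a + b + c = a + (b + c)"
    by (rule two_adic_eqI) (simp add: plus_two_adic.rep_eq mod_simps add.assoc)
  show "a + b = b + a"
    by (rule two_adic_eqI) (simp add: plus_two_adic.rep_eq add.commute)
  show "0 + a = a"
    by (rule two_adic_eqI) (simp add: plus_two_adic.rep_eq zero_two_adic.rep_eq)
  show "- a + a = 0"
    by (rule two_adic_eqI)
      (simp add: plus_two_adic.rep_eq uminus_two_adic.rep_eq zero_two_adic.rep_eq mod_simps)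
  show "a - b = a + - b"
    by (rule two_adic_eqI)
      (simp add: plus_two_adic.rep_eq uminus_two_adic.rep_eq minus_two_adic.rep_eq mod_simps)
  show "a * b * c = a * (b * c)"
    by (rule two_adic_eqI) (simp add: times_two_adic.rep_eq mod_simps mult.assoc)
  show "a * b = b * a"
    by (rule two_adic_eqI) (simp add: times_two_adic.rep_eq mult.commute)
  show "1 * a = a"
    by (rule two_adic_eqI)
      (simp only: times_two_adic.rep_eq one_two_adic.rep_eq mod_mult_left_eq mult_1_left res_mod)
  show "(a + b) * c = a * c + b * c"
    by (rule two_adic_eqI)
      (simp add: times_two_adic.rep_eq plus_two_adic.rep_eq mod_simps distrib_right)
  have "res 0 1 \<noteq> res 1 1"
    by (simp add: zero_two_adic.rep_eq one_two_adic.rep_eq)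
  then show "(0 :: two_adic) \<noteq> 1"
    by metis
qed

end

lemma res_mod_le: "m \<le> n \<Longrightarrow> res a n mod 2 ^ m = res a m"
proof (induction n rule: dec_induct)
  case (step n)
  have "res a (Suc n) mod 2 ^ m = res a (Suc n) mod 2 ^ n mod 2 ^ m"
    using step.hyps by (intro mod_mod_cancel[symmetric] le_imp_power_dvd) simp
  with step show ?case
    by (simp flip: res_Suc)
qed simp

instance two_adic :: idom
proof
  fix a b :: two_adic
  assume "a \<noteq> 0" "b \<noteq> 0"
  moreover have "\<exists>n. res c n \<noteq> 0" if "c \<noteq> 0" for c
  proof (rule ccontr)
    assume "\<nexists>n. res c n \<noteq> 0"
    then have "c = 0"
      by (intro two_adic_eqI) (simp add: zero_two_adic.rep_eq)
    with that show False ..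
  qed
  ultimately obtain i j where i: "res a i \<noteq> 0" and j: "res b j \<noteq> 0"
    by meson
  let ?n = "i + j" and ?v = "multiplicity (2 :: int)"
  have na: "\<not> 2 ^ i dvd res a ?n" and nb: "\<not> 2 ^ j dvd res b ?n"
    using i j by (auto simp: dvd_eq_mod_eq_0 res_mod_le)
  then have nz: "res a ?n \<noteq> 0" "res b ?n \<noteq> 0"
    by auto
  have "?v (res a ?n) < i" "?v (res b ?n) < j"
    using na nb by (meson multiplicity_dvd' not_le_imp_less)+
  then have "?v (res a ?n * res b ?n) < ?n"
    using nz by (simp add: prime_elem_multiplicity_mult_distrib)
  then have "\<not> 2 ^ ?n dvd res a ?n * res b ?n"
    using nz by (subst power_dvd_iff_le_multiplicity) auto
  then have "res (a * b) ?n \<noteq> 0"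
    by (simp add: times_two_adic.rep_eq dvd_eq_mod_eq_0)
  then show "a * b \<noteq> 0"
    by (auto simp: zero_two_adic.rep_eq)
qed

text \<open>
  The inverse limit topology. The group $\mathbb{Z}_2^\times$ is \<open>{u. u dvd 1}\<close> with
  the subspace topology.
\<close>

definition two_adic_topology :: "two_adic topology" where
  "two_adic_topology =
     pullback_topology UNIV res (product_topology (\<lambda>_. discrete_topology UNIV) UNIV)"

text \<open>
  The projection $\mathbb{Z}_2^\times = \{\pm 1\} \times (1 + 4\mathbb{Z}_2) \to \{\pm 1\}$.
\<close>

definition sign_part :: "two_adic \<Rightarrow> two_adic" where
  "sign_part u = (THE s. s \<in> {1, -1} \<and> (\<exists>v. 4 dvd v - 1 \<and> u = s * v))"


section \<open>Cyclotomic pro-2 pairs\<close>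

record 'a top_group = "'a monoid" +
  topo :: "'a topology"

record 'a cyc_pair = "'a top_group" +
  chr :: "'a \<Rightarrow> two_adic"

text \<open>
  A pro-2 group is a compact Hausdorff topological group whose open normal subgroups form a
  neighbourhood base at the identity and all have index a power of 2.
\<close>

definition pro_2_group :: "('a, 'b) top_group_scheme \<Rightarrow> bool" where
  "pro_2_group G \<longleftrightarrow>
     group G \<and> topspace (topo G) = carrier G \<and>
     continuous_map (prod_topology (topo G) (topo G)) (topo G) (\<lambda>(x, y). x \<otimes>\<^bsub>G\<^esub> y) \<and>
     continuous_map (topo G) (topo G) (\<lambda>x. inv\<^bsub>G\<^esub> x) \<and>
     compact_space (topo G) \<and> Hausdorff_space (topo G) \<and>
     (\<forall>U. openin (topo G) U \<and> \<one>\<^bsub>G\<^esub> \<in> U \<longrightarrow>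
        (\<exists>N. N \<lhd> G \<and> openin (topo G) N \<and> N \<subseteq> U)) \<and>
     (\<forall>N. N \<lhd> G \<and> openin (topo G) N \<longrightarrow> (\<exists>n. order (G Mod N) = 2 ^ n))"

definition cont_hom ::
    "('a, 'c) top_group_scheme \<Rightarrow> ('b, 'd) top_group_scheme \<Rightarrow> ('a \<Rightarrow> 'b) set" where
  "cont_hom G H = {f. f \<in> hom G H \<and> continuous_map (topo G) (topo H) f}"

definition cont_unit_character :: "('a, 'c) top_group_scheme \<Rightarrow> ('a \<Rightarrow> two_adic) \<Rightarrow> bool" where
  "cont_unit_character G \<theta> \<longleftrightarrow>
     (\<forall>x\<in>carrier G. \<theta> x dvd 1) \<and>
     (\<forall>x\<in>carrier G. \<forall>y\<in>carrier G. \<theta> (x \<otimes>\<^bsub>G\<^esub> y) = \<theta> x * \<theta> y) \<and>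
     continuous_map (topo G) (subtopology two_adic_topology {u. u dvd 1}) \<theta>"

definition cyclotomic_pair :: "'a cyc_pair \<Rightarrow> bool" where
  "cyclotomic_pair \<G> \<longleftrightarrow> pro_2_group \<G> \<and> cont_unit_character \<G> (chr \<G>)"

definition pair_iso :: "'a cyc_pair \<Rightarrow> 'b cyc_pair \<Rightarrow> bool" where
  "pair_iso \<G> \<H> \<longleftrightarrow>
     (\<exists>f \<in> iso \<G> \<H>. homeomorphic_map (topo \<G>) (topo \<H>) f \<and>
        (\<forall>x\<in>carrier \<G>. chr \<H> (f x) = chr \<G> x))"


subsection \<open>The basic pairs\<close>

definition trivial_pair :: "unit cyc_pair" where
  "trivial_pair = \<lparr>carrier = UNIV, mult = (\<lambda>_ _. ()), one = (),
     topo = discrete_topology UNIV, chr = (\<lambda>_. 1)\<rparr>"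

definition two_adic_group :: "two_adic top_group" where
  "two_adic_group = \<lparr>carrier = UNIV, mult = (+), one = 0, topo = two_adic_topology\<rparr>"

definition Z_pair :: "two_adic \<Rightarrow> two_adic cyc_pair" where
  "Z_pair \<alpha> = \<lparr>carrier = UNIV, mult = (+), one = 0, topo = two_adic_topology,
     chr = (THE \<theta>. cont_unit_character two_adic_group \<theta> \<and> \<theta> 1 = \<alpha>)\<rparr>"

definition E_pair :: "bit cyc_pair" where
  "E_pair = \<lparr>carrier = UNIV, mult = (+), one = 0,
     topo = discrete_topology UNIV, chr = (\<lambda>b. if b = 0 then 1 else -1)\<rparr>"


subsection \<open>Extensions and free products\<close>

definition extension_pair :: "'a cyc_pair \<Rightarrow> (two_adic \<times> 'a) cyc_pair" where
  "extension_pair \<G> = \<lparr>carrier = UNIV \<times> carrier \<G>,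
     mult = (\<lambda>(a, g) (b, h). (a + chr \<G> g * b, g \<otimes>\<^bsub>\<G>\<^esub> h)),
     one = (0, \<one>\<^bsub>\<G>\<^esub>),
     topo = prod_topology two_adic_topology (topo \<G>),
     chr = (\<lambda>(a, g). chr \<G> g)\<rparr>"

text \<open>
  The type on which abstract pro-2 groups live. It has the cardinality of the continuum, so it
  carries copies of all finite groups and of all topologically finitely generated pro-2 groups;
  all members of $\mathrm{ET}_2$ are of the latter kind.
\<close>

type_synonym univ = "nat \<Rightarrow> nat"

text \<open>
  Universal property of $G = G_1 *_2 G_2$ in the category of pro-2 groups. Test groups on
  \<open>univ\<close> suffice, since every pro-2 group is an inverse limit of finite 2-groups.
\<close>

definition is_free_pro_2_product ::
    "('a, 'd) top_group_scheme \<Rightarrow> ('a \<Rightarrow> 'c) \<Rightarrow> ('b, 'e) top_group_scheme \<Rightarrow> ('b \<Rightarrow> 'c) \<Rightarrow>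
     ('c, 'f) top_group_scheme \<Rightarrow> bool" where
  "is_free_pro_2_product G\<^sub>1 \<iota>\<^sub>1 G\<^sub>2 \<iota>\<^sub>2 G \<longleftrightarrow>
     pro_2_group G \<and> \<iota>\<^sub>1 \<in> cont_hom G\<^sub>1 G \<and> \<iota>\<^sub>2 \<in> cont_hom G\<^sub>2 G \<and>
     (\<forall>(H :: univ top_group) f\<^sub>1 f\<^sub>2.
        pro_2_group H \<and> f\<^sub>1 \<in> cont_hom G\<^sub>1 H \<and> f\<^sub>2 \<in> cont_hom G\<^sub>2 H \<longrightarrow>
        (\<exists>f \<in> cont_hom G H.
           (\<forall>x\<in>carrier G\<^sub>1. f (\<iota>\<^sub>1 x) = f\<^sub>1 x) \<and> (\<forall>x\<in>carrier G\<^sub>2. f (\<iota>\<^sub>2 x) = f\<^sub>2 x) \<and>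
           (\<forall>f' \<in> cont_hom G H.
              (\<forall>x\<in>carrier G\<^sub>1. f' (\<iota>\<^sub>1 x) = f\<^sub>1 x) \<and> (\<forall>x\<in>carrier G\<^sub>2. f' (\<iota>\<^sub>2 x) = f\<^sub>2 x) \<longrightarrow>
              (\<forall>x\<in>carrier G. f' x = f x))))"

definition is_free_product :: "'a cyc_pair \<Rightarrow> 'b cyc_pair \<Rightarrow> 'c cyc_pair \<Rightarrow> bool" where
  "is_free_product \<G>\<^sub>1 \<G>\<^sub>2 \<G> \<longleftrightarrow>
     (\<exists>\<iota>\<^sub>1 \<iota>\<^sub>2. is_free_pro_2_product \<G>\<^sub>1 \<iota>\<^sub>1 \<G>\<^sub>2 \<iota>\<^sub>2 \<G> \<and>
        (\<forall>x\<in>carrier \<G>\<^sub>1. chr \<G> (\<iota>\<^sub>1 x) = chr \<G>\<^sub>1 x) \<and>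
        (\<forall>x\<in>carrier \<G>\<^sub>2. chr \<G> (\<iota>\<^sub>2 x) = chr \<G>\<^sub>2 x))"


subsection \<open>Pairs of 2-adic type\<close>

text \<open>
  Finite extensions of $\mathbb{Q}_2$ are taken inside a fixed algebraic closure.
\<close>

type_synonym Q2bar = "two_adic fract alg_closure"

definition Q2bar :: "Q2bar ring" where
  "Q2bar = ring_of_type_algebra"

definition finite_ext_Q2 :: "Q2bar set \<Rightarrow> bool" where
  "finite_ext_Q2 K \<longleftrightarrow>
     subfield K Q2bar \<and> range to_ac \<subseteq> K \<and> ring.finite_dimension Q2bar (range to_ac) K"

text \<open>Automorphisms of \<open>L\<close> over \<open>K\<close>, as functions that are \<open>undefined\<close> outside \<open>L\<close>.\<close>

definition Aut_over :: "Q2bar set \<Rightarrow> Q2bar set \<Rightarrow> (Q2bar \<Rightarrow> Q2bar) set" where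
  "Aut_over K L = {\<sigma> \<in> extensional L.
     \<sigma> \<in> ring_iso (Q2bar\<lparr>carrier := L\<rparr>) (Q2bar\<lparr>carrier := L\<rparr>) \<and> (\<forall>x\<in>K. \<sigma> x = x)}"

definition galois_2_ext :: "Q2bar set \<Rightarrow> Q2bar set \<Rightarrow> bool" where
  "galois_2_ext K L \<longleftrightarrow>
     subfield L Q2bar \<and> K \<subseteq> L \<and> (\<exists>n. ring.dimension Q2bar (2 ^ n) K L) \<and>
     {x \<in> L. \<forall>\<sigma>\<in>Aut_over K L. \<sigma> x = x} = K"

text \<open>The maximal pro-2 extension $K(2)$: the compositum of all finite Galois 2-extensions.\<close>

definition max_pro_2_ext :: "Q2bar set \<Rightarrow> Q2bar set" where
  "max_pro_2_ext K = generate_field Q2bar (\<Union>{L. galois_2_ext K L})"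

definition cyclotomic_character :: "(Q2bar \<Rightarrow> Q2bar) \<Rightarrow> two_adic" where
  "cyclotomic_character \<sigma> =
     (THE u. u dvd 1 \<and> (\<forall>n \<zeta>. \<zeta> ^ (2 ^ n) = 1 \<longrightarrow> \<sigma> \<zeta> = \<zeta> ^ nat (res u n)))"

text \<open>
  The pair $(G_K(2), \chi_K)$ with the Krull topology, whose subbasic open sets are the
  $\{\sigma \mid \sigma(x) = y\}$.
\<close>

definition galois_pair :: "Q2bar set \<Rightarrow> (Q2bar \<Rightarrow> Q2bar) cyc_pair" where
  "galois_pair K = (let M = max_pro_2_ext K; A = Aut_over K M in
     \<lparr>carrier = A, mult = compose M, one = (\<lambda>x\<in>M. x),
      topo = topology_generated_by {{\<sigma> \<in> A. \<sigma> x = y} | x y. x \<in> M \<and> y \<in> M},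
      chr = cyclotomic_character\<rparr>)"


subsection \<open>The class $\mathrm{ET}_2$\<close>

inductive ET2_univ :: "univ cyc_pair \<Rightarrow> bool" where
  trivial: "cyclotomic_pair \<G> \<Longrightarrow> pair_iso \<G> trivial_pair \<Longrightarrow> ET2_univ \<G>"
| Z: "cyclotomic_pair \<G> \<Longrightarrow> \<alpha> dvd 1 \<Longrightarrow> pair_iso \<G> (Z_pair \<alpha>) \<Longrightarrow> ET2_univ \<G>"
| E: "cyclotomic_pair \<G> \<Longrightarrow> pair_iso \<G> E_pair \<Longrightarrow> ET2_univ \<G>"
| two_adic_type:
    "cyclotomic_pair \<G> \<Longrightarrow> finite_ext_Q2 K \<Longrightarrow> pair_iso \<G> (galois_pair K) \<Longrightarrow> ET2_univ \<G>"
| free_product: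
    "cyclotomic_pair \<G> \<Longrightarrow> ET2_univ \<G>\<^sub>1 \<Longrightarrow> ET2_univ \<G>\<^sub>2 \<Longrightarrow>
     is_free_product \<G>\<^sub>1 \<G>\<^sub>2 \<G> \<Longrightarrow> ET2_univ \<G>"
| extension:
    "cyclotomic_pair \<G> \<Longrightarrow> ET2_univ \<H> \<Longrightarrow> pair_iso \<G> (extension_pair \<H>) \<Longrightarrow> ET2_univ \<G>"

definition ET2 :: "'a cyc_pair \<Rightarrow> bool" where
  "ET2 \<G> \<longleftrightarrow> cyclotomic_pair \<G> \<and> (\<exists>\<H>. ET2_univ \<H> \<and> pair_iso \<G> \<H>)"


section \<open>Continuous cohomology with coefficients in $\mathbb{Z}/2$\<close>

text \<open>
  $G^n$ consists of the extensional functions on $\{0,\dots,n-1\}$; inhomogeneous cochains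
  are normalised to vanish outside $G^n$. Signs are omitted since the coefficients are
  $\mathbb{Z}/2$.
\<close>

abbreviation tuples :: "('a, 'b) top_group_scheme \<Rightarrow> nat \<Rightarrow> (nat \<Rightarrow> 'a) set" where
  "tuples G n \<equiv> (\<Pi>\<^sub>E i\<in>{..<n}. carrier G)"

definition cochains :: "('a, 'b) top_group_scheme \<Rightarrow> nat \<Rightarrow> ((nat \<Rightarrow> 'a) \<Rightarrow> bit) set" where
  "cochains G n = {c. continuous_map (product_topology (\<lambda>_. topo G) {..<n})
     (discrete_topology UNIV) c \<and> (\<forall>x. x \<notin> tuples G n \<longrightarrow> c x = 0)}"

definition coboundary ::
    "('a, 'b) top_group_scheme \<Rightarrow> nat \<Rightarrow> ((nat \<Rightarrow> 'a) \<Rightarrow> bit) \<Rightarrow> (nat \<Rightarrow> 'a) \<Rightarrow> bit" where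
  "coboundary G n c x = (if x \<in> tuples G (Suc n) then
       c (\<lambda>i\<in>{..<n}. x (Suc i)) +
       (\<Sum>j<n. c (\<lambda>i\<in>{..<n}.
          if i < j then x i else if i = j then x j \<otimes>\<^bsub>G\<^esub> x (Suc j) else x (Suc i))) +
       c (restrict x {..<n})
     else 0)"

definition cocycle_group :: "('a, 'b) top_group_scheme \<Rightarrow> nat \<Rightarrow> ((nat \<Rightarrow> 'a) \<Rightarrow> bit) monoid" where
  "cocycle_group G n = \<lparr>carrier = {c \<in> cochains G n. coboundary G n c = (\<lambda>_. 0)},
     mult = (\<lambda>c d x. c x + d x), one = (\<lambda>_. 0)\<rparr>"

definition coboundaries :: "('a, 'b) top_group_scheme \<Rightarrow> nat \<Rightarrow> ((nat \<Rightarrow> 'a) \<Rightarrow> bit) set" where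
  "coboundaries G n = (case n of 0 \<Rightarrow> {\<lambda>_. 0} | Suc k \<Rightarrow> coboundary G k ` cochains G k)"

definition cohomology ::
    "('a, 'b) top_group_scheme \<Rightarrow> nat \<Rightarrow> ((nat \<Rightarrow> 'a) \<Rightarrow> bit) set monoid" where
  "cohomology G n = cocycle_group G n Mod coboundaries G n"

definition coh_class ::
    "('a, 'b) top_group_scheme \<Rightarrow> nat \<Rightarrow> ((nat \<Rightarrow> 'a) \<Rightarrow> bit) \<Rightarrow> ((nat \<Rightarrow> 'a) \<Rightarrow> bit) set" where
  "coh_class G n c = coboundaries G n #>\<^bsub>cocycle_group G n\<^esub> c"

definition cochain_cup ::
    "('a, 'b) top_group_scheme \<Rightarrow> nat \<Rightarrow> nat \<Rightarrow> ((nat \<Rightarrow> 'a) \<Rightarrow> bit) \<Rightarrow> ((nat \<Rightarrow> 'a) \<Rightarrow> bit) \<Rightarrow>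
     (nat \<Rightarrow> 'a) \<Rightarrow> bit" where
  "cochain_cup G p q c d x = (if x \<in> tuples G (p + q)
     then c (restrict x {..<p}) * d (\<lambda>i\<in>{..<q}. x (p + i)) else 0)"

text \<open>
  The cup product of cohomology classes, given by all products of representatives; this is a
  single class because the product on cochains satisfies the Leibniz rule.
\<close>

definition cup ::
    "('a, 'b) top_group_scheme \<Rightarrow> nat \<Rightarrow> nat \<Rightarrow> ((nat \<Rightarrow> 'a) \<Rightarrow> bit) set \<Rightarrow>
     ((nat \<Rightarrow> 'a) \<Rightarrow> bit) set \<Rightarrow> ((nat \<Rightarrow> 'a) \<Rightarrow> bit) set" where
  "cup G p q A B = (\<Union>c\<in>A. \<Union>d\<in>B. coh_class G (p + q) (cochain_cup G p q c d))"

primrec cup_power ::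
    "('a, 'b) top_group_scheme \<Rightarrow> ((nat \<Rightarrow> 'a) \<Rightarrow> bit) set \<Rightarrow> nat \<Rightarrow> ((nat \<Rightarrow> 'a) \<Rightarrow> bit) set" where
  "cup_power G A 0 = coh_class G 0 (\<lambda>x. if x \<in> tuples G 0 then 1 else 0)"
| "cup_power G A (Suc m) = cup G m 1 (cup_power G A m) A"


section \<open>The logarithmic level\<close>

definition eps_class :: "'a cyc_pair \<Rightarrow> ((nat \<Rightarrow> 'a) \<Rightarrow> bit) set" where
  "eps_class \<G> = coh_class \<G> 1
     (\<lambda>x. if x \<in> tuples \<G> 1 then (if sign_part (chr \<G> (x 0)) = 1 then 0 else 1) else 0)"

definition log_level :: "'a cyc_pair \<Rightarrow> enat" where
  "log_level \<G> =
     (let P = (\<lambda>m. m \<ge> 1 \<and> cup_power \<G> (eps_class \<G>) m = \<one>\<^bsub>cohomology \<G> m\<^esub>)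
      in if \<exists>m. P m then enat (LEAST m. P m) else \<infinity>)"

end

(*
  Write e for the class of the pair in H^1(G, Z/2). If G contains an involution g with e(g) = 1,
  all powers of e restrict to nonzero classes of the subgroup {1, g}, and the level is infinite.
  Every other pair of the class carries characters x, y with xe = ye = (y + e)(x + e) = 0, which
  gives e^2 = yx and e^3 = yxe = 0, so the level is at most 3.

  The alternative is inherited by extensions (through the projection and its section) and by free
  products: involutions map to the free product, and a relation xy = 0 between characters says that
  (x, y) lifts to the group of unitriangular 3 x 3 matrices over F_2, so the universal property
  applies. For a finite extension of Q_2 the characters x, y belong to the square roots of 2 and 5;
  the three relations hold because 2 = 1 + 1 and 5 = 1 + 4 are norms from K(i), and because -7 is a
  square in Q_2 and -5 = -7 + 2, so that -5 is a norm from the field obtained by adjoining the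
  square root of -2.
*)

theory Submission
  imports Defs
begin

section \<open>Units of the 2-adic integers\<close>

text \<open>The vanishing of e^3 is a statement in degree 3, about which the universal property of a
  free product says nothing directly. The vanishing of a product of two characters, by contrast, is
  a lifting to a finite 2-group and can be glued from the factors. This is why the induction carries
  three relations in degree 2 instead of e^3 = 0 itself. The elements 2 and 5 come from quaternion
  algebras over Q_2: (-1,-1) and (2,5) are both the nonsplit one, which is what e^2 = yx expresses.
  The three norm identities already hold over Q_2, so the same two elements serve every finite
  extension. Each relation is stored with a witness, a function b with b(gh) = b(g) + b(h) + x(g)
  y(h). From such witnesses the cube of e is written as an explicit coboundary.\<close>

lemma res_of_nat: "res (of_nat k) n = int k mod 2 ^ n"
proof (induction k)
  case (Suc k)
  then show ?case
    by (simp add: plus_two_adic.rep_eq one_two_adic.rep_eq mod_simps)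
qed (simp add: zero_two_adic.rep_eq)

lemma res_of_int: "res (of_int k) n = k mod 2 ^ n"
  by (cases k rule: int_cases2)
    (simp_all add: res_of_nat uminus_two_adic.rep_eq mod_simps)

lemma res_bounds: "0 \<le> res a n" "res a n < 2 ^ n"
  by (metis res_mod pos_mod_sign pos_mod_bound zero_less_power zero_less_numeral)+

lemma two_adic_of_coherent:
  assumes "\<And>n. f n = f (Suc n) mod 2 ^ n"
  obtains a where "\<And>n. res a n = f n"
proof
  have "f \<in> {a. \<forall>n. a n = a (Suc n) mod 2 ^ n}"
    using assms by blast
  then show "res (Abs_two_adic f) n = f n" for n
    by (simp only: Abs_two_adic_inverse)
qed

lemma two_power_dvd_iff: "2 ^ k dvd (a :: two_adic) \<longleftrightarrow> res a k = 0"
proof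
  assume "2 ^ k dvd a"
  moreover have "res (2 ^ k) k = 0"
    using res_of_int[of "2 ^ k" k] by simp
  ultimately show "res a k = 0"
    by (auto simp: dvd_def times_two_adic.rep_eq)
next
  assume a: "res a k = 0"
  \<comment> \<open>Division by 2^k costs k digits, so the n-th residue of the quotient has to be
    read off from the (n + k)-th residue of \<open>a\<close>.\<close>
  have "res a (n + k) div 2 ^ k = res a (Suc n + k) div 2 ^ k mod 2 ^ n" for n
  proof -
    have "res a (n + k) = res a (Suc n + k) mod (2 ^ k * 2 ^ n)"
      using res_Suc[of a "n + k"] by (simp add: power_add mult.commute)
    also have "\<dots> div 2 ^ k = res a (Suc n + k) div 2 ^ k mod 2 ^ n"
      by (subst zmod_zmult2_eq) simp_all
    finally show ?thesis .
  qed
  then obtain c where c: "\<And>n. res c n = res a (n + k) div 2 ^ k"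
    using two_adic_of_coherent[of "\<lambda>n. res a (n + k) div 2 ^ k"] by blast
  have "a = 2 ^ k * c"
  proof (rule two_adic_eqI)
    fix n
    have "res a (n + k) mod 2 ^ k = 0"
      using res_mod_le[of k "n + k" a] a by simp
    then have *: "2 ^ k * (res a (n + k) div 2 ^ k) = res a (n + k)"
      by (metis add.right_neutral mult_div_mod_eq)
    have "res (2 ^ k * c) n = res a (n + k) mod 2 ^ n"
      using res_of_int[of "2 ^ k" n] by (simp add: times_two_adic.rep_eq c mod_simps *)
    then show "res a n = res (2 ^ k * c) n"
      using res_mod_le[of n "n + k" a] by simp
  qed
  then show "2 ^ k dvd a"
    by simp
qed

lemma four_dvd_iff: "4 dvd (a :: two_adic) \<longleftrightarrow> res a 2 = 0"
  using two_power_dvd_iff[of 2 a] by simp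

lemma res_unit_cases:
  assumes "(u :: two_adic) dvd 1"
  shows "res u 2 = 1 \<or> res u 2 = 3"
proof -
  from assms obtain v where uv: "u * v = 1"
    by (metis dvdE)
  have "res u 2 * res v 2 mod 4 = 1"
    using arg_cong[OF uv, of "\<lambda>a. res a 2"]
    by (simp add: one_two_adic.rep_eq times_two_adic.rep_eq)
  moreover have "res u 2 \<in> {0..<4}"
    using res_bounds[of u 2] by simp
  then have "res u 2 \<in> {0,1,2,3}"
    by auto
  ultimately show ?thesis
    by (auto; presburger)
qed

text \<open>A unit is 1 or 3 modulo 4, and its residue decides the factor in {1, -1}. This gives a
  computable, additive form of \<open>sign_part\<close>, which is a definite description.\<close>

definition sign_bit :: "two_adic \<Rightarrow> bit" where
  "sign_bit u = (if res u 2 = 1 then 0 else 1)"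

lemma one_neq_uminus_one_two_adic: "(1 :: two_adic) \<noteq> -1"
proof
  assume "(1 :: two_adic) = -1"
  from arg_cong[OF this, of "\<lambda>a. res a 2"] show False
    by (simp add: uminus_two_adic.rep_eq one_two_adic.rep_eq del: one_neq_neg_one)
qed

lemma sign_part_eq_1_iff:
  assumes "u dvd 1"
  shows "sign_part u = 1 \<longleftrightarrow> sign_bit u = 0"
proof -
  \<comment> \<open>The description has exactly one solution: the cofactor \<open>v\<close> must be
    \<open>u\<close> or \<open>- u\<close>, and exactly one of these is 1 modulo 4.\<close>
  have P: "(s \<in> {1, -1} \<and> (\<exists>v. 4 dvd v - 1 \<and> u = s * v)) \<longleftrightarrow> s = (if res u 2 = 1 then 1 else -1)" for s
  proof -
    have v: "4 dvd v - 1 \<longleftrightarrow> res v 2 = 1" for v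
      using res_bounds[of v 2]
      by (auto simp: four_dvd_iff minus_two_adic.rep_eq one_two_adic.rep_eq; presburger)
    have m: "res (- u) 2 = 1 \<longleftrightarrow> res u 2 = 3"
      using res_bounds[of u 2] by (auto simp: uminus_two_adic.rep_eq; presburger)
    have "(\<exists>v. 4 dvd v - 1 \<and> u = v) \<longleftrightarrow> res u 2 = 1"
      by (auto simp: v)
    moreover have "(\<exists>v. 4 dvd v - 1 \<and> u = - v) \<longleftrightarrow> res u 2 = 3"
      unfolding v by (metis m minus_minus)
    moreover note one_neq_uminus_one_two_adic
    ultimately show ?thesis
      using res_unit_cases[OF assms] by auto
  qed
  with one_neq_uminus_one_two_adic show ?thesis
    unfolding sign_part_def P by (simp add: sign_bit_def)
qed

lemma sign_bit_1 [simp]: "sign_bit 1 = 0"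
  by (simp add: sign_bit_def one_two_adic.rep_eq)

lemma sign_bit_uminus_1 [simp]: "sign_bit (-1) = 1"
  by (simp add: sign_bit_def uminus_two_adic.rep_eq one_two_adic.rep_eq)

lemma sign_bit_mult:
  assumes "u dvd 1" "v dvd 1"
  shows "sign_bit (u * v) = sign_bit u + sign_bit v"
  using res_unit_cases[OF assms(1)] res_unit_cases[OF assms(2)]
  by (auto simp: sign_bit_def times_two_adic.rep_eq)

section \<open>Continuity of residues\<close>

lemma topspace_two_adic [simp]: "topspace two_adic_topology = UNIV"
  by (simp add: two_adic_topology_def topspace_pullback_topology)

lemma continuous_map_res: "continuous_map two_adic_topology (discrete_topology UNIV) (\<lambda>a. res a n)"
proof -
  have "continuous_map two_adic_topology (product_topology (\<lambda>_. discrete_topology UNIV) UNIV) res"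
    unfolding two_adic_topology_def by (rule continuous_map_pullback[of _ _ id, simplified]) simp
  then show ?thesis
    by (simp add: continuous_map_componentwise_UNIV)
qed

lemma continuous_map_discrete_comp:
  assumes "continuous_map T (discrete_topology UNIV) f"
  shows "continuous_map T (discrete_topology UNIV) (\<lambda>x. k (f x))"
  using continuous_map_compose[OF assms, of "discrete_topology UNIV" k]
  by (simp add: o_def)

lemma continuous_map_discrete_comp2:
  assumes "continuous_map T (discrete_topology UNIV) f" "continuous_map T (discrete_topology UNIV) g"
  shows "continuous_map T (discrete_topology UNIV) (\<lambda>x. k (f x) (g x))"
proof -
  have "continuous_map T (discrete_topology UNIV) (\<lambda>x. (f x, g x))"
    using continuous_map_pairedI[OF assms] by (simp flip: prod_topology_discrete_topology)
  from continuous_map_discrete_comp[OF this, of "\<lambda>(a, b). k a b"] show ?thesis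
    by simp
qed

lemma continuous_map_sign_bit: "continuous_map two_adic_topology (discrete_topology UNIV) sign_bit"
  unfolding sign_bit_def by (rule continuous_map_discrete_comp) (rule continuous_map_res)

section \<open>Cup powers of characters\<close>

declare add_bit_eq_xor [simp del] mult_bit_eq_and [simp del]

text \<open>Once a sum of bits is sorted by \<open>algebra_simps\<close>, equal summands are
  adjacent and these rules cancel them. Cochain identities modulo 2 are verified this way, so bits
  are kept in ring notation rather than rewritten to xor and and.\<close>

lemma bit_add_self [simp]: "(a :: bit) + a = 0" "a + (a + b) = b"
  by (cases a; simp)+

text \<open>The standard cochain representing the n-fold cup power of a character; it vanishes
  outside the tuples because cochains are normalised so.\<close>

definition char_power :: "('a, 'b) top_group_scheme \<Rightarrow> ('a \<Rightarrow> bit) \<Rightarrow> nat \<Rightarrow> (nat \<Rightarrow> 'a) \<Rightarrow> bit" where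
  "char_power G e n x = (if x \<in> tuples G n then \<Prod>i<n. e (x i) else 0)"

section \<open>Cochains and classes modulo 2\<close>

lemma zero_in_cochains: "(\<lambda>_. 0) \<in> cochains G n"
  by (simp add: cochains_def)

lemma add_in_cochains:
  assumes "c \<in> cochains G n" "d \<in> cochains G n"
  shows "(\<lambda>x. c x + d x) \<in> cochains G n"
  using assms by (auto simp: cochains_def intro: continuous_map_discrete_comp2)

lemma coboundary_zero: "coboundary G n (\<lambda>_. 0) = (\<lambda>_. 0)"
  by (auto simp: coboundary_def fun_eq_iff)

lemma coboundary_add: "coboundary G n (\<lambda>x. c x + d x) = (\<lambda>x. coboundary G n c x + coboundary G n d x)"
  by (rule ext) (simp add: coboundary_def sum.distrib algebra_simps)

text \<open>Both outer terms evaluate \<open>c\<close> at the empty tuple, and they cancel modulo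
  2.\<close>

lemma coboundary_0: "coboundary G 0 c = (\<lambda>_. 0)"
  by (auto simp: coboundary_def fun_eq_iff restrict_def)

lemma zero_in_coboundaries: "(\<lambda>_. 0) \<in> coboundaries G n"
proof (cases n)
  case (Suc k)
  then show ?thesis
    using zero_in_cochains[of G k] coboundary_zero[of G k] by (force simp: coboundaries_def)
qed (simp add: coboundaries_def)

lemma add_in_coboundaries:
  assumes "c \<in> coboundaries G n" "d \<in> coboundaries G n"
  shows "(\<lambda>x. c x + d x) \<in> coboundaries G n"
proof (cases n)
  case (Suc k)
  with assms obtain c' d' where "c = coboundary G k c'" "d = coboundary G k d'"
    "c' \<in> cochains G k" "d' \<in> cochains G k"
    by (auto simp: coboundaries_def)
  then show ?thesis
    using add_in_cochains[of c' G k d'] coboundary_add[of G k c' d'] Suc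
    by (force simp: coboundaries_def)
qed (use assms in \<open>simp add: coboundaries_def\<close>)

text \<open>Consequently a class in degree 1 has a single representative, and the class of a
  character is the singleton of that character.\<close>

lemma coboundaries_1: "coboundaries G (Suc 0) = {\<lambda>_. 0}"
  using zero_in_cochains[of G 0] by (auto simp: coboundaries_def coboundary_0)

lemma mem_coh_class_iff: "d \<in> coh_class G n c \<longleftrightarrow> (\<exists>b\<in>coboundaries G n. d = (\<lambda>x. b x + c x))"
  by (auto simp: coh_class_def r_coset_def cocycle_group_def)

lemma coh_class_add_coboundary:
  assumes "b \<in> coboundaries G n"
  shows "coh_class G n (\<lambda>x. c x + b x) = coh_class G n c"
proof (intro equalityI subsetI)
  fix d assume "d \<in> coh_class G n (\<lambda>x. c x + b x)"
  then obtain b' where b': "b' \<in> coboundaries G n" "d = (\<lambda>x. b' x + (c x + b x))"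
    by (auto simp: mem_coh_class_iff)
  then have "d = (\<lambda>x. (b' x + b x) + c x)"
    by (simp add: algebra_simps)
  then show "d \<in> coh_class G n c"
    unfolding mem_coh_class_iff using add_in_coboundaries[OF b'(1) assms]
      by (rule bexI[where x = "\<lambda>x. b' x + b x"])
next
  fix d assume "d \<in> coh_class G n c"
  then obtain b' where b': "b' \<in> coboundaries G n" "d = (\<lambda>x. b' x + c x)"
    by (auto simp: mem_coh_class_iff)
  then have "d = (\<lambda>x. (b' x + b x) + (c x + b x))"
    by (simp add: algebra_simps)
  then show "d \<in> coh_class G n (\<lambda>x. c x + b x)"
    unfolding mem_coh_class_iff using add_in_coboundaries[OF b'(1) assms]
      by (rule bexI[where x = "\<lambda>x. b' x + b x"])
qed

lemma coh_class_eq_one_iff: "coh_class G n c = \<one>\<^bsub>cohomology G n\<^esub> \<longleftrightarrow> c \<in> coboundaries G n"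
proof -
  have "\<one>\<^bsub>cohomology G n\<^esub> = coboundaries G n"
    by (simp add: cohomology_def FactGroup_def)
  moreover have "c \<in> coh_class G n c"
    unfolding mem_coh_class_iff using zero_in_coboundaries by force
  moreover have "coh_class G n c = coboundaries G n" if "c \<in> coboundaries G n"
  proof -
    have "coh_class G n (\<lambda>_. 0) = coboundaries G n"
      by (rule Set.set_eqI) (simp add: mem_coh_class_iff)
    then show ?thesis
      using coh_class_add_coboundary[OF that, of "\<lambda>_. 0"] by simp
  qed
  ultimately show ?thesis
    by auto
qed

section \<open>Multiplication by a character\<close>

lemma cochain_cup_char:
  assumes "x \<in> tuples G (Suc k)"
  shows "cochain_cup G k (Suc 0) u (char_power G e (Suc 0)) x = u (restrict x {..<k}) * e (x k)"
  using assms by (auto simp: cochain_cup_def char_power_def PiE_iff)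

lemma cochain_cup_in_cochains:
  assumes G: "topspace (topo G) = carrier G"
    and e: "continuous_map (topo G) (discrete_topology UNIV) e"
    and u: "u \<in> cochains G k"
  shows "cochain_cup G k (Suc 0) u (char_power G e (Suc 0)) \<in> cochains G (Suc k)"
proof -
  let ?T = "\<lambda>k. product_topology (\<lambda>_. topo G) {..<k}"
  have "continuous_map (?T (Suc k)) (?T k) (\<lambda>x. restrict x {..<k})"
    by (auto simp: continuous_map_componentwise intro!: continuous_map_product_projection)
  moreover have "continuous_map (?T k) (discrete_topology UNIV) u"
    using u by (simp add: cochains_def)
  ultimately have 1: "continuous_map (?T (Suc k)) (discrete_topology UNIV) (\<lambda>x. u (restrict x {..<k}))"
    by (rule continuous_map_compose[unfolded o_def])
  have "continuous_map (?T (Suc k)) (topo G) (\<lambda>x. x k)"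
    by (rule continuous_map_product_projection) simp
  then have 2: "continuous_map (?T (Suc k)) (discrete_topology UNIV) (\<lambda>x. e (x k))"
    using continuous_map_compose[OF _ e] by (simp add: o_def)
  have "continuous_map (?T (Suc k)) (discrete_topology UNIV) (cochain_cup G k (Suc 0) u (char_power G e (Suc 0)))"
    by (rule continuous_map_eq[OF continuous_map_discrete_comp2[OF 1 2, of "(*)"]])
      (simp add: G cochain_cup_char)
  then show ?thesis
    by (auto simp: cochains_def cochain_cup_def)
qed

text \<open>The Leibniz rule for a second factor with zero coboundary. The face that multiplies the
  last two entries contributes \<open>u\<close> times a sum of two values of \<open>e\<close>: one
  half cancels the final face, the other half is the final face of the coboundary of
  \<open>u\<close>.\<close>

lemma coboundary_cochain_cup_char:
  assumes G: "group G"
    and e: "\<And>x y. x \<in> carrier G \<Longrightarrow> y \<in> carrier G \<Longrightarrow> e (x \<otimes>\<^bsub>G\<^esub> y) = e x + e y"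
  shows "coboundary G (Suc k) (cochain_cup G k (Suc 0) u (char_power G e (Suc 0))) =
    cochain_cup G (Suc k) (Suc 0) (coboundary G k u) (char_power G e (Suc 0))"
proof (rule ext)
  fix x
  interpret group G by fact
  show "coboundary G (Suc k) (cochain_cup G k (Suc 0) u (char_power G e (Suc 0))) x =
    cochain_cup G (Suc k) (Suc 0) (coboundary G k u) (char_power G e (Suc 0)) x"
  proof (cases "x \<in> tuples G (Suc (Suc k))")
    case True
    then have xc: "x i \<in> carrier G" if "i < Suc (Suc k)" for i
      using that by auto
    let ?m = "\<lambda>n j. \<lambda>i\<in>{..<n}. if i < j then x i else if i = j then x j \<otimes>\<^bsub>G\<^esub> x (Suc j) else x (Suc i)"
    have m: "?m (Suc k) j \<in> tuples G (Suc k)" if "j < Suc k" for j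
      using xc that by (auto simp: PiE_iff)
    have mk: "restrict (?m (Suc k) j) {..<k} = ?m k j" for j
      by (rule ext) simp
    have mk': "(\<lambda>i\<in>{..<k}. if i < j then restrict x {..<Suc k} i
        else if i = j then restrict x {..<Suc k} j \<otimes>\<^bsub>G\<^esub> restrict x {..<Suc k} (Suc j)
        else restrict x {..<Suc k} (Suc i)) = ?m k j" if "j < k" for j
      using that by (auto simp: fun_eq_iff)
    have mkk: "?m k k = restrict x {..<k}"
      by (auto simp: fun_eq_iff)
    have s: "(\<lambda>i\<in>{..<Suc k}. x (Suc i)) \<in> tuples G (Suc k)" "restrict x {..<Suc k} \<in> tuples G (Suc k)"
      using xc by auto
    have "coboundary G (Suc k) (cochain_cup G k (Suc 0) u (char_power G e (Suc 0))) x =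
      u (\<lambda>i\<in>{..<k}. x (Suc i)) * e (x (Suc k)) +
      ((\<Sum>j<k. u (?m k j) * e (x (Suc k))) + u (restrict x {..<k}) * (e (x k) + e (x (Suc k)))) +
      u (restrict x {..<k}) * e (x k)"
    proof -
      have "(\<Sum>j<Suc k. cochain_cup G k (Suc 0) u (char_power G e (Suc 0)) (?m (Suc k) j)) =
        (\<Sum>j<k. u (?m k j) * e (x (Suc k))) + u (?m k k) * e (x k \<otimes>\<^bsub>G\<^esub> x (Suc k))"
        using cochain_cup_char[OF m, of _ u e] by (simp only: sum.lessThan_Suc mk) (simp cong: sum.cong_simp)
      also have "e (x k \<otimes>\<^bsub>G\<^esub> x (Suc k)) = e (x k) + e (x (Suc k))"
        using xc by (intro e) auto
      finally have S: "(\<Sum>j<Suc k. cochain_cup G k (Suc 0) u (char_power G e (Suc 0)) (?m (Suc k) j)) =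
        (\<Sum>j<k. u (?m k j) * e (x (Suc k))) + u (restrict x {..<k}) * (e (x k) + e (x (Suc k)))"
        by (simp only: mkk)
      have "restrict (\<lambda>i\<in>{..<Suc k}. x (Suc i)) {..<k} = (\<lambda>i\<in>{..<k}. x (Suc i))"
        "restrict (restrict x {..<Suc k}) {..<k} = restrict x {..<k}"
        by (auto simp: fun_eq_iff)
      then show ?thesis
        unfolding coboundary_def S cochain_cup_char[OF s(1)] cochain_cup_char[OF s(2)]
        using True by simp
    qed
    also have "\<dots> = (u (\<lambda>i\<in>{..<k}. x (Suc i)) + (\<Sum>j<k. u (?m k j)) + u (restrict x {..<k})) * e (x (Suc k))"
      by (simp add: algebra_simps sum_distrib_left)
    also have "\<dots> = coboundary G k u (restrict x {..<Suc k}) * e (x (Suc k))"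
    proof -
      have "(\<lambda>i\<in>{..<k}. restrict x {..<Suc k} (Suc i)) = (\<lambda>i\<in>{..<k}. x (Suc i))"
        "restrict (restrict x {..<Suc k}) {..<k} = restrict x {..<k}"
        by (auto simp: fun_eq_iff)
      moreover have "(\<Sum>j<k. u (?m k j)) = (\<Sum>j<k. u (\<lambda>i\<in>{..<k}. if i < j then restrict x {..<Suc k} i
        else if i = j then restrict x {..<Suc k} j \<otimes>\<^bsub>G\<^esub> restrict x {..<Suc k} (Suc j)
        else restrict x {..<Suc k} (Suc i)))"
        using mk' by (intro sum.cong) simp_all
      ultimately show ?thesis
        using s(2) by (simp only: coboundary_def if_True)
    qed
    also have "\<dots> = cochain_cup G (Suc k) (Suc 0) (coboundary G k u) (char_power G e (Suc 0)) x"
      using cochain_cup_char[OF True] by simp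
    finally show ?thesis .
  qed (simp add: coboundary_def cochain_cup_def)
qed

text \<open>Since \<open>cup\<close> is a union over all representatives, the induction has to treat
  every representative of the m-th power. Two of them differ by a coboundary, and by the Leibniz
  rule a coboundary times a character is again a coboundary.\<close>

lemma cup_power_char:
  assumes G: "group G" "topspace (topo G) = carrier G"
    and e: "continuous_map (topo G) (discrete_topology UNIV) e"
      "\<And>x y. x \<in> carrier G \<Longrightarrow> y \<in> carrier G \<Longrightarrow> e (x \<otimes>\<^bsub>G\<^esub> y) = e x + e y"
  shows "cup_power G (coh_class G (Suc 0) (char_power G e (Suc 0))) m = coh_class G m (char_power G e m)"
proof (induction m)
  case 0
  show ?case
    by (simp add: char_power_def cong: if_cong)
next
  case (Suc m)
  have B: "coh_class G (Suc 0) (char_power G e (Suc 0)) = {char_power G e (Suc 0)}"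
    by (auto simp: mem_coh_class_iff coboundaries_1)
  have "coh_class G (Suc m) (cochain_cup G m (Suc 0) c (char_power G e (Suc 0))) = coh_class G (Suc m) (char_power G e (Suc m))"
    if c: "c \<in> coh_class G m (char_power G e m)" for c
  proof -
    from c obtain b where b: "b \<in> coboundaries G m" "c = (\<lambda>x. b x + char_power G e m x)"
      by (auto simp: mem_coh_class_iff)
    have "cochain_cup G m (Suc 0) b (char_power G e (Suc 0)) \<in> coboundaries G (Suc m)"
    proof (cases m)
      case 0
      then have "cochain_cup G m (Suc 0) b (char_power G e (Suc 0)) = (\<lambda>_. 0)"
        using b by (auto simp: coboundaries_def cochain_cup_def)
      then show ?thesis
        using zero_in_coboundaries by simp
    next
      case (Suc k)
      with b obtain u where u: "u \<in> cochains G k" "b = coboundary G k u"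
        by (auto simp: coboundaries_def)
      then have "cochain_cup G m (Suc 0) b (char_power G e (Suc 0)) =
          coboundary G m (cochain_cup G k (Suc 0) u (char_power G e (Suc 0)))"
        using coboundary_cochain_cup_char[OF G(1) e(2), of k u] Suc by simp
      then show ?thesis
        using cochain_cup_in_cochains[OF G(2) e(1) u(1)] Suc by (simp add: coboundaries_def)
    qed
    moreover have "cochain_cup G m (Suc 0) c (char_power G e (Suc 0)) =
        (\<lambda>x. char_power G e (Suc m) x + cochain_cup G m (Suc 0) b (char_power G e (Suc 0)) x)"
    proof (rule ext)
      fix x
      show "cochain_cup G m (Suc 0) c (char_power G e (Suc 0)) x =
        char_power G e (Suc m) x + cochain_cup G m (Suc 0) b (char_power G e (Suc 0)) x"
      proof (cases "x \<in> tuples G (Suc m)")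
        case True
        then have r: "restrict x {..<m} \<in> tuples G m"
          by (auto simp: PiE_iff)
        have "char_power G e (Suc m) x = char_power G e m (restrict x {..<m}) * e (x m)"
          unfolding char_power_def if_P[OF True] if_P[OF r] by simp
        then show ?thesis
          unfolding cochain_cup_char[OF True] b(2) by (simp add: distrib_right add.commute)
      qed (simp add: cochain_cup_def char_power_def)
    qed
    ultimately show ?thesis
      by (simp add: coh_class_add_coboundary)
  qed
  moreover have "char_power G e m \<in> coh_class G m (char_power G e m)"
    unfolding mem_coh_class_iff using zero_in_coboundaries by force
  ultimately show ?case
    unfolding cup_power.simps Suc.IH unfolding cup_def B by auto
qed

text \<open>Multiplying \<open>a\<close> by e on the right bounds (y + e)(x + e)e = yxe + yee + exe
  + eee. The first three products are bounded by y times \<open>b\<close>, \<open>d\<close> times e,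
  and e times \<open>b\<close>, with the factors in the order in which they occur. The sum of the
  four cochains therefore bounds eee.\<close>

lemma char_power_3_in_coboundaries:
  assumes G: "group G" "topspace (topo G) = carrier G"
    and cont: "continuous_map (topo G) (discrete_topology UNIV) e"
      "continuous_map (topo G) (discrete_topology UNIV) y"
      "continuous_map (topo G) (discrete_topology UNIV) a"
      "continuous_map (topo G) (discrete_topology UNIV) b"
      "continuous_map (topo G) (discrete_topology UNIV) d"
    and hom: "\<And>g h. g \<in> carrier G \<Longrightarrow> h \<in> carrier G \<Longrightarrow> e (g \<otimes>\<^bsub>G\<^esub> h) = e g + e h"
      "\<And>g h. g \<in> carrier G \<Longrightarrow> h \<in> carrier G \<Longrightarrow> y (g \<otimes>\<^bsub>G\<^esub> h) = y g + y h"
    and a: "\<And>g h. g \<in> carrier G \<Longrightarrow> h \<in> carrier G \<Longrightarrow>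
        a (g \<otimes>\<^bsub>G\<^esub> h) = a g + a h + (y g + e g) * (x h + e h)"
    and b: "\<And>g h. g \<in> carrier G \<Longrightarrow> h \<in> carrier G \<Longrightarrow> b (g \<otimes>\<^bsub>G\<^esub> h) = b g + b h + x g * e h"
    and d: "\<And>g h. g \<in> carrier G \<Longrightarrow> h \<in> carrier G \<Longrightarrow> d (g \<otimes>\<^bsub>G\<^esub> h) = d g + d h + y g * e h"
  shows "char_power G e 3 \<in> coboundaries G 3"
proof -
  interpret group G by fact
  let ?T = "product_topology (\<lambda>_. topo G) {..<2::nat}"
  let ?f = "\<lambda>g h. y g * b h + d g * e h + e g * b h + a g * e h"
  define c where "c z = (if z \<in> tuples G 2 then ?f (z 0) (z 1) else 0)" for z
  have comp: "continuous_map ?T (discrete_topology UNIV) (\<lambda>z. f (z i))"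
    if "i < 2" "continuous_map (topo G) (discrete_topology UNIV) f" for i :: nat and f :: "'a \<Rightarrow> bit"
  proof -
    have "continuous_map ?T (topo G) (\<lambda>z. z i)"
      by (rule continuous_map_product_projection) (use that in simp)
    from continuous_map_compose[OF this that(2)] show ?thesis
      by (simp add: o_def)
  qed
  have "continuous_map ?T (discrete_topology UNIV) (\<lambda>z. ?f (z 0) (z 1))"
    by (intro continuous_map_discrete_comp2[where k = "(+)"] continuous_map_discrete_comp2[where k = "(*)"]
        comp cont) simp_all
  then have "continuous_map ?T (discrete_topology UNIV) c"
    by (rule continuous_map_eq) (simp add: c_def G(2))
  then have "c \<in> cochains G 2"
    by (simp add: cochains_def c_def)
  moreover have "char_power G e 3 = coboundary G 2 c"
  proof (rule ext)
    fix z
    show "char_power G e 3 z = coboundary G 2 c z"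
    proof (cases "z \<in> tuples G 3")
      case True
      have z: "z 0 \<in> carrier G" "z 1 \<in> carrier G" "z 2 \<in> carrier G"
        by (rule PiE_mem[OF True], simp)+
      let ?t = "\<lambda>g h. \<lambda>i\<in>{..<2::nat}. if i = 0 then g else h"
      have t: "c (?t g h) = ?f g h" if "g \<in> carrier G" "h \<in> carrier G" for g h
        using that by (auto simp: c_def PiE_iff)
      have "(\<lambda>i\<in>{..<2}. z (Suc i)) = ?t (z 1) (z 2)"
        "restrict z {..<2} = ?t (z 0) (z 1)"
        "(\<lambda>i\<in>{..<2}. if i < 0 then z i else if i = 0 then z 0 \<otimes>\<^bsub>G\<^esub> z (Suc 0) else z (Suc i)) = ?t (z 0 \<otimes>\<^bsub>G\<^esub> z 1) (z 2)"
        "(\<lambda>i\<in>{..<2}. if i < Suc 0 then z i else if i = Suc 0 then z (Suc 0) \<otimes>\<^bsub>G\<^esub> z (Suc (Suc 0)) else z (Suc i)) =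
          ?t (z 0) (z 1 \<otimes>\<^bsub>G\<^esub> z 2)"
        by (auto simp: fun_eq_iff numeral_2_eq_2 less_Suc_eq)
      moreover have "{..<2} = {0, Suc 0}"
        by auto
      ultimately have "coboundary G 2 c z = c (?t (z 1) (z 2)) + (c (?t (z 0 \<otimes>\<^bsub>G\<^esub> z 1) (z 2)) +
          c (?t (z 0) (z 1 \<otimes>\<^bsub>G\<^esub> z 2))) + c (?t (z 0) (z 1))"
        using True by (simp add: coboundary_def del: lessThan_Suc)
      also have "\<dots> = ?f (z 1) (z 2) + (?f (z 0 \<otimes>\<^bsub>G\<^esub> z 1) (z 2) + ?f (z 0) (z 1 \<otimes>\<^bsub>G\<^esub> z 2)) + ?f (z 0) (z 1)"
        using z by (simp only: t m_closed)
      also have "\<dots> = e (z 0) * e (z 1) * e (z 2)"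
        using z by (simp add: hom a b d algebra_simps)
      also have "\<dots> = char_power G e 3 z"
        using True by (simp add: char_power_def numeral_3_eq_3 numeral_2_eq_2)
      finally show ?thesis ..
    qed (simp add: char_power_def coboundary_def)
  qed
  ultimately show ?thesis
    by (simp add: coboundaries_def numeral_3_eq_3 numeral_2_eq_2)
qed


text \<open>
  On tuples from \<open>{1, g}\<close>, the operator sending \<open>u\<close> to
  \<open>(x\<^sub>1, \<dots>, x\<^sub>k) \<mapsto> u(x\<^sub>1, \<dots>, x\<^sub>k, 1, g) + u(x\<^sub>1, \<dots>, x\<^sub>k, g, g)\<close> commutes with the coboundary
  and turns the \<open>(k + 2)\<close>-nd power of a character nontrivial at \<open>g\<close> into its \<open>k\<close>-th power.
\<close>

lemma coboundary_neq_char_product_at_involution: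
  assumes G: "group G"
    and g: "g \<in> carrier G" "g \<otimes>\<^bsub>G\<^esub> g = \<one>\<^bsub>G\<^esub>"
    and e: "e g = 1" "e \<one>\<^bsub>G\<^esub> = 0"
  shows "\<exists>z\<in>(\<Pi>\<^sub>E i\<in>{..<Suc k}. {\<one>\<^bsub>G\<^esub>, g}). coboundary G k u z \<noteq> (\<Prod>i<Suc k. e (z i))"
proof (induction k arbitrary: u rule: nat_induct2)
  case 0
  show ?case
    by (rule bexI[of _ "\<lambda>i\<in>{..<Suc 0}. g"]) (use e in \<open>auto simp: coboundary_0\<close>)
next
  \<comment> \<open>The operator lowers the degree by two, hence a second base case. At the tuples
    (g, g) and (1, 1) the coboundary has the same value \<open>u\<close> at (1), while the products
    of values of \<open>e\<close> are 1 and 0.\<close>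
  case 1
  interpret group G by fact
  let ?z = "\<lambda>i\<in>{..<Suc (Suc 0)}. g"
  let ?o = "\<lambda>i\<in>{..<Suc 0}. \<one>\<^bsub>G\<^esub>" and ?g = "\<lambda>i\<in>{..<Suc 0}. g"
  let ?w = "\<lambda>i\<in>{..<Suc (Suc 0)}. \<one>\<^bsub>G\<^esub>"
  have 1: "(\<lambda>i\<in>{..<Suc 0}. ?z (Suc i)) = ?g" "restrict ?z {..<Suc 0} = ?g"
    "(\<lambda>i\<in>{..<Suc 0}. if i < 0 then ?z i else if i = 0 then ?z 0 \<otimes>\<^bsub>G\<^esub> ?z (Suc 0) else ?z (Suc i)) = ?o"
    "(\<lambda>i\<in>{..<Suc 0}. ?w (Suc i)) = ?o" "restrict ?w {..<Suc 0} = ?o"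
    "(\<lambda>i\<in>{..<Suc 0}. if i < 0 then ?w i else if i = 0 then ?w 0 \<otimes>\<^bsub>G\<^esub> ?w (Suc 0) else ?w (Suc i)) = ?o"
    using g by (auto simp: fun_eq_iff)
  have zw: "?z \<in> tuples G (Suc (Suc 0))" "?w \<in> tuples G (Suc (Suc 0))"
    using g by auto
  have S: "(\<Sum>j<Suc 0. f j) = f 0" for f :: "nat \<Rightarrow> bit"
    by simp
  have "coboundary G (Suc 0) u ?z = u ?o" "coboundary G (Suc 0) u ?w = u ?o"
    unfolding coboundary_def if_P[OF zw(1)] if_P[OF zw(2)] S 1 by (simp_all add: algebra_simps)
  moreover have "(\<Prod>i<Suc (Suc 0). e (?z i)) = 1" "(\<Prod>i<Suc (Suc 0). e (?w i)) = 0"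
    using e by simp_all
  moreover have "?z \<in> (\<Pi>\<^sub>E i\<in>{..<Suc (Suc 0)}. {\<one>\<^bsub>G\<^esub>, g})" "?w \<in> (\<Pi>\<^sub>E i\<in>{..<Suc (Suc 0)}. {\<one>\<^bsub>G\<^esub>, g})"
    by auto
  ultimately show ?case
    unfolding One_nat_def by (metis zero_neq_one)
next
  case (step k)
  interpret group G by fact
  define ext2 where "ext2 n z h = (\<lambda>i\<in>{..<Suc (Suc n)}. if i < n then z i else if i = n then h else g)"
    for n and z :: "nat \<Rightarrow> 'a" and h
  define ext1 where "ext1 n z h = (\<lambda>i\<in>{..<Suc n}. if i < n then z i else h)"
    for n and z :: "nat \<Rightarrow> 'a" and h
  define D where "D z = u (ext2 k z \<one>\<^bsub>G\<^esub>) + u (ext2 k z g)" for z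
  from step.IH obtain z where z: "z \<in> (\<Pi>\<^sub>E i\<in>{..<Suc k}. {\<one>\<^bsub>G\<^esub>, g})"
    and neq: "coboundary G k D z \<noteq> (\<Prod>i<Suc k. e (z i))"
    by blast
  have z': "z i = \<one>\<^bsub>G\<^esub> \<or> z i = g" if "i < Suc k" for i
    using PiE_mem[OF z] that by blast
  let ?m = "\<lambda>n z j. \<lambda>i\<in>{..<n}. if i < j then z i else if i = j then z j \<otimes>\<^bsub>G\<^esub> z (Suc j) else z (Suc i)"
  have zt: "z \<in> tuples G (Suc k)"
    using PiE_mono[of "{..<Suc k}" "\<lambda>_. {\<one>\<^bsub>G\<^esub>, g}" "\<lambda>_. carrier G"] z g by auto
  have cb: "coboundary G (Suc (Suc k)) u (ext2 (Suc k) z h) =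
      u (ext2 k (\<lambda>i\<in>{..<k}. z (Suc i)) h) +
      ((\<Sum>j<k. u (ext2 k (?m k z j) h)) + u (ext2 k (restrict z {..<k}) (z k \<otimes>\<^bsub>G\<^esub> h)) + u (ext1 (Suc k) z (h \<otimes>\<^bsub>G\<^esub> g))) +
      u (ext1 (Suc k) z h)" if h: "h \<in> carrier G" for h
  proof -
    let ?y = "ext2 (Suc k) z h"
    have y: "?y \<in> tuples G (Suc (Suc (Suc k)))"
      using h g PiE_mem[OF zt] by (auto simp: ext2_def PiE_iff)
    have "(\<lambda>i\<in>{..<Suc (Suc k)}. ?y (Suc i)) = ext2 k (\<lambda>i\<in>{..<k}. z (Suc i)) h"
      "?m (Suc (Suc k)) ?y (Suc k) = ext1 (Suc k) z (h \<otimes>\<^bsub>G\<^esub> g)"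
      "?m (Suc (Suc k)) ?y k = ext2 k (restrict z {..<k}) (z k \<otimes>\<^bsub>G\<^esub> h)"
      "restrict ?y {..<Suc (Suc k)} = ext1 (Suc k) z h"
      by (auto simp: ext1_def ext2_def fun_eq_iff less_Suc_eq)
    moreover have "(\<Sum>j<k. u (?m (Suc (Suc k)) ?y j)) = (\<Sum>j<k. u (ext2 k (?m k z j) h))"
    proof (rule sum.cong)
      fix j assume "j \<in> {..<k}"
      then have "?m (Suc (Suc k)) ?y j = ext2 k (?m k z j) h"
        by (auto simp: ext2_def fun_eq_iff less_Suc_eq)
      then show "u (?m (Suc (Suc k)) ?y j) = u (ext2 k (?m k z j) h)"
        by (rule arg_cong)
    qed simp
    ultimately show ?thesis
      unfolding coboundary_def if_P[OF y] sum.lessThan_Suc by simp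
  qed
  \<comment> \<open>Now h runs over {1, g}. Multiplication by \<open>z k\<close> permutes this set,
    so the faces containing the product of \<open>z k\<close> and h add up to a value of
    \<open>D\<close>. Multiplication by g permutes it too, so the last two faces cancel in
    pairs.\<close>
  have "coboundary G (Suc (Suc k)) u (ext2 (Suc k) z \<one>\<^bsub>G\<^esub>) + coboundary G (Suc (Suc k)) u (ext2 (Suc k) z g) =
      D (\<lambda>i\<in>{..<k}. z (Suc i)) + (\<Sum>j<k. D (?m k z j)) + D (restrict z {..<k})"
    unfolding cb[OF one_closed] cb[OF g(1)] D_def using z'[of k] g
    by (auto simp: sum.distrib algebra_simps)
  also have "\<dots> = coboundary G k D z"
    using zt by (simp only: coboundary_def if_True)
  finally have "coboundary G (Suc (Suc k)) u (ext2 (Suc k) z \<one>\<^bsub>G\<^esub>) +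
      coboundary G (Suc (Suc k)) u (ext2 (Suc k) z g) \<noteq> (\<Prod>i<Suc k. e (z i))"
    using neq by simp
  \<comment> \<open>The entry 1 kills the first product. If the coboundary agreed with the product
    at both tuples, the sum of its values would be the product over \<open>z\<close>, against the
    induction hypothesis.\<close>
  moreover have "(\<Prod>i<Suc (Suc (Suc k)). e (ext2 (Suc k) z \<one>\<^bsub>G\<^esub> i)) = 0"
    "(\<Prod>i<Suc (Suc (Suc k)). e (ext2 (Suc k) z g i)) = (\<Prod>i<Suc k. e (z i))"
    by (simp_all add: ext2_def e)
  ultimately have "coboundary G (Suc (Suc k)) u (ext2 (Suc k) z \<one>\<^bsub>G\<^esub>) \<noteq> (\<Prod>i<Suc (Suc (Suc k)). e (ext2 (Suc k) z \<one>\<^bsub>G\<^esub> i))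
    \<or> coboundary G (Suc (Suc k)) u (ext2 (Suc k) z g) \<noteq> (\<Prod>i<Suc (Suc (Suc k)). e (ext2 (Suc k) z g i))"
    by auto
  moreover have "ext2 (Suc k) z h \<in> (\<Pi>\<^sub>E i\<in>{..<Suc (Suc (Suc k))}. {\<one>\<^bsub>G\<^esub>, g})" if "h \<in> {\<one>\<^bsub>G\<^esub>, g}" for h
    using that z' by (auto simp: ext2_def PiE_iff)
  ultimately show ?case
    by (metis add_2_eq_Suc' insertI1 insertI2)
qed

text \<open>This is restriction to the subgroup {1, g}, carried out by evaluating only on tuples
  with entries in it.\<close>

lemma char_power_not_in_coboundaries:
  assumes G: "group G"
    and g: "g \<in> carrier G" "g \<otimes>\<^bsub>G\<^esub> g = \<one>\<^bsub>G\<^esub>"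
    and e: "e g = 1" "e \<one>\<^bsub>G\<^esub> = 0"
    and "m \<ge> 1"
  shows "char_power G e m \<notin> coboundaries G m"
proof
  interpret group G by fact
  assume "char_power G e m \<in> coboundaries G m"
  moreover obtain k where m: "m = Suc k"
    using \<open>m \<ge> 1\<close> by (cases m) auto
  ultimately obtain u where u: "char_power G e (Suc k) = coboundary G k u"
    by (auto simp: coboundaries_def)
  obtain z where z: "z \<in> (\<Pi>\<^sub>E i\<in>{..<Suc k}. {\<one>\<^bsub>G\<^esub>, g})"
    and neq: "coboundary G k u z \<noteq> (\<Prod>i<Suc k. e (z i))"
    using coboundary_neq_char_product_at_involution[OF G g e, of k u] by blast
  have "z \<in> tuples G (Suc k)"
    using PiE_mono[of "{..<Suc k}" "\<lambda>_. {\<one>\<^bsub>G\<^esub>, g}" "\<lambda>_. carrier G"] z g by auto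
  then show False
    using neq u by (metis char_power_def)
qed

section \<open>Pairs with trivial cube and pairs with a real involution\<close>

definition chr_bit :: "'a cyc_pair \<Rightarrow> 'a \<Rightarrow> bit" where
  "chr_bit \<G> g = sign_bit (chr \<G> g)"

definition bit_character :: "('a, 'b) top_group_scheme \<Rightarrow> ('a \<Rightarrow> bit) \<Rightarrow> bool" where
  "bit_character G x \<longleftrightarrow> continuous_map (topo G) (discrete_topology UNIV) x \<and>
     (\<forall>g\<in>carrier G. \<forall>h\<in>carrier G. x (g \<otimes>\<^bsub>G\<^esub> h) = x g + x h)"

text \<open>\<open>b\<close> is a 1-cochain whose coboundary is the cup product of \<open>x\<close>
  and \<open>y\<close>, a witness that the product vanishes in degree 2.\<close>

definition bounds_cup ::
    "('a, 'b) top_group_scheme \<Rightarrow> ('a \<Rightarrow> bit) \<Rightarrow> ('a \<Rightarrow> bit) \<Rightarrow> ('a \<Rightarrow> bit) \<Rightarrow> bool" where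
  "bounds_cup G x y b \<longleftrightarrow> continuous_map (topo G) (discrete_topology UNIV) b \<and>
     (\<forall>g\<in>carrier G. \<forall>h\<in>carrier G. b (g \<otimes>\<^bsub>G\<^esub> h) = b g + b h + x g * y h)"

definition cube_trivial :: "'a cyc_pair \<Rightarrow> bool" where
  "cube_trivial \<G> \<longleftrightarrow> (\<exists>x y a b d. bit_character \<G> x \<and> bit_character \<G> y \<and>
     bounds_cup \<G> (\<lambda>g. y g + chr_bit \<G> g) (\<lambda>g. x g + chr_bit \<G> g) a \<and>
     bounds_cup \<G> x (chr_bit \<G>) b \<and> bounds_cup \<G> y (chr_bit \<G>) d)"

definition has_real_involution :: "'a cyc_pair \<Rightarrow> bool" where
  "has_real_involution \<G> \<longleftrightarrow>
     (\<exists>g\<in>carrier \<G>. g \<otimes>\<^bsub>\<G>\<^esub> g = \<one>\<^bsub>\<G>\<^esub> \<and> chr_bit \<G> g = 1)"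

lemma cyclotomic_pairD:
  assumes "cyclotomic_pair \<G>"
  shows "group \<G>" "topspace (topo \<G>) = carrier \<G>" "pro_2_group \<G>" "cont_unit_character \<G> (chr \<G>)"
    "\<And>g. g \<in> carrier \<G> \<Longrightarrow> chr \<G> g dvd 1"
  using assms by (auto simp: cyclotomic_pair_def pro_2_group_def cont_unit_character_def)

lemma bit_character_chr_bit:
  assumes "cyclotomic_pair \<G>"
  shows "bit_character \<G> (chr_bit \<G>)"
proof -
  have "continuous_map (topo \<G>) two_adic_topology (chr \<G>)"
    using assms by (auto simp: cyclotomic_pair_def cont_unit_character_def continuous_map_in_subtopology)
  from continuous_map_compose[OF this continuous_map_sign_bit]
  have "continuous_map (topo \<G>) (discrete_topology UNIV) (chr_bit \<G>)"
    by (simp add: o_def chr_bit_def[abs_def])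
  moreover have "chr_bit \<G> (g \<otimes>\<^bsub>\<G>\<^esub> h) = chr_bit \<G> g + chr_bit \<G> h"
    if "g \<in> carrier \<G>" "h \<in> carrier \<G>" for g h
    using assms that by (simp add: chr_bit_def cyclotomic_pair_def cont_unit_character_def sign_bit_mult)
  ultimately show ?thesis
    by (simp add: bit_character_def)
qed

lemma eps_class_eq:
  assumes "cyclotomic_pair \<G>"
  shows "eps_class \<G> = coh_class \<G> (Suc 0) (char_power \<G> (chr_bit \<G>) (Suc 0))"
proof -
  have "(\<lambda>x. if x \<in> tuples \<G> 1 then (if sign_part (chr \<G> (x 0)) = 1 then 0 else 1) else (0 :: bit)) =
      char_power \<G> (chr_bit \<G>) (Suc 0)"
  proof (rule ext)
    fix x
    show "(if x \<in> tuples \<G> 1 then (if sign_part (chr \<G> (x 0)) = 1 then 0 else 1) else (0 :: bit)) =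
      char_power \<G> (chr_bit \<G>) (Suc 0) x"
    proof (cases "x \<in> tuples \<G> (Suc 0)")
      case True
      then have "x 0 \<in> carrier \<G>"
        by (rule PiE_mem) simp
      with True show ?thesis
        using cyclotomic_pairD(5)[OF assms] by (simp add: char_power_def chr_bit_def sign_part_eq_1_iff)
    qed (simp add: char_power_def)
  qed
  then show ?thesis
    unfolding eps_class_def by simp
qed

lemma cup_power_eps_eq_one_iff:
  assumes "cyclotomic_pair \<G>"
  shows "cup_power \<G> (eps_class \<G>) m = \<one>\<^bsub>cohomology \<G> m\<^esub> \<longleftrightarrow>
    char_power \<G> (chr_bit \<G>) m \<in> coboundaries \<G> m"
  using bit_character_chr_bit[OF assms] cyclotomic_pairD(1,2)[OF assms]
  by (simp add: eps_class_eq[OF assms] cup_power_char bit_character_def coh_class_eq_one_iff)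

lemma log_level_real_involution:
  assumes \<G>: "cyclotomic_pair \<G>" and "has_real_involution \<G>"
  shows "log_level \<G> = \<infinity>"
proof -
  interpret group \<G>
    using cyclotomic_pairD(1)[OF \<G>] .
  obtain g where g: "g \<in> carrier \<G>" "g \<otimes>\<^bsub>\<G>\<^esub> g = \<one>\<^bsub>\<G>\<^esub>" "chr_bit \<G> g = 1"
    using assms(2) by (auto simp: has_real_involution_def)
  have "chr_bit \<G> (\<one>\<^bsub>\<G>\<^esub> \<otimes>\<^bsub>\<G>\<^esub> \<one>\<^bsub>\<G>\<^esub>) = chr_bit \<G> \<one>\<^bsub>\<G>\<^esub> + chr_bit \<G> \<one>\<^bsub>\<G>\<^esub>"
    using bit_character_chr_bit[OF \<G>] unfolding bit_character_def by blast
  then have "chr_bit \<G> \<one>\<^bsub>\<G>\<^esub> = 0"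
    by simp
  then have "\<not> (m \<ge> 1 \<and> cup_power \<G> (eps_class \<G>) m = \<one>\<^bsub>cohomology \<G> m\<^esub>)" for m
    using char_power_not_in_coboundaries[OF group_axioms g(1,2), of "chr_bit \<G>"] g(3)
    by (auto simp: cup_power_eps_eq_one_iff[OF \<G>])
  then show ?thesis
    by (simp add: log_level_def Let_def)
qed

lemma log_level_cube_trivial:
  assumes \<G>: "cyclotomic_pair \<G>" and "cube_trivial \<G>"
  shows "log_level \<G> \<in> {1, 2, 3}"
proof -
  let ?P = "\<lambda>m. m \<ge> 1 \<and> cup_power \<G> (eps_class \<G>) m = \<one>\<^bsub>cohomology \<G> m\<^esub>"
  obtain x y a b d where "bit_character \<G> x" "bit_character \<G> y"
    "bounds_cup \<G> (\<lambda>g. y g + chr_bit \<G> g) (\<lambda>g. x g + chr_bit \<G> g) a"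
    "bounds_cup \<G> x (chr_bit \<G>) b" "bounds_cup \<G> y (chr_bit \<G>) d"
    using assms(2) unfolding cube_trivial_def by blast
  then have "char_power \<G> (chr_bit \<G>) 3 \<in> coboundaries \<G> 3"
    using cyclotomic_pairD(1,2)[OF \<G>] bit_character_chr_bit[OF \<G>]
    by (intro char_power_3_in_coboundaries[where y = y and x = x and a = a and b = b and d = d])
      (simp_all add: bit_character_def bounds_cup_def)
  then have P: "?P 3"
    by (simp add: cup_power_eps_eq_one_iff[OF \<G>])
  then have "log_level \<G> = enat (LEAST m. ?P m)"
    unfolding log_level_def Let_def by meson
  moreover have "(LEAST m. ?P m) \<le> 3" "(LEAST m. ?P m) \<ge> 1"
    using LeastI[of ?P 3, OF P] Least_le[of ?P 3, OF P] by simp_all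
  then have "(LEAST m. ?P m) \<in> {1, 2, 3}"
    by auto
  ultimately show ?thesis
    by (auto simp: one_enat_def numeral_eq_enat)
qed

section \<open>Transport along homomorphisms\<close>

lemma bit_character_pullback:
  assumes f: "f \<in> cont_hom G H" and "bit_character H x"
  shows "bit_character G (\<lambda>g. x (f g))"
proof -
  have "continuous_map (topo G) (discrete_topology UNIV) (x \<circ> f)"
    using assms by (intro continuous_map_compose) (auto simp: cont_hom_def bit_character_def)
  then show ?thesis
    using assms by (auto simp: bit_character_def o_def cont_hom_def hom_def Pi_iff)
qed

lemma bounds_cup_pullback:
  assumes f: "f \<in> cont_hom G H" and "bounds_cup H x y b"
  shows "bounds_cup G (\<lambda>g. x (f g)) (\<lambda>g. y (f g)) (\<lambda>g. b (f g))"
proof -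
  have "continuous_map (topo G) (discrete_topology UNIV) (b \<circ> f)"
    using assms by (intro continuous_map_compose) (auto simp: cont_hom_def bounds_cup_def)
  then show ?thesis
    using assms by (auto simp: bounds_cup_def o_def cont_hom_def hom_def Pi_iff)
qed

lemma bounds_cup_cong:
  assumes "bounds_cup G x y b"
    and "\<And>g. g \<in> carrier G \<Longrightarrow> x g = x' g" "\<And>g. g \<in> carrier G \<Longrightarrow> y g = y' g"
  shows "bounds_cup G x' y' b"
  using assms by (simp add: bounds_cup_def)

text \<open>Inflation of all five functions; applied to isomorphisms and to the projection of an
  extension onto its quotient.\<close>

lemma cube_trivial_pullback:
  assumes f: "f \<in> cont_hom \<G> \<H>" and chr: "\<And>g. g \<in> carrier \<G> \<Longrightarrow> chr \<H> (f g) = chr \<G> g"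
    and "cube_trivial \<H>"
  shows "cube_trivial \<G>"
proof -
  obtain x y a b d where H: "bit_character \<H> x" "bit_character \<H> y"
    "bounds_cup \<H> (\<lambda>g. y g + chr_bit \<H> g) (\<lambda>g. x g + chr_bit \<H> g) a"
    "bounds_cup \<H> x (chr_bit \<H>) b" "bounds_cup \<H> y (chr_bit \<H>) d"
    using assms(3) unfolding cube_trivial_def by blast
  have c: "chr_bit \<H> (f g) = chr_bit \<G> g" if "g \<in> carrier \<G>" for g
    using chr that by (simp add: chr_bit_def)
  show ?thesis
    unfolding cube_trivial_def
    using bit_character_pullback[OF f H(1)] bit_character_pullback[OF f H(2)]
      bounds_cup_cong[OF bounds_cup_pullback[OF f H(3)], where x' = "\<lambda>g. y (f g) + chr_bit \<G> g"
        and y' = "\<lambda>g. x (f g) + chr_bit \<G> g"]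
      bounds_cup_cong[OF bounds_cup_pullback[OF f H(4)], where x' = "\<lambda>g. x (f g)" and y' = "chr_bit \<G>"]
      bounds_cup_cong[OF bounds_cup_pullback[OF f H(5)], where x' = "\<lambda>g. y (f g)" and y' = "chr_bit \<G>"] c
    by auto
qed

text \<open>The image of the identity is idempotent, hence the identity of the target group. The
  source is a mere monoid so that \<open>E_pair\<close> can be used after checking the monoid
  laws.\<close>

lemma has_real_involution_image:
  assumes "monoid \<G>" "group \<H>" and f: "f \<in> hom \<G> \<H>"
    and chr: "\<And>g. g \<in> carrier \<G> \<Longrightarrow> chr \<H> (f g) = chr \<G> g" and "has_real_involution \<G>"
  shows "has_real_involution \<H>"
proof -
  interpret G: monoid \<G> by fact
  interpret H: group \<H> by fact
  obtain g where g: "g \<in> carrier \<G>" "g \<otimes>\<^bsub>\<G>\<^esub> g = \<one>\<^bsub>\<G>\<^esub>" "chr_bit \<G> g = 1"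
    using assms(5) by (auto simp: has_real_involution_def)
  have "f \<one>\<^bsub>\<G>\<^esub> \<in> carrier \<H>" "f \<one>\<^bsub>\<G>\<^esub> \<otimes>\<^bsub>\<H>\<^esub> f \<one>\<^bsub>\<G>\<^esub> = f \<one>\<^bsub>\<G>\<^esub>"
    using hom_in_carrier[OF f G.one_closed] hom_mult[OF f G.one_closed G.one_closed] by simp_all
  then have "f \<one>\<^bsub>\<G>\<^esub> = \<one>\<^bsub>\<H>\<^esub>"
    using H.r_cancel_one by blast
  then have "f g \<otimes>\<^bsub>\<H>\<^esub> f g = \<one>\<^bsub>\<H>\<^esub>"
    using hom_mult[OF f g(1) g(1)] g(2) by simp
  then show ?thesis
    unfolding has_real_involution_def using hom_in_carrier[OF f g(1)] chr[OF g(1)] g(3)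
    by (auto simp: chr_bit_def)
qed

text \<open>Both directions are used: cochains are pulled back along \<open>f\<close>, involutions
  are pushed forward along \<open>k\<close>.\<close>

lemma pair_isoE:
  assumes "pair_iso \<G> \<H>" "group \<G>" "topspace (topo \<G>) = carrier \<G>"
  obtains f k where "f \<in> cont_hom \<G> \<H>" "\<And>g. g \<in> carrier \<G> \<Longrightarrow> chr \<H> (f g) = chr \<G> g"
    "k \<in> cont_hom \<H> \<G>" "\<And>h. h \<in> carrier \<H> \<Longrightarrow> chr \<G> (k h) = chr \<H> h"
    "\<And>g. g \<in> carrier \<G> \<Longrightarrow> k (f g) = g"
proof -
  interpret group \<G> by fact
  obtain f where f: "f \<in> iso \<G> \<H>" "homeomorphic_map (topo \<G>) (topo \<H>) f"
    and chr: "\<And>g. g \<in> carrier \<G> \<Longrightarrow> chr \<H> (f g) = chr \<G> g"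
    using assms(1) by (auto simp: pair_iso_def)
  from f(2) obtain k where k: "homeomorphic_maps (topo \<G>) (topo \<H>) f k"
    using homeomorphic_map_maps by blast
  have kf: "k (f g) = g" if "g \<in> carrier \<G>" for g
    using k that assms(3) by (simp add: homeomorphic_maps_def)
  have hom: "f \<in> hom \<G> \<H>" and im: "carrier \<H> = f ` carrier \<G>"
    using f(1) by (auto simp: iso_def bij_betw_def)
  have "k \<in> hom \<H> \<G>"
  proof (rule homI)
    fix a b assume "a \<in> carrier \<H>" "b \<in> carrier \<H>"
    then obtain g h where gh: "g \<in> carrier \<G>" "h \<in> carrier \<G>" "a = f g" "b = f h"
      using im by auto
    then show "k (a \<otimes>\<^bsub>\<H>\<^esub> b) = k a \<otimes>\<^bsub>\<G>\<^esub> k b"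
      using kf[of "g \<otimes>\<^bsub>\<G>\<^esub> h"] by (simp add: kf hom_mult[OF hom])
  qed (auto simp: im kf)
  moreover have "chr \<G> (k h) = chr \<H> h" if "h \<in> carrier \<H>" for h
    using that by (auto simp: im kf chr)
  ultimately show thesis
    using that[of f k] hom k kf chr by (simp add: cont_hom_def homeomorphic_maps_def)
qed

lemma cube_trivial_if_chr_bit_zero:
  assumes "\<And>g. g \<in> carrier \<G> \<Longrightarrow> chr_bit \<G> g = 0"
  shows "cube_trivial \<G>"
  unfolding cube_trivial_def bit_character_def bounds_cup_def
  by (rule exI[of _ "\<lambda>_. 0"])+ (use assms in simp)

section \<open>Basic pairs and extensions\<close>

lemma cube_trivial_iso_trivial_pair:
  assumes "cyclotomic_pair \<G>" "pair_iso \<G> trivial_pair"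
  shows "cube_trivial \<G>"
proof -
  obtain f where "\<And>g. g \<in> carrier \<G> \<Longrightarrow> chr trivial_pair (f g) = chr \<G> g"
    using pair_isoE[OF assms(2) cyclotomic_pairD(1,2)[OF assms(1)]] by metis
  then have "chr \<G> g = 1" if "g \<in> carrier \<G>" for g
    using that by (metis (no_types) trivial_pair_def cyc_pair.select_convs(1))
  then show ?thesis
    by (intro cube_trivial_if_chr_bit_zero) (simp add: chr_bit_def)
qed

definition parity :: "two_adic \<Rightarrow> bit" where
  "parity a = (if res a 1 = 0 then 0 else 1)"

definition second_digit :: "two_adic \<Rightarrow> bit" where
  "second_digit a = (if res a 2 < 2 then 0 else 1)"

text \<open>The carry into the second binary digit is the product of the first digits. Hence the
  second digit bounds the cup square of the parity character.\<close>

lemma second_digit_add: "second_digit (a + b) = second_digit a + second_digit b + parity a * parity b"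
proof -
  have 2: "res c 2 = 0 \<or> res c 2 = 1 \<or> res c 2 = 2 \<or> res c 2 = 3" for c
    using res_bounds[of c 2] by auto
  have 1: "res c 1 = res c 2 mod 2" for c
    using res_mod_le[of 1 2 c] by simp
  show ?thesis
    unfolding second_digit_def parity_def 1 plus_two_adic.rep_eq
    using 2[of a] 2[of b] by (elim disjE) simp_all
qed

text \<open>An additive map to Z/2 kills all doubles, and the doubles have index 2 in the 2-adic
  integers.\<close>

lemma additive_bit_eq:
  assumes add: "\<And>a b. e (a + b) = e a + (e b :: bit)"
  shows "e a = parity a * e (1 :: two_adic)"
proof -
  have even: "e b = 0" if "res b 1 = 0" for b
  proof -
    have "2 dvd b"
      using two_power_dvd_iff[of 1 b] that by simp
    then obtain c where b: "b = 2 * c"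
      by (auto simp: dvd_def)
    show ?thesis
      using add[of c c] unfolding b mult_2 by (simp only: bit_add_self)
  qed
  show ?thesis
  proof (cases "res a 1 = 0")
    case False
    then have "res a 1 = 1"
      using res_bounds[of a 1] by simp
    then have "e (a - 1) = 0"
      by (intro even) (simp add: minus_two_adic.rep_eq one_two_adic.rep_eq)
    moreover have "e a = e (a - 1) + e 1"
      using add[of "a - 1" 1] by simp
    ultimately show ?thesis
      using False by (simp add: parity_def)
  qed (simp add: even parity_def)
qed

text \<open>The definite description in \<open>Z_pair\<close> is never evaluated: the character of
  \<open>\<G>\<close> is carried to the 2-adic integers along \<open>k\<close>, where additivity
  leaves only its value at 1 open. If that value is nonzero, x = y = 0 reduces the relations to e^2
  = 0, and the second digit is a witness.\<close>

lemma cube_trivial_iso_Z_pair: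
  assumes \<G>: "cyclotomic_pair \<G>" and iso: "pair_iso \<G> (Z_pair \<alpha>)"
  shows "cube_trivial \<G>"
proof -
  obtain f k where f: "f \<in> cont_hom \<G> (Z_pair \<alpha>)"
    and k: "k \<in> cont_hom (Z_pair \<alpha>) \<G>" and kf: "\<And>g. g \<in> carrier \<G> \<Longrightarrow> k (f g) = g"
    using pair_isoE[OF iso cyclotomic_pairD(1,2)[OF \<G>]] by metis
  have k_add: "k (a + b) = k a \<otimes>\<^bsub>\<G>\<^esub> k b" and k_closed: "k a \<in> carrier \<G>" for a b
    using k by (auto simp: cont_hom_def hom_def Z_pair_def)
  define e where "e a = chr_bit \<G> (k a)" for a
  have "e (a + b) = e a + e b" for a b
    using bit_character_chr_bit[OF \<G>] k_closed by (simp add: e_def k_add bit_character_def)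
  then have e: "e a = parity a * e 1" for a
    by (rule additive_bit_eq)
  have chr: "chr_bit \<G> g = parity (f g) * e 1" if "g \<in> carrier \<G>" for g
    using e[of "f g"] kf[OF that] by (simp add: e_def)
  show ?thesis
  proof (cases "e 1 = 0")
    case True
    with chr show ?thesis
      by (intro cube_trivial_if_chr_bit_zero) simp
  next
    case False
    have "continuous_map two_adic_topology (discrete_topology UNIV) second_digit"
      unfolding second_digit_def by (rule continuous_map_discrete_comp) (rule continuous_map_res)
    then have "bounds_cup (Z_pair \<alpha>) parity parity second_digit"
      by (simp add: bounds_cup_def Z_pair_def second_digit_add)
    then have "bounds_cup \<G> (\<lambda>g. parity (f g)) (\<lambda>g. parity (f g)) (\<lambda>g. second_digit (f g))"
      by (rule bounds_cup_pullback[OF f])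
    then have "bounds_cup \<G> (\<lambda>g. 0 + chr_bit \<G> g) (\<lambda>g. 0 + chr_bit \<G> g) (\<lambda>g. second_digit (f g))"
      by (rule bounds_cup_cong) (use False chr in simp_all)
    then show ?thesis
      unfolding cube_trivial_def
      by (intro exI[of _ "\<lambda>_. 0"] exI[of _ "\<lambda>g. second_digit (f g)"] conjI)
        (simp_all add: bit_character_def bounds_cup_def)
  qed
qed

lemma has_real_involution_iso_E_pair:
  assumes \<G>: "cyclotomic_pair \<G>" and iso: "pair_iso \<G> E_pair"
  shows "has_real_involution \<G>"
proof -
  obtain k where k: "k \<in> cont_hom E_pair \<G>"
    and chr: "\<And>h. h \<in> carrier E_pair \<Longrightarrow> chr \<G> (k h) = chr E_pair h"
    using pair_isoE[OF iso cyclotomic_pairD(1,2)[OF \<G>]] by metis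
  have "monoid E_pair"
    by unfold_locales (auto simp: E_pair_def algebra_simps)
  moreover have "has_real_involution E_pair"
    unfolding has_real_involution_def by (rule bexI[of _ 1]) (simp_all add: E_pair_def chr_bit_def)
  moreover have "k \<in> hom E_pair \<G>"
    using k by (simp add: cont_hom_def)
  ultimately show ?thesis
    using has_real_involution_image cyclotomic_pairD(1)[OF \<G>] chr by blast
qed

lemma extension_pair_dichotomy:
  assumes \<G>: "cyclotomic_pair \<G>" and \<H>: "cyclotomic_pair \<H>"
    and iso: "pair_iso \<G> (extension_pair \<H>)"
    and "cube_trivial \<H> \<or> has_real_involution \<H>"
  shows "cube_trivial \<G> \<or> has_real_involution \<G>"
proof -
  interpret H: group \<H>
    using cyclotomic_pairD(1)[OF \<H>] .
  obtain f k where f: "f \<in> cont_hom \<G> (extension_pair \<H>)"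
    and chr_f: "\<And>g. g \<in> carrier \<G> \<Longrightarrow> chr (extension_pair \<H>) (f g) = chr \<G> g"
    and k: "k \<in> cont_hom (extension_pair \<H>) \<G>"
    and chr_k: "\<And>h. h \<in> carrier (extension_pair \<H>) \<Longrightarrow> chr \<G> (k h) = chr (extension_pair \<H>) h"
    using pair_isoE[OF iso cyclotomic_pairD(1,2)[OF \<G>]] by metis
  from assms(4) show ?thesis
  proof
    assume "cube_trivial \<H>"
    moreover have "snd \<in> cont_hom (extension_pair \<H>) \<H>"
      by (auto simp: cont_hom_def hom_def extension_pair_def continuous_map_snd)
    then have "snd \<circ> f \<in> cont_hom \<G> \<H>"
      using f by (auto simp: cont_hom_def hom_compose continuous_map_compose)
    ultimately have "cube_trivial \<G>"
      by (rule cube_trivial_pullback[rotated 2])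
        (use chr_f in \<open>simp add: extension_pair_def case_prod_beta\<close>)
    then show ?thesis ..
  next
    assume "has_real_involution \<H>"
    moreover have "(\<lambda>h. (0, h)) \<in> hom \<H> (extension_pair \<H>)"
      by (auto simp: hom_def extension_pair_def)
    then have "k \<circ> (\<lambda>h. (0, h)) \<in> hom \<H> \<G>"
      using k by (auto simp: cont_hom_def intro: hom_compose)
    moreover have "chr \<G> ((k \<circ> (\<lambda>h. (0, h))) h) = chr \<H> h" if "h \<in> carrier \<H>" for h
      using that chr_k[of "(0, h)"] by (simp add: extension_pair_def)
    ultimately have "has_real_involution \<G>"
      using has_real_involution_image[OF H.monoid_axioms cyclotomic_pairD(1)[OF \<G>]] by blast
    then show ?thesis ..
  qed
qed

section \<open>Free products\<close>

text \<open>Makes finite 2-groups eligible as test groups in the universal property of free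
  products.\<close>

lemma pro_2_group_finite_discrete:
  assumes "group G" "order G = 2 ^ n" "topo G = discrete_topology (carrier G)"
  shows "pro_2_group G"
proof -
  interpret group G by fact
  have fin: "finite (carrier G)"
    using assms(2) by (intro order_gt_0_iff_finite[THEN iffD1]) simp
  have "\<exists>N. N \<lhd> G \<and> openin (topo G) N \<and> N \<subseteq> U" if "\<one>\<^bsub>G\<^esub> \<in> U" for U
    by (rule exI[of _ "{\<one>\<^bsub>G\<^esub>}"]) (use that one_is_normal assms(3) in simp)
  moreover have "\<exists>k. order (G Mod N) = 2 ^ k" if "N \<lhd> G" for N
  proof -
    have "card (rcosets\<^bsub>G\<^esub> N) * card N = 2 ^ n"
      using lagrange[OF normal_imp_subgroup[OF that]] assms(2) by simp
    then have "card (rcosets\<^bsub>G\<^esub> N) dvd 2 ^ n"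
      by (metis dvd_triv_left)
    then show ?thesis
      by (auto simp: order_def FactGroup_def divides_primepow_nat)
  qed
  ultimately show ?thesis
    unfolding pro_2_group_def assms(3)
    using fin group_axioms
    by (auto simp: compact_space_discrete_topology Pi_iff simp flip: prod_topology_discrete_topology)
qed

text \<open>
  The group of order 8 of unitriangular \<open>3 \<times> 3\<close> matrices over $\mathbb{F}_2$, copied to the type
  of test groups. Its continuous representations are the triples \<open>(x, y, b)\<close> with
  \<open>bounds_cup G x y b\<close>.
\<close>

definition triple_code :: "bit \<times> bit \<times> bit \<Rightarrow> univ" where
  "triple_code = (\<lambda>(x, y, b) n.
     if n = 0 then (if x = 0 then 0 else 1)
     else if n = 1 then (if y = 0 then 0 else 1)
     else if n = 2 then (if b = 0 then 0 else 1) else 0)"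

definition triple_decode :: "univ \<Rightarrow> bit \<times> bit \<times> bit" where
  "triple_decode f = (of_nat (f 0), of_nat (f 1), of_nat (f 2))"

text \<open>The matrix product in coordinates: the first two entries stand next to the diagonal, the
  third is the upper right corner.\<close>

definition heisenberg_mult :: "bit \<times> bit \<times> bit \<Rightarrow> bit \<times> bit \<times> bit \<Rightarrow> bit \<times> bit \<times> bit" where
  "heisenberg_mult = (\<lambda>(x, y, b) (x', y', b'). (x + x', y + y', b + b' + x * y'))"

definition heisenberg_group :: "univ top_group" where
  "heisenberg_group = \<lparr>carrier = range triple_code,
     mult = (\<lambda>f g. triple_code (heisenberg_mult (triple_decode f) (triple_decode g))),
     one = triple_code (0, 0, 0), topo = discrete_topology (range triple_code)\<rparr>"

lemma triple_decode_code [simp]: "triple_decode (triple_code t) = t"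
  by (cases t) (simp add: triple_decode_def triple_code_def)

lemma group_heisenberg: "group heisenberg_group"
proof (rule groupI)
  fix f assume "f \<in> carrier heisenberg_group"
  then obtain x y b where "f = triple_code (x, y, b)"
    by (auto simp: heisenberg_group_def)
  then show "\<exists>g\<in>carrier heisenberg_group. g \<otimes>\<^bsub>heisenberg_group\<^esub> f = \<one>\<^bsub>heisenberg_group\<^esub>"
    \<comment> \<open>Multiplying (x, y, b') by (x, y, b) puts b' + b + xy in the corner, which
      vanishes for b' = b + xy.\<close>
    by (intro bexI[of _ "triple_code (x, y, b + x * y)"])
      (auto simp: heisenberg_group_def heisenberg_mult_def algebra_simps)
qed (auto simp: heisenberg_group_def heisenberg_mult_def algebra_simps)

lemma pro_2_group_heisenberg: "pro_2_group heisenberg_group"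
proof (rule pro_2_group_finite_discrete[OF group_heisenberg])
  have "inj triple_code"
    by (rule inj_on_inverseI[of _ triple_decode]) simp
  then have "order heisenberg_group = card (UNIV :: (bit \<times> bit \<times> bit) set)"
    by (simp add: order_def heisenberg_group_def card_image)
  also have "\<dots> = 2 ^ 3"
  proof -
    have "(UNIV :: bit set) = {0, 1}"
      by (auto intro: bit.exhaust)
    then have "card (UNIV :: bit set) = card {0, 1 :: bit}"
      by (rule arg_cong)
    then have "card (UNIV :: bit set) = 2"
      by simp
    then show ?thesis
      by (simp flip: UNIV_Times_UNIV add: card_cartesian_product)
  qed
  finally show "order heisenberg_group = 2 ^ 3" .
qed (simp add: heisenberg_group_def)

lemma heisenberg_homI:
  assumes "topspace (topo G) = carrier G"
    and "bit_character G x" "bit_character G y" "bounds_cup G x y b"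
  shows "(\<lambda>g. triple_code (x g, y g, b g)) \<in> cont_hom G heisenberg_group"
proof -
  have "continuous_map (topo G) (discrete_topology UNIV) (\<lambda>g. triple_code (x g, y g, b g))"
    by (intro continuous_map_discrete_comp2[where k = "\<lambda>a t. triple_code (a, t)"]
        continuous_map_discrete_comp2[where k = Pair])
      (use assms in \<open>simp_all add: bit_character_def bounds_cup_def\<close>)
  then have "continuous_map (topo G) (discrete_topology (range triple_code)) (\<lambda>g. triple_code (x g, y g, b g))"
    by (auto simp: continuous_map_def)
  then show ?thesis
    using assms by (auto simp: cont_hom_def hom_def heisenberg_group_def heisenberg_mult_def
        bit_character_def bounds_cup_def)
qed

lemma heisenberg_homE:
  assumes "f \<in> cont_hom G heisenberg_group"
  obtains x y b where "bit_character G x" "bit_character G y" "bounds_cup G x y b"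
    "\<And>g. x g = fst (triple_decode (f g))" "\<And>g. y g = fst (snd (triple_decode (f g)))"
    "\<And>g. b g = snd (snd (triple_decode (f g)))"
proof -
  have "continuous_map (topo G) (discrete_topology (range triple_code)) f"
    using assms by (simp add: cont_hom_def heisenberg_group_def)
  then have "continuous_map (topo G) (subtopology (discrete_topology UNIV) (range triple_code)) f"
    by simp
  then have f: "continuous_map (topo G) (discrete_topology UNIV) f"
    by (simp only: continuous_map_in_subtopology)
  have mult: "triple_decode (f (g \<otimes>\<^bsub>G\<^esub> h)) = heisenberg_mult (triple_decode (f g)) (triple_decode (f h))"
    if "g \<in> carrier G" "h \<in> carrier G" for g h
    using assms that by (simp add: cont_hom_def hom_def heisenberg_group_def)
  show thesis
    by (rule that[of "\<lambda>g. fst (triple_decode (f g))" "\<lambda>g. fst (snd (triple_decode (f g)))"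
          "\<lambda>g. snd (snd (triple_decode (f g)))"])
      (auto simp: bit_character_def bounds_cup_def mult heisenberg_mult_def case_prod_beta
        intro: continuous_map_discrete_comp[OF f])
qed

locale free_pro_2_product =
  fixes G\<^sub>1 :: "('a, 'd) top_group_scheme" and \<iota>\<^sub>1 :: "'a \<Rightarrow> 'c"
    and G\<^sub>2 :: "('b, 'e) top_group_scheme" and \<iota>\<^sub>2 :: "'b \<Rightarrow> 'c"
    and G :: "('c, 'f) top_group_scheme"
  assumes free_product: "is_free_pro_2_product G\<^sub>1 \<iota>\<^sub>1 G\<^sub>2 \<iota>\<^sub>2 G"
    and topspace_factors: "topspace (topo G\<^sub>1) = carrier G\<^sub>1" "topspace (topo G\<^sub>2) = carrier G\<^sub>2"
begin

lemma topspace_product: "topspace (topo G) = carrier G"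
  using free_product by (simp add: is_free_pro_2_product_def pro_2_group_def)

lemma inclusions: "\<iota>\<^sub>1 \<in> cont_hom G\<^sub>1 G" "\<iota>\<^sub>2 \<in> cont_hom G\<^sub>2 G"
  using free_product by (simp_all add: is_free_pro_2_product_def)

lemma heisenberg_hom_ex_unique:
  assumes "f\<^sub>1 \<in> cont_hom G\<^sub>1 heisenberg_group" "f\<^sub>2 \<in> cont_hom G\<^sub>2 heisenberg_group"
  shows "\<exists>f\<in>cont_hom G heisenberg_group.
      (\<forall>x\<in>carrier G\<^sub>1. f (\<iota>\<^sub>1 x) = f\<^sub>1 x) \<and> (\<forall>x\<in>carrier G\<^sub>2. f (\<iota>\<^sub>2 x) = f\<^sub>2 x) \<and>
      (\<forall>f'\<in>cont_hom G heisenberg_group.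
        (\<forall>x\<in>carrier G\<^sub>1. f' (\<iota>\<^sub>1 x) = f\<^sub>1 x) \<and> (\<forall>x\<in>carrier G\<^sub>2. f' (\<iota>\<^sub>2 x) = f\<^sub>2 x) \<longrightarrow>
        (\<forall>x\<in>carrier G. f' x = f x))"
  by (rule free_product[unfolded is_free_pro_2_product_def,
        THEN conjunct2, THEN conjunct2, THEN conjunct2, THEN spec, THEN spec, THEN spec, THEN mp])
    (simp add: assms pro_2_group_heisenberg)

lemma heisenberg_hom_extends:
  assumes "f\<^sub>1 \<in> cont_hom G\<^sub>1 heisenberg_group" "f\<^sub>2 \<in> cont_hom G\<^sub>2 heisenberg_group"
  shows "\<exists>f\<in>cont_hom G heisenberg_group.
      (\<forall>x\<in>carrier G\<^sub>1. f (\<iota>\<^sub>1 x) = f\<^sub>1 x) \<and> (\<forall>x\<in>carrier G\<^sub>2. f (\<iota>\<^sub>2 x) = f\<^sub>2 x)"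
proof -
  from heisenberg_hom_ex_unique[OF assms] show ?thesis
    by (elim bexE conjE) (intro bexI conjI)
qed

lemma heisenberg_hom_eqI:
  assumes f: "f \<in> cont_hom G heisenberg_group" and f': "f' \<in> cont_hom G heisenberg_group"
    and 1: "\<And>x. x \<in> carrier G\<^sub>1 \<Longrightarrow> f (\<iota>\<^sub>1 x) = f' (\<iota>\<^sub>1 x)"
    and 2: "\<And>x. x \<in> carrier G\<^sub>2 \<Longrightarrow> f (\<iota>\<^sub>2 x) = f' (\<iota>\<^sub>2 x)"
    and "x \<in> carrier G"
  shows "f x = f' x"
proof -
  have "f \<circ> \<iota>\<^sub>1 \<in> cont_hom G\<^sub>1 heisenberg_group" "f \<circ> \<iota>\<^sub>2 \<in> cont_hom G\<^sub>2 heisenberg_group"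
    using f inclusions by (auto simp: cont_hom_def hom_compose continuous_map_compose)
  from heisenberg_hom_ex_unique[OF this] obtain k where
    k: "\<forall>f'\<in>cont_hom G heisenberg_group.
        (\<forall>x\<in>carrier G\<^sub>1. f' (\<iota>\<^sub>1 x) = (f \<circ> \<iota>\<^sub>1) x) \<and> (\<forall>x\<in>carrier G\<^sub>2. f' (\<iota>\<^sub>2 x) = (f \<circ> \<iota>\<^sub>2) x) \<longrightarrow>
        (\<forall>x\<in>carrier G. f' x = k x)"
    by (elim bexE conjE)
  have "f x = k x"
    using k[THEN bspec, OF f] \<open>x \<in> carrier G\<close> by simp
  moreover have "f' x = k x"
    using k[THEN bspec, OF f'] \<open>x \<in> carrier G\<close> 1 2 by simp
  ultimately show ?thesis
    by simp
qed

text \<open>A character x becomes the representation (x, 0, 0), so the one test group also controls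
  characters with values in Z/2.\<close>

lemma trivial_bounds:
  assumes "bit_character H x"
  shows "bit_character H (\<lambda>_. 0)" "bounds_cup H x (\<lambda>_. 0) (\<lambda>_. 0)"
  using assms by (simp_all add: bit_character_def bounds_cup_def)

lemma bit_character_eqI:
  assumes x: "bit_character G x" and y: "bit_character G y"
    and "\<And>g. g \<in> carrier G\<^sub>1 \<Longrightarrow> x (\<iota>\<^sub>1 g) = y (\<iota>\<^sub>1 g)" "\<And>g. g \<in> carrier G\<^sub>2 \<Longrightarrow> x (\<iota>\<^sub>2 g) = y (\<iota>\<^sub>2 g)"
    and "g \<in> carrier G"
  shows "x g = y g"
proof -
  have "triple_code (x g, 0, 0) = triple_code (y g, 0, 0)"
    by (rule heisenberg_hom_eqI[OF heisenberg_homI[OF topspace_product x trivial_bounds[OF x]]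
          heisenberg_homI[OF topspace_product y trivial_bounds[OF y]]])
      (use assms(3-) in simp_all)
  then have "triple_decode (triple_code (x g, 0, 0)) = triple_decode (triple_code (y g, 0, 0))"
    by (rule arg_cong)
  then show ?thesis
    by simp
qed

lemma bit_character_extends:
  assumes "bit_character G\<^sub>1 x\<^sub>1" "bit_character G\<^sub>2 x\<^sub>2"
  obtains x where "bit_character G x" "\<And>g. g \<in> carrier G\<^sub>1 \<Longrightarrow> x (\<iota>\<^sub>1 g) = x\<^sub>1 g"
    "\<And>g. g \<in> carrier G\<^sub>2 \<Longrightarrow> x (\<iota>\<^sub>2 g) = x\<^sub>2 g"
proof -
  have "(\<lambda>g. triple_code (x\<^sub>1 g, 0, 0)) \<in> cont_hom G\<^sub>1 heisenberg_group"
    "(\<lambda>g. triple_code (x\<^sub>2 g, 0, 0)) \<in> cont_hom G\<^sub>2 heisenberg_group"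
    using heisenberg_homI[OF topspace_factors(1) assms(1) trivial_bounds[OF assms(1)]]
      heisenberg_homI[OF topspace_factors(2) assms(2) trivial_bounds[OF assms(2)]] .
  from heisenberg_hom_extends[OF this] obtain f where f: "f \<in> cont_hom G heisenberg_group"
    "\<forall>g\<in>carrier G\<^sub>1. f (\<iota>\<^sub>1 g) = triple_code (x\<^sub>1 g, 0, 0)"
    "\<forall>g\<in>carrier G\<^sub>2. f (\<iota>\<^sub>2 g) = triple_code (x\<^sub>2 g, 0, 0)"
    by (elim bexE conjE)
  from f(1) obtain x where "bit_character G x" "\<And>g. x g = fst (triple_decode (f g))"
    by (rule heisenberg_homE) blast
  then show thesis
    using that[of x] f(2,3) by simp
qed

text \<open>The universal property returns a triple (x', y', b) whose characters are not chosen in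
  advance. They agree with \<open>x\<close> and \<open>y\<close> on both factors, hence everywhere
  by uniqueness, so \<open>b\<close> bounds the product of the given characters.\<close>

lemma bounds_cup_extends:
  assumes x: "bit_character G x" and y: "bit_character G y"
    and "bounds_cup G\<^sub>1 (\<lambda>g. x (\<iota>\<^sub>1 g)) (\<lambda>g. y (\<iota>\<^sub>1 g)) b\<^sub>1"
    and "bounds_cup G\<^sub>2 (\<lambda>g. x (\<iota>\<^sub>2 g)) (\<lambda>g. y (\<iota>\<^sub>2 g)) b\<^sub>2"
  obtains b where "bounds_cup G x y b"
proof -
  have "(\<lambda>g. triple_code (x (\<iota>\<^sub>1 g), y (\<iota>\<^sub>1 g), b\<^sub>1 g)) \<in> cont_hom G\<^sub>1 heisenberg_group"
    "(\<lambda>g. triple_code (x (\<iota>\<^sub>2 g), y (\<iota>\<^sub>2 g), b\<^sub>2 g)) \<in> cont_hom G\<^sub>2 heisenberg_group"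
    using heisenberg_homI[OF topspace_factors(1) bit_character_pullback[OF inclusions(1) x]
        bit_character_pullback[OF inclusions(1) y] assms(3)]
      heisenberg_homI[OF topspace_factors(2) bit_character_pullback[OF inclusions(2) x]
        bit_character_pullback[OF inclusions(2) y] assms(4)] .
  from heisenberg_hom_extends[OF this] obtain f where f: "f \<in> cont_hom G heisenberg_group"
    "\<forall>g\<in>carrier G\<^sub>1. f (\<iota>\<^sub>1 g) = triple_code (x (\<iota>\<^sub>1 g), y (\<iota>\<^sub>1 g), b\<^sub>1 g)"
    "\<forall>g\<in>carrier G\<^sub>2. f (\<iota>\<^sub>2 g) = triple_code (x (\<iota>\<^sub>2 g), y (\<iota>\<^sub>2 g), b\<^sub>2 g)"
    by (elim bexE conjE)
  from f(1) obtain x' y' b where b: "bit_character G x'" "bit_character G y'" "bounds_cup G x' y' b"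
    "\<And>g. x' g = fst (triple_decode (f g))" "\<And>g. y' g = fst (snd (triple_decode (f g)))"
    by (rule heisenberg_homE) (rule that)
  have "x' g = x g" if "g \<in> carrier G" for g
    by (rule bit_character_eqI[OF b(1) x _ _ that]) (simp_all add: b(4) f(2,3))
  moreover have "y' g = y g" if "g \<in> carrier G" for g
    by (rule bit_character_eqI[OF b(2) y _ _ that]) (simp_all add: b(5) f(2,3))
  ultimately have "bounds_cup G x y b"
    by (rule bounds_cup_cong[OF b(3)])
  then show thesis
    by (rule that)
qed

end

lemma free_product_dichotomy:
  assumes \<G>: "cyclotomic_pair \<G>" and \<G>\<^sub>1: "cyclotomic_pair \<G>\<^sub>1" and \<G>\<^sub>2: "cyclotomic_pair \<G>\<^sub>2"
    and "is_free_product \<G>\<^sub>1 \<G>\<^sub>2 \<G>"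
    and "cube_trivial \<G>\<^sub>1 \<or> has_real_involution \<G>\<^sub>1" "cube_trivial \<G>\<^sub>2 \<or> has_real_involution \<G>\<^sub>2"
  shows "cube_trivial \<G> \<or> has_real_involution \<G>"
proof -
  interpret G: group \<G> using cyclotomic_pairD(1)[OF \<G>] .
  interpret G1: group \<G>\<^sub>1 using cyclotomic_pairD(1)[OF \<G>\<^sub>1] .
  interpret G2: group \<G>\<^sub>2 using cyclotomic_pairD(1)[OF \<G>\<^sub>2] .
  obtain \<iota>\<^sub>1 \<iota>\<^sub>2 where free: "is_free_pro_2_product \<G>\<^sub>1 \<iota>\<^sub>1 \<G>\<^sub>2 \<iota>\<^sub>2 \<G>"
    and chr1: "\<And>g. g \<in> carrier \<G>\<^sub>1 \<Longrightarrow> chr \<G> (\<iota>\<^sub>1 g) = chr \<G>\<^sub>1 g"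
    and chr2: "\<And>g. g \<in> carrier \<G>\<^sub>2 \<Longrightarrow> chr \<G> (\<iota>\<^sub>2 g) = chr \<G>\<^sub>2 g"
    using assms(4) by (auto simp: is_free_product_def)
  interpret free_pro_2_product \<G>\<^sub>1 \<iota>\<^sub>1 \<G>\<^sub>2 \<iota>\<^sub>2 \<G>
    by (unfold_locales) (use free cyclotomic_pairD(2)[OF \<G>\<^sub>1] cyclotomic_pairD(2)[OF \<G>\<^sub>2] in simp_all)
  have hom: "\<iota>\<^sub>1 \<in> hom \<G>\<^sub>1 \<G>" "\<iota>\<^sub>2 \<in> hom \<G>\<^sub>2 \<G>"
    using inclusions by (simp_all add: cont_hom_def)
  consider "has_real_involution \<G>\<^sub>1" | "has_real_involution \<G>\<^sub>2" | "cube_trivial \<G>\<^sub>1" "cube_trivial \<G>\<^sub>2"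
    using assms(5,6) by blast
  then show ?thesis
  proof cases
    case 1
    then show ?thesis
      using has_real_involution_image[OF G1.monoid_axioms G.group_axioms hom(1) chr1] by blast
  next
    case 2
    then show ?thesis
      using has_real_involution_image[OF G2.monoid_axioms G.group_axioms hom(2) chr2] by blast
  next
    case 3
    let ?e = "chr_bit \<G>" and ?e1 = "chr_bit \<G>\<^sub>1" and ?e2 = "chr_bit \<G>\<^sub>2"
    note e = bit_character_chr_bit[OF \<G>]
    have e1: "?e (\<iota>\<^sub>1 g) = ?e1 g" if "g \<in> carrier \<G>\<^sub>1" for g
      using chr1[OF that] by (simp add: chr_bit_def)
    have e2: "?e (\<iota>\<^sub>2 g) = ?e2 g" if "g \<in> carrier \<G>\<^sub>2" for g
      using chr2[OF that] by (simp add: chr_bit_def)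
    obtain x1 y1 a1 b1 d1 where 1: "bit_character \<G>\<^sub>1 x1" "bit_character \<G>\<^sub>1 y1"
      "bounds_cup \<G>\<^sub>1 (\<lambda>g. y1 g + ?e1 g) (\<lambda>g. x1 g + ?e1 g) a1"
      "bounds_cup \<G>\<^sub>1 x1 ?e1 b1" "bounds_cup \<G>\<^sub>1 y1 ?e1 d1"
      using 3(1) unfolding cube_trivial_def by blast
    obtain x2 y2 a2 b2 d2 where 2: "bit_character \<G>\<^sub>2 x2" "bit_character \<G>\<^sub>2 y2"
      "bounds_cup \<G>\<^sub>2 (\<lambda>g. y2 g + ?e2 g) (\<lambda>g. x2 g + ?e2 g) a2"
      "bounds_cup \<G>\<^sub>2 x2 ?e2 b2" "bounds_cup \<G>\<^sub>2 y2 ?e2 d2"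
      using 3(2) unfolding cube_trivial_def by blast
    obtain x where x: "bit_character \<G> x" "\<And>g. g \<in> carrier \<G>\<^sub>1 \<Longrightarrow> x (\<iota>\<^sub>1 g) = x1 g"
      "\<And>g. g \<in> carrier \<G>\<^sub>2 \<Longrightarrow> x (\<iota>\<^sub>2 g) = x2 g"
      using bit_character_extends[OF 1(1) 2(1)] by blast
    obtain y where y: "bit_character \<G> y" "\<And>g. g \<in> carrier \<G>\<^sub>1 \<Longrightarrow> y (\<iota>\<^sub>1 g) = y1 g"
      "\<And>g. g \<in> carrier \<G>\<^sub>2 \<Longrightarrow> y (\<iota>\<^sub>2 g) = y2 g"
      using bit_character_extends[OF 1(2) 2(2)] by blast
    have sum: "bit_character \<G> (\<lambda>g. z g + ?e g)" if "bit_character \<G> z" for z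
      using that e by (auto simp: bit_character_def algebra_simps intro: continuous_map_discrete_comp2)
    have "\<exists>a. bounds_cup \<G> (\<lambda>g. y g + ?e g) (\<lambda>g. x g + ?e g) a"
    proof -
      have "bounds_cup \<G>\<^sub>1 (\<lambda>g. y (\<iota>\<^sub>1 g) + ?e (\<iota>\<^sub>1 g)) (\<lambda>g. x (\<iota>\<^sub>1 g) + ?e (\<iota>\<^sub>1 g)) a1"
        by (rule bounds_cup_cong[OF 1(3)]) (simp_all add: x y e1 e2)
      moreover
      have "bounds_cup \<G>\<^sub>2 (\<lambda>g. y (\<iota>\<^sub>2 g) + ?e (\<iota>\<^sub>2 g)) (\<lambda>g. x (\<iota>\<^sub>2 g) + ?e (\<iota>\<^sub>2 g)) a2"
        by (rule bounds_cup_cong[OF 2(3)]) (simp_all add: x y e1 e2)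
      ultimately show ?thesis
        using bounds_cup_extends[OF sum[OF y(1)] sum[OF x(1)]] by blast
    qed
    moreover have "\<exists>b. bounds_cup \<G> x ?e b"
    proof -
      have "bounds_cup \<G>\<^sub>1 (\<lambda>g. x (\<iota>\<^sub>1 g)) (\<lambda>g. ?e (\<iota>\<^sub>1 g)) b1"
        by (rule bounds_cup_cong[OF 1(4)]) (simp_all add: x y e1 e2)
      moreover
      have "bounds_cup \<G>\<^sub>2 (\<lambda>g. x (\<iota>\<^sub>2 g)) (\<lambda>g. ?e (\<iota>\<^sub>2 g)) b2"
        by (rule bounds_cup_cong[OF 2(4)]) (simp_all add: x y e1 e2)
      ultimately show ?thesis
        using bounds_cup_extends[OF x(1) e] by blast
    qed
    moreover have "\<exists>d. bounds_cup \<G> y ?e d"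
    proof -
      have "bounds_cup \<G>\<^sub>1 (\<lambda>g. y (\<iota>\<^sub>1 g)) (\<lambda>g. ?e (\<iota>\<^sub>1 g)) d1"
        by (rule bounds_cup_cong[OF 1(5)]) (simp_all add: x y e1 e2)
      moreover
      have "bounds_cup \<G>\<^sub>2 (\<lambda>g. y (\<iota>\<^sub>2 g)) (\<lambda>g. ?e (\<iota>\<^sub>2 g)) d2"
        by (rule bounds_cup_cong[OF 2(5)]) (simp_all add: x y e1 e2)
      ultimately show ?thesis
        using bounds_cup_extends[OF y(1) e] by blast
    qed
    ultimately show ?thesis
      unfolding cube_trivial_def using x(1) y(1) by blast
  qed
qed

section \<open>Quadratic extensions inside the algebraic closure\<close>

lemma Q2bar_simps [simp]:
  "carrier Q2bar = UNIV" "x \<otimes>\<^bsub>Q2bar\<^esub> y = x * y" "x \<oplus>\<^bsub>Q2bar\<^esub> y = x + y"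
  "\<one>\<^bsub>Q2bar\<^esub> = 1" "\<zero>\<^bsub>Q2bar\<^esub> = 0"
  by (simp_all add: Q2bar_def ring_of_type_algebra_def)

lemma field_Q2bar: "field Q2bar"
  unfolding Q2bar_def by (rule field_from_type_algebra)

interpretation Q2bar: ring Q2bar
  using field_Q2bar by (intro cring.axioms domain.axioms field.axioms)

lemma Q2bar_a_inv [simp]: "\<ominus>\<^bsub>Q2bar\<^esub> x = - x"
  using Q2bar.minus_equality[of "- x" x] by simp

lemma Q2bar_m_inv: "x \<noteq> 0 \<Longrightarrow> inv\<^bsub>Q2bar\<^esub> x = inverse x"
  by (rule Q2bar.inv_char) simp_all

lemma subfield_Q2barI:
  assumes "1 \<in> L" "\<And>x y. x \<in> L \<Longrightarrow> y \<in> L \<Longrightarrow> x + y \<in> L" "\<And>x y. x \<in> L \<Longrightarrow> y \<in> L \<Longrightarrow> x * y \<in> L"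
    "\<And>x. x \<in> L \<Longrightarrow> - x \<in> L" "\<And>x. x \<in> L \<Longrightarrow> x \<noteq> 0 \<Longrightarrow> inverse x \<in> L"
  shows "subfield L Q2bar"
  by (rule field.subfieldI'[OF field_Q2bar Q2bar.subringI]) (use assms Q2bar_m_inv in simp_all)

lemma subfield_Q2barD:
  assumes "subfield L Q2bar"
  shows "1 \<in> L" "0 \<in> L" "\<And>x y. x \<in> L \<Longrightarrow> y \<in> L \<Longrightarrow> x + y \<in> L" "\<And>x y. x \<in> L \<Longrightarrow> y \<in> L \<Longrightarrow> x * y \<in> L"
    "\<And>x. x \<in> L \<Longrightarrow> - x \<in> L" "\<And>x. x \<in> L \<Longrightarrow> inverse x \<in> L"
    "\<And>x y. x \<in> L \<Longrightarrow> y \<in> L \<Longrightarrow> x - y \<in> L" "\<And>x y. x \<in> L \<Longrightarrow> y \<in> L \<Longrightarrow> x / y \<in> L"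
    "\<And>x n. x \<in> L \<Longrightarrow> x ^ n \<in> L"
proof -
  note S = subringE[OF subfieldE(1)[OF assms]]
  show 1: "1 \<in> L" and 0: "0 \<in> L" and add: "\<And>x y. x \<in> L \<Longrightarrow> y \<in> L \<Longrightarrow> x + y \<in> L"
    and mult: "\<And>x y. x \<in> L \<Longrightarrow> y \<in> L \<Longrightarrow> x * y \<in> L" and minus: "\<And>x. x \<in> L \<Longrightarrow> - x \<in> L"
    using S by simp_all
  show inv: "inverse x \<in> L" if "x \<in> L" for x
    using Q2bar.subfield_m_inv(1)[OF assms, of x] that 0 by (cases "x = 0") (simp_all add: Q2bar_m_inv)
  show "x - y \<in> L" if "x \<in> L" "y \<in> L" for x y
    using add[OF that(1) minus[OF that(2)]] by simp
  show "x / y \<in> L" if "x \<in> L" "y \<in> L" for x y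
    using mult[OF that(1) inv[OF that(2)]] by (simp add: divide_inverse)
  show "x ^ n \<in> L" if "x \<in> L" for x n
    by (induction n) (simp_all add: 1 mult that)
qed

text \<open>Characteristic 0, seen from the residue modulo 2^n: it is n itself because n <
  2^n.\<close>

lemma of_nat_Q2bar_neq_0:
  assumes "n > 0"
  shows "(of_nat n :: Q2bar) \<noteq> 0"
proof -
  have "res (of_nat n) n = int n"
    by (simp add: res_of_nat of_nat_less_two_power)
  then have "(of_nat n :: two_adic) \<noteq> 0"
    using assms by (auto simp: zero_two_adic.rep_eq)
  then have "(of_nat n :: two_adic fract) \<noteq> 0"
    by (simp add: of_nat_fract Zero_fract_def eq_fract)
  then show ?thesis
    by (metis to_ac_eq_0_iff to_ac_of_nat)
qed

lemma numeral_Q2bar_neq_0 [simp]: "(numeral k :: Q2bar) \<noteq> 0"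
  using of_nat_Q2bar_neq_0[of "numeral k"] by simp

lemma uminus_eq_self_Q2bar [simp]: "- x = x \<longleftrightarrow> (x :: Q2bar) = 0"
proof -
  have "- x = x \<longleftrightarrow> 2 * x = 0"
    unfolding mult_2 by (metis add.right_inverse add_eq_0_iff)
  then show ?thesis
    by simp
qed

lemma Q2bar_sqrt: "\<exists>w :: Q2bar. w * w = d"
  using nth_root_exists[of 2 d] by (auto simp: power2_eq_square)

section \<open>Automorphisms and their extension to a quadratic step\<close>

lemma Aut_over_iff:
  "\<sigma> \<in> Aut_over K L \<longleftrightarrow> \<sigma> \<in> extensional L \<and> bij_betw \<sigma> L L \<and>
     (\<forall>x\<in>L. \<forall>y\<in>L. \<sigma> (x + y) = \<sigma> x + \<sigma> y) \<and> (\<forall>x\<in>L. \<forall>y\<in>L. \<sigma> (x * y) = \<sigma> x * \<sigma> y) \<and>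
     \<sigma> 1 = 1 \<and> (\<forall>x\<in>K. \<sigma> x = x)"
  by (auto simp: Aut_over_def ring_iso_def ring_hom_def bij_betw_def)

lemma Aut_overD:
  assumes "\<sigma> \<in> Aut_over K L" "subfield L Q2bar"
  shows "\<sigma> \<in> extensional L" "bij_betw \<sigma> L L" "\<And>x. x \<in> L \<Longrightarrow> \<sigma> x \<in> L"
    "\<And>x y. x \<in> L \<Longrightarrow> y \<in> L \<Longrightarrow> \<sigma> (x + y) = \<sigma> x + \<sigma> y"
    "\<And>x y. x \<in> L \<Longrightarrow> y \<in> L \<Longrightarrow> \<sigma> (x * y) = \<sigma> x * \<sigma> y"
    "\<sigma> 1 = 1" "\<And>x. x \<in> K \<Longrightarrow> \<sigma> x = x" "\<sigma> 0 = 0"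
    "\<And>x. x \<in> L \<Longrightarrow> \<sigma> (- x) = - \<sigma> x" "\<And>x y. x \<in> L \<Longrightarrow> y \<in> L \<Longrightarrow> \<sigma> (x - y) = \<sigma> x - \<sigma> y"
    "\<And>x. x \<in> L \<Longrightarrow> \<sigma> x = 0 \<longleftrightarrow> x = 0"
    "\<And>x y. x \<in> L \<Longrightarrow> y \<in> L \<Longrightarrow> \<sigma> (x / y) = \<sigma> x / \<sigma> y"
    "\<And>x n. x \<in> L \<Longrightarrow> \<sigma> (x ^ n) = \<sigma> x ^ n"
proof -
  note L = subfield_Q2barD[OF assms(2)]
  show ext: "\<sigma> \<in> extensional L" and bij: "bij_betw \<sigma> L L"
    and add: "\<And>x y. x \<in> L \<Longrightarrow> y \<in> L \<Longrightarrow> \<sigma> (x + y) = \<sigma> x + \<sigma> y"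
    and mult: "\<And>x y. x \<in> L \<Longrightarrow> y \<in> L \<Longrightarrow> \<sigma> (x * y) = \<sigma> x * \<sigma> y"
    and 1: "\<sigma> 1 = 1" and "\<And>x. x \<in> K \<Longrightarrow> \<sigma> x = x"
    using assms(1) by (simp_all add: Aut_over_iff)
  show "\<And>x. x \<in> L \<Longrightarrow> \<sigma> x \<in> L"
    using bij by (auto simp: bij_betw_def)
  show 0: "\<sigma> 0 = 0"
    using add[OF L(2) L(2)] by (metis add.right_neutral add_left_cancel)
  show minus: "\<sigma> (- x) = - \<sigma> x" if "x \<in> L" for x
    using add[OF that L(5)[OF that]] 0 by (simp add: eq_neg_iff_add_eq_0 add.commute)
  show "\<sigma> (x - y) = \<sigma> x - \<sigma> y" if "x \<in> L" "y \<in> L" for x y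
    using add[OF that(1) L(5)[OF that(2)]] minus[OF that(2)] by simp
  show nz: "\<sigma> x = 0 \<longleftrightarrow> x = 0" if "x \<in> L" for x
    using bij_betw_imp_inj_on[OF bij] that L(2) 0 by (metis inj_onD)
  show "\<sigma> (x / y) = \<sigma> x / \<sigma> y" if "x \<in> L" "y \<in> L" for x y
  proof (cases "y = 0")
    case False
    then have "\<sigma> x = \<sigma> (x / y) * \<sigma> y"
      using mult[OF L(8)[OF that] that(2)] by simp
    then show ?thesis
      using False nz[OF that(2)] by simp
  qed (simp add: 0)
  show "\<sigma> (x ^ n) = \<sigma> x ^ n" if "x \<in> L" for x n
    by (induction n) (simp_all add: 1 mult that L(9))
qed

text \<open>For a square root of an element of the field \<open>L\<close>, these combinations
  already form the field L(w).\<close>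

definition adjoin :: "Q2bar set \<Rightarrow> Q2bar \<Rightarrow> Q2bar set" where
  "adjoin L w = {p + q * w | p q. p \<in> L \<and> q \<in> L}"

locale quadratic_extension =
  fixes L :: "Q2bar set" and w :: Q2bar
  assumes L: "subfield L Q2bar" and square: "w * w \<in> L" and new: "w \<notin> L"
begin

lemmas L_closed = subfield_Q2barD[OF L]

lemma adjoinI: "p \<in> L \<Longrightarrow> q \<in> L \<Longrightarrow> p + q * w \<in> adjoin L w"
  by (auto simp: adjoin_def)

lemma incl: "x \<in> L \<Longrightarrow> x \<in> adjoin L w"
  using adjoinI[of x 0] by (simp add: L_closed)

lemma generator_mem: "w \<in> adjoin L w"
  using adjoinI[of 0 1] by (simp add: L_closed)

lemma coordinates_zero:
  assumes "p \<in> L" "q \<in> L" "p + q * w = 0"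
  shows "q = 0"
proof (rule ccontr)
  assume "q \<noteq> 0"
  then have "w = - p / q"
    using assms(3) by (simp add: field_simps eq_neg_iff_add_eq_0)
  moreover have "- p / q \<in> L"
    using assms(1,2) by (simp only: L_closed)
  ultimately show False
    using new by simp
qed

lemma coordinates_unique:
  assumes "p \<in> L" "q \<in> L" "p' \<in> L" "q' \<in> L" "p + q * w = p' + q' * w"
  shows "p = p'" "q = q'"
proof -
  have "(p - p') + (q - q') * w = 0"
    using assms(5) by (simp add: algebra_simps)
  from coordinates_zero[OF _ _ this] have "q - q' = 0"
    using assms(1-4) by (simp add: L_closed)
  then show "q = q'" "p = p'"
    using assms(5) by simp_all
qed

text \<open>The expression is the norm of p + q w, its product with p - q w; it becomes the
  denominator of the inverse.\<close>

lemma norm_neq_0: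
  assumes "p \<in> L" "q \<in> L" "p + q * w \<noteq> 0"
  shows "p * p - q * q * (w * w) \<noteq> 0"
proof
  assume "p * p - q * q * (w * w) = 0"
  then have "(p + q * w) * (p - q * w) = 0"
    by (simp add: algebra_simps)
  then have "p + (- q) * w = 0"
    using assms(3) by simp
  then have "q = 0"
    using coordinates_zero[of p "- q"] assms(1,2) by (simp add: L_closed)
  then show False
    using \<open>p + (- q) * w = 0\<close> assms(3) by simp
qed

lemma subfield_adjoin: "subfield (adjoin L w) Q2bar"
proof (rule subfield_Q2barI)
  show "1 \<in> adjoin L w"
    by (rule incl) (rule L_closed)
next
  fix x y assume "x \<in> adjoin L w" "y \<in> adjoin L w"
  then obtain p q p' q' where x: "x = p + q * w" "p \<in> L" "q \<in> L" and y: "y = p' + q' * w" "p' \<in> L" "q' \<in> L"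
    by (auto simp: adjoin_def)
  have sum: "x + y = (p + p') + (q + q') * w"
    by (simp add: x y algebra_simps)
  show "x + y \<in> adjoin L w"
    unfolding sum by (rule adjoinI) (simp_all add: x y L_closed)
  have prod: "x * y = (p * p' + q * q' * (w * w)) + (p * q' + q * p') * w"
    by (simp add: x y algebra_simps)
  show "x * y \<in> adjoin L w"
    unfolding prod by (rule adjoinI) (simp_all add: x y L_closed square)
next
  fix x assume "x \<in> adjoin L w"
  then obtain p q where x: "x = p + q * w" "p \<in> L" "q \<in> L"
    by (auto simp: adjoin_def)
  show "- x \<in> adjoin L w"
    using adjoinI[of "- p" "- q"] x by (simp add: L_closed)
  assume "x \<noteq> 0"
  define n where "n = p * p - q * q * (w * w)"
  have n: "n \<noteq> 0" "n \<in> L"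
    using norm_neq_0 x \<open>x \<noteq> 0\<close> square by (simp_all add: n_def L_closed)
  have "x * (p / n + (- q / n) * w) = (p * p - q * q * (w * w)) / n"
    using n(1) by (simp add: x field_simps)
  also have "\<dots> = 1"
    using n by (simp add: n_def)
  finally have "inverse x = p / n + (- q / n) * w"
    by (rule inverse_unique)
  then show "inverse x \<in> adjoin L w"
    using adjoinI[of "p / n" "- q / n"] x n by (simp add: L_closed)
qed

lemma dimension_adjoin: "Q2bar.dimension 2 L (adjoin L w)"
proof -
  have "Q2bar.dimension (Suc 1) L (Q2bar.line_extension L w L)"
    by (rule Q2bar.Suc_dim) (use new Q2bar.dimension_one[OF L] in simp_all)
  moreover have "Q2bar.line_extension L w L = adjoin L w"
    by (auto simp: Q2bar.line_extension_mem_iff adjoin_def add.commute) (metis add.commute)+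
  ultimately show ?thesis
    by (simp add: numeral_2_eq_2)
qed

text \<open>The assumption on \<open>t\<close> says that t w is a square root of the image of w^2,
  so w may be sent to t w. The identity with t = -1 yields the conjugation of L(w) over
  \<open>L\<close>.\<close>

lemma automorphism_extends:
  assumes "K \<subseteq> L" and \<sigma>: "\<sigma> \<in> Aut_over K L" and "t \<in> L" and t: "\<sigma> (w * w) = w * w * (t * t)"
  obtains \<tau> where "\<tau> \<in> Aut_over K (adjoin L w)" "\<And>p q. p \<in> L \<Longrightarrow> q \<in> L \<Longrightarrow> \<tau> (p + q * w) = \<sigma> p + \<sigma> q * (t * w)"
proof -
  note s = Aut_overD[OF \<sigma> L]
  have "w \<noteq> 0"
    using new L_closed(2) by auto
  then have "t \<noteq> 0"
    using t s(11)[OF square] by auto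
  have "\<forall>z\<in>adjoin L w. \<exists>p q. p \<in> L \<and> q \<in> L \<and> z = p + q * w"
    by (auto simp: adjoin_def)
  then obtain P Q where PQ: "\<And>z. z \<in> adjoin L w \<Longrightarrow> P z \<in> L \<and> Q z \<in> L \<and> z = P z + Q z * w"
    by metis
  define \<tau> where "\<tau> = (\<lambda>z\<in>adjoin L w. \<sigma> (P z) + \<sigma> (Q z) * (t * w))"
  have \<tau>: "\<tau> (p + q * w) = \<sigma> p + \<sigma> q * t * w" if "p \<in> L" "q \<in> L" for p q
  proof -
    let ?z = "p + q * w"
    have "?z \<in> adjoin L w"
      using that by (rule adjoinI)
    moreover from PQ[OF this] have "P ?z \<in> L" "Q ?z \<in> L" "P ?z + Q ?z * w = p + q * w"
      by simp_all
    then have "P ?z = p" "Q ?z = q"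
      using coordinates_unique that by blast+
    ultimately show ?thesis
      by (simp add: \<tau>_def)
  qed
  have \<tau>_L: "\<tau> p = \<sigma> p" if "p \<in> L" for p
    using \<tau>[OF that L_closed(2)] s(8) by simp
  have "\<tau> \<in> Aut_over K (adjoin L w)"
    unfolding Aut_over_iff
  proof (intro conjI ballI)
    show "\<tau> \<in> extensional (adjoin L w)"
      by (simp add: \<tau>_def)
    show "bij_betw \<tau> (adjoin L w) (adjoin L w)"
      unfolding bij_betw_def
    proof (intro conjI equalityI subsetI inj_onI)
      fix x y assume "x \<in> adjoin L w" "y \<in> adjoin L w" and eq: "\<tau> x = \<tau> y"
      then obtain p q p' q' where x: "x = p + q * w" "p \<in> L" "q \<in> L" and y: "y = p' + q' * w" "p' \<in> L" "q' \<in> L"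
        by (auto simp: adjoin_def)
      then have "\<sigma> p = \<sigma> p'" "\<sigma> q * t = \<sigma> q' * t"
        using coordinates_unique[of "\<sigma> p" "\<sigma> q * t" "\<sigma> p'" "\<sigma> q' * t"] eq \<open>t \<in> L\<close>
        by (simp_all add: \<tau> s(3) L_closed)
      then show "x = y"
        using x y \<open>t \<noteq> 0\<close> inj_on_eq_iff[OF bij_betw_imp_inj_on[OF s(2)]] by simp
    next
      fix z assume "z \<in> \<tau> ` adjoin L w"
      then obtain p q where "z = \<sigma> p + \<sigma> q * t * w" "p \<in> L" "q \<in> L"
        by (auto simp: adjoin_def \<tau>)
      then show "z \<in> adjoin L w"
        using adjoinI[of "\<sigma> p" "\<sigma> q * t"] \<open>t \<in> L\<close> by (simp add: s(3) L_closed)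
    next
      fix z assume "z \<in> adjoin L w"
      then obtain p q where z: "z = p + q * w" "p \<in> L" "q \<in> L"
        by (auto simp: adjoin_def)
      have "\<sigma> ` L = L"
        using s(2) by (simp add: bij_betw_def)
      then obtain p' q' where "p' \<in> L" "\<sigma> p' = p" "q' \<in> L" "\<sigma> q' = q / t"
        using z L_closed(8)[OF _ \<open>t \<in> L\<close>] by (metis imageE)
      then have "\<tau> (p' + q' * w) = z" "p' + q' * w \<in> adjoin L w"
        using \<tau> adjoinI z \<open>t \<noteq> 0\<close> by simp_all
      then show "z \<in> \<tau> ` adjoin L w"
        by blast
    qed
  next
    fix x y assume "x \<in> adjoin L w" "y \<in> adjoin L w"
    then obtain p q p' q' where x: "x = p + q * w" "p \<in> L" "q \<in> L" and y: "y = p' + q' * w" "p' \<in> L" "q' \<in> L"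
      by (auto simp: adjoin_def)
    have sum: "x + y = (p + p') + (q + q') * w"
      by (simp add: x y algebra_simps)
    have "\<tau> (x + y) = \<sigma> (p + p') + \<sigma> (q + q') * t * w"
      unfolding sum by (rule \<tau>) (simp_all add: x y L_closed)
    then show "\<tau> (x + y) = \<tau> x + \<tau> y"
      using x y by (simp add: \<tau> s(4) algebra_simps)
    have prod: "x * y = (p * p' + q * q' * (w * w)) + (p * q' + q * p') * w"
      by (simp add: x y algebra_simps)
    have "\<tau> (x * y) = \<sigma> (p * p' + q * q' * (w * w)) + \<sigma> (p * q' + q * p') * t * w"
      unfolding prod by (rule \<tau>) (simp_all add: x y L_closed square)
    also have "\<sigma> (p * p' + q * q' * (w * w)) = \<sigma> p * \<sigma> p' + \<sigma> q * \<sigma> q' * (w * w * (t * t))"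
      using x y square by (simp add: L_closed s(4,5) t)
    also have "\<sigma> (p * q' + q * p') = \<sigma> p * \<sigma> q' + \<sigma> q * \<sigma> p'"
      using x y by (simp add: L_closed s(4,5))
    finally show "\<tau> (x * y) = \<tau> x * \<tau> y"
      using x y by (simp add: \<tau> algebra_simps)
  next
    show "\<tau> 1 = 1"
      using \<tau>_L[OF L_closed(1)] s(6) by (rule trans)
    show "\<tau> x = x" if "x \<in> K" for x
      using \<tau>_L s(7)[OF that] that \<open>K \<subseteq> L\<close> by auto
  qed
  then show thesis
    using that[of \<tau>] \<tau> by (simp add: mult.assoc)
qed

end

section \<open>Finite Galois 2-extensions\<close>

lemma id_in_Aut_over: "K \<subseteq> L \<Longrightarrow> subfield L Q2bar \<Longrightarrow> (\<lambda>x\<in>L. x) \<in> Aut_over K L"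
  by (auto simp: Aut_over_iff subfield_Q2barD bij_betw_def inj_on_def)

lemma galois_2_extD:
  assumes "galois_2_ext K L"
  shows "subfield L Q2bar" "K \<subseteq> L" "\<exists>n. Q2bar.dimension (2 ^ n) K L"
    "\<And>x. x \<in> L \<Longrightarrow> (\<And>\<sigma>. \<sigma> \<in> Aut_over K L \<Longrightarrow> \<sigma> x = x) \<Longrightarrow> x \<in> K"
  using assms by (auto simp: galois_2_ext_def)

lemma galois_2_ext_refl:
  assumes "subfield K Q2bar"
  shows "galois_2_ext K K"
proof -
  have "Q2bar.dimension (2 ^ 0) K K"
    using Q2bar.dimension_one[OF assms] by simp
  moreover have "{x \<in> K. \<forall>\<sigma>\<in>Aut_over K K. \<sigma> x = x} = K"
    by (auto simp: Aut_over_iff)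
  ultimately show ?thesis
    using assms unfolding galois_2_ext_def by blast
qed

text \<open>Every automorphism of \<open>L\<close> extends to L(w), since each conjugate of w^2 is
  w^2 times a square in \<open>L\<close>. The degree is unchanged or doubles, so it stays a power of
  2. All memberships in K(2) below rest on this criterion.\<close>

lemma galois_2_ext_sqrt:
  assumes K: "subfield K Q2bar" and KL: "galois_2_ext K L" and square: "w * w \<in> L"
    and conjugates: "\<And>\<sigma>. \<sigma> \<in> Aut_over K L \<Longrightarrow> \<exists>t\<in>L. \<sigma> (w * w) = w * w * (t * t)"
  obtains L' where "galois_2_ext K L'" "L \<subseteq> L'" "w \<in> L'"
proof (cases "w \<in> L")
  case True
  then show thesis
    using that KL by blast
next
  case False
  note KLD = galois_2_extD[OF KL]
  interpret quadratic_extension L w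
    using KLD(1) square False by (rule quadratic_extension.intro)
  have KL': "K \<subseteq> adjoin L w"
    using KLD(2) incl by blast
  obtain n where "Q2bar.dimension (2 ^ n) K L"
    using KLD(3) by blast
  then have "Q2bar.dimension (2 ^ n * 2) K (adjoin L w)"
    using Q2bar.telescopic_base[OF K KLD(1) _ dimension_adjoin] by blast
  then have dim: "Q2bar.dimension (2 ^ Suc n) K (adjoin L w)"
    by (simp add: mult.commute)
  have "z \<in> K" if z: "z \<in> adjoin L w" and fixed: "\<And>\<tau>. \<tau> \<in> Aut_over K (adjoin L w) \<Longrightarrow> \<tau> z = z" for z
  proof -
    from z obtain p q where pq: "z = p + q * w" "p \<in> L" "q \<in> L"
      by (auto simp: adjoin_def)
    \<comment> \<open>The extension of the identity with w -> -w removes the w-coordinate of a fixed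
      element. Extensions of the automorphisms of \<open>L\<close> then force the remaining
      coordinate into \<open>K\<close>.\<close>
    have id: "(\<lambda>x\<in>L. x) \<in> Aut_over K L" "(\<lambda>x\<in>L. x) (w * w) = w * w * (- 1 * - 1)"
      using id_in_Aut_over[OF KLD(2,1)] square by simp_all
    have "- 1 \<in> L"
      by (simp add: L_closed)
    then obtain \<tau> where \<tau>: "\<tau> \<in> Aut_over K (adjoin L w)"
      "\<And>p q. p \<in> L \<Longrightarrow> q \<in> L \<Longrightarrow> \<tau> (p + q * w) = (\<lambda>x\<in>L. x) p + (\<lambda>x\<in>L. x) q * (- 1 * w)"
      by (rule automorphism_extends[OF KLD(2) id(1) _ id(2)]) (rule that)
    have "p + q * w = p + (- q) * w"
      using fixed[OF \<tau>(1)] \<tau>(2)[OF pq(2,3)] pq by simp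
    then have "q = - q"
      using coordinates_unique(2)[of p q p "- q"] pq(2,3) L_closed(5) by blast
    then have "q = 0"
      by (metis uminus_eq_self_Q2bar)
    then have "z \<in> L"
      using pq by simp
    moreover have "\<sigma> z = z" if \<sigma>: "\<sigma> \<in> Aut_over K L" for \<sigma>
    proof -
      obtain t where t: "t \<in> L" "\<sigma> (w * w) = w * w * (t * t)"
        using conjugates[OF \<sigma>] by blast
      obtain \<tau> where \<tau>: "\<tau> \<in> Aut_over K (adjoin L w)"
        "\<And>p q. p \<in> L \<Longrightarrow> q \<in> L \<Longrightarrow> \<tau> (p + q * w) = \<sigma> p + \<sigma> q * (t * w)"
        by (rule automorphism_extends[OF KLD(2) \<sigma> t]) (rule that)
      have "\<tau> z = \<sigma> z"
        using \<tau>(2)[OF \<open>z \<in> L\<close> L_closed(2)] Aut_overD(8)[OF \<sigma> KLD(1)] by simp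
      then show ?thesis
        using fixed[OF \<tau>(1)] by simp
    qed
    ultimately show ?thesis
      by (rule KLD(4))
  qed
  moreover have "\<tau> z = z" if "\<tau> \<in> Aut_over K (adjoin L w)" "z \<in> K" for \<tau> z
    using that by (simp add: Aut_over_iff)
  ultimately have "{z \<in> adjoin L w. \<forall>\<tau>\<in>Aut_over K (adjoin L w). \<tau> z = z} = K"
    using KL' by blast
  then have "galois_2_ext K (adjoin L w)"
    unfolding galois_2_ext_def using subfield_adjoin KL' dim by blast
  moreover have "L \<subseteq> adjoin L w"
    using incl by blast
  ultimately show thesis
    using that generator_mem by blast
qed

lemma max_pro_2_ext_subfield: "subfield (max_pro_2_ext K) Q2bar"
  unfolding max_pro_2_ext_def by (rule field.generate_field_is_subfield[OF field_Q2bar]) simp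

lemma max_pro_2_ext_incl: "galois_2_ext K L \<Longrightarrow> x \<in> L \<Longrightarrow> x \<in> max_pro_2_ext K"
  unfolding max_pro_2_ext_def by (rule generate_field.incl) blast

section \<open>Pairs of 2-adic type\<close>

text \<open>A Hensel iteration on integers, where each step gains one binary digit of t^2 +
  7.\<close>

lemma two_adic_sqrt_minus_7: "\<exists>s :: two_adic. s * s = - 7"
proof -
  \<comment> \<open>The offset 3 matches the start 1 + 7 = 2^3. It leaves room for the correction of
    t by 2^(n+2): this changes the square by 2^(n+3) (t + 2^(n+1)), an odd multiple of
    2^(n+3).\<close>
  let ?P = "\<lambda>n t. odd t \<and> 2 ^ (n + 3) dvd t * t + (7 :: int)"
  have "\<exists>t. \<forall>n. ?P n (t n) \<and> 2 ^ n dvd t (Suc n) - t n"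
  proof (rule dependent_nat_choice)
    show "\<exists>t. ?P 0 t"
      by (rule exI[of _ 1]) simp
  next
    fix t n assume t: "?P n t"
    then obtain m where m: "t * t + 7 = 2 ^ (n + 3) * m"
      by (auto simp: dvd_def)
    show "\<exists>u. ?P (Suc n) u \<and> 2 ^ n dvd u - t"
    proof (cases "even m")
      case True
      then obtain k where "m = 2 * k"
        by blast
      then have "t * t + 7 = 2 ^ (Suc n + 3) * k"
        using m by (simp add: power_add)
      then show ?thesis
        using t by (intro exI[of _ t]) auto
    next
      case False
      let ?u = "t + 2 ^ (n + 2)"
      have "even (m + t + 2 ^ (n + 1))"
        using False t by simp
      then obtain k where k: "m + t + 2 ^ (n + 1) = 2 * k"
        by blast
      have "?u * ?u + 7 = 2 ^ (n + 3) * (m + t + 2 ^ (n + 1))"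
      proof -
        have "?u * ?u + 7 = (t * t + 7) + (2 ^ (n + 3) * t + 2 ^ (n + 2) * 2 ^ (n + 2))"
          by (simp add: algebra_simps power_add)
        also have "\<dots> = 2 ^ (n + 3) * (m + t + 2 ^ (n + 1))"
          unfolding m by (simp add: algebra_simps power_add)
        finally show ?thesis .
      qed
      also have "\<dots> = 2 ^ (Suc n + 3) * k"
        unfolding k by (simp add: power_add)
      finally have "2 ^ (Suc n + 3) dvd ?u * ?u + 7"
        by (rule dvdI)
      moreover have "odd ?u" "2 ^ n dvd ?u - t"
        using t by (simp_all add: power_add)
      ultimately show ?thesis
        by blast
    qed
  qed
  then obtain t where t: "\<And>n. 2 ^ (n + 3) dvd t n * t n + (7 :: int)" "\<And>n. 2 ^ n dvd t (Suc n) - t n"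
    by blast
  have "t n mod 2 ^ n = t (Suc n) mod 2 ^ Suc n mod 2 ^ n" for n
    using t(2)[of n] by (simp only: mod_pow_Suc) (metis mod_eq_dvd_iff)
  then obtain s where s: "\<And>n. res s n = t n mod 2 ^ n"
    using two_adic_of_coherent[of "\<lambda>n. t n mod 2 ^ n"] by blast
  have "s * s = - 7"
  proof (rule two_adic_eqI)
    fix n
    have "(2 :: int) ^ n dvd 2 ^ (n + 3)"
      by (simp add: le_imp_power_dvd)
    then have "2 ^ n dvd t n * t n - (- 7)"
      using t(1)[of n] by (simp add: dvd_trans)
    then have "t n * t n mod 2 ^ n = (- 7) mod 2 ^ n"
      by (simp only: mod_eq_dvd_iff)
    then show "res (s * s) n = res (- 7) n"
      using res_of_int[of "- 7" n] by (simp add: times_two_adic.rep_eq s mod_simps)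
  qed
  then show ?thesis
    by blast
qed

lemma Q2bar_sqrt_minus_7: "\<exists>s\<in>range to_ac. s * s = (- 7 :: Q2bar)"
proof -
  obtain s :: two_adic where s: "s * s = - 7"
    using two_adic_sqrt_minus_7 by blast
  have "Fract (7 :: two_adic) 1 = 7"
    using of_nat_fract[of 7, where ?'a = two_adic] by simp
  then have "Fract s 1 * Fract s 1 = - 7"
    by (simp add: s flip: minus_fract)
  then have "to_ac (Fract s 1) * to_ac (Fract s 1) = to_ac (- 7)"
    by (metis to_ac_mult)
  then show ?thesis
    by (intro bexI[of _ "to_ac (Fract s 1)"]) simp_all
qed

text \<open>Each root is an arbitrary square root of its predecessor. Starting from -1 is what makes
  the n-th one primitive of order 2^n.\<close>

lemma Q2bar_two_power_roots:
  obtains \<zeta> :: "nat \<Rightarrow> Q2bar" where "\<zeta> 0 = 1" "\<zeta> (Suc 0) = - 1" "\<And>n. \<zeta> (Suc n) * \<zeta> (Suc n) = \<zeta> n"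
proof -
  obtain f :: "Q2bar \<Rightarrow> Q2bar" where f: "\<And>x. f x * f x = x"
    using Q2bar_sqrt by metis
  define \<zeta> where "\<zeta> n = (case n of 0 \<Rightarrow> 1 | Suc k \<Rightarrow> (f ^^ k) (- 1))" for n
  have "\<zeta> (Suc n) * \<zeta> (Suc n) = \<zeta> n" for n
    by (cases n) (simp_all add: \<zeta>_def f)
  then show thesis
    by (intro that[of \<zeta>]) (simp_all add: \<zeta>_def)
qed

definition bit_sign :: "bit \<Rightarrow> Q2bar" where
  "bit_sign b = (if b = 0 then 1 else - 1)"

lemma bit_sign_add: "bit_sign (a + b) = bit_sign a * bit_sign b"
  by (cases a; cases b) (simp_all add: bit_sign_def)

lemma bit_sign_square [simp]: "bit_sign a * bit_sign a = 1" "bit_sign a \<noteq> 0"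
  by (simp_all add: bit_sign_def)

lemma bit_sign_eq_iff: "bit_sign a = bit_sign b \<longleftrightarrow> a = b"
proof -
  have "(1 :: Q2bar) \<noteq> - 1"
    by (metis uminus_eq_self_Q2bar zero_neq_one)
  then show ?thesis
    by (cases a; cases b) (auto simp: bit_sign_def)
qed

text \<open>For r^2 in \<open>K\<close> this is the Kummer character of r^2.\<close>

definition sqrt_character :: "Q2bar \<Rightarrow> (Q2bar \<Rightarrow> Q2bar) \<Rightarrow> bit" where
  "sqrt_character r \<sigma> = (if \<sigma> r = r then 0 else 1)"

locale two_adic_field =
  fixes K :: "Q2bar set"
  assumes finite_ext: "finite_ext_Q2 K"
begin

abbreviation "M \<equiv> max_pro_2_ext K"
abbreviation "\<Gamma> \<equiv> Aut_over K M"

lemma subfield_K: "subfield K Q2bar" and base: "range to_ac \<subseteq> K"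
  using finite_ext by (simp_all add: finite_ext_Q2_def)

lemmas K_closed = subfield_Q2barD[OF subfield_K]
lemmas M_closed = subfield_Q2barD[OF max_pro_2_ext_subfield[of K]]
lemmas \<Gamma>D = Aut_overD[OF _ max_pro_2_ext_subfield[of K]]

lemma numeral_in_K: "numeral k \<in> K"
  using base by (metis rangeI subset_iff to_ac_numeral)

lemma K_in_M: "x \<in> K \<Longrightarrow> x \<in> M"
  by (rule max_pro_2_ext_incl[OF galois_2_ext_refl[OF subfield_K]])

section \<open>Kummer characters of the Galois group\<close>

lemma galois_pair_simps:
  "carrier (galois_pair K) = \<Gamma>"
  "topo (galois_pair K) = topology_generated_by {{\<sigma> \<in> \<Gamma>. \<sigma> x = y} | x y. x \<in> M \<and> y \<in> M}"
  "chr (galois_pair K) = cyclotomic_character"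
  by (simp_all add: galois_pair_def Let_def)

lemma galois_pair_mult: "x \<in> M \<Longrightarrow> (\<sigma> \<otimes>\<^bsub>galois_pair K\<^esub> \<tau>) x = \<sigma> (\<tau> x)"
  by (simp add: galois_pair_def Let_def compose_def)

lemma topspace_galois_pair: "topspace (topo (galois_pair K)) = \<Gamma>"
proof -
  have "\<Gamma> \<subseteq> {\<sigma> \<in> \<Gamma>. \<sigma> 0 = 0}"
    using \<Gamma>D(8) by blast
  then show ?thesis
    unfolding galois_pair_simps topology_generated_by_topspace using M_closed(2) by blast
qed

lemma continuous_map_evaluation:
  assumes "x \<in> M"
  shows "continuous_map (topo (galois_pair K)) (discrete_topology UNIV) (\<lambda>\<sigma>. \<sigma> x)"
  unfolding continuous_map_def
proof (intro conjI allI impI)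
  fix U :: "Q2bar set"
  have "{\<sigma> \<in> topspace (topo (galois_pair K)). \<sigma> x \<in> U} = (\<Union>y\<in>U \<inter> M. {\<sigma> \<in> \<Gamma>. \<sigma> x = y})"
    using \<Gamma>D(3) assms by (auto simp: topspace_galois_pair)
  moreover have "openin (topo (galois_pair K)) {\<sigma> \<in> \<Gamma>. \<sigma> x = y}" if "y \<in> U \<inter> M" for y
    unfolding galois_pair_simps by (rule topology_generated_by_Basis) (use that assms in blast)
  ultimately show "openin (topo (galois_pair K)) {\<sigma> \<in> topspace (topo (galois_pair K)). \<sigma> x \<in> U}"
    by (auto intro!: openin_Union)
qed simp

lemma sqrt_conjugate:
  assumes "\<sigma> \<in> \<Gamma>" "r \<in> M" "r * r \<in> K"
  shows "\<sigma> r = bit_sign (sqrt_character r \<sigma>) * r"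
proof -
  have "\<sigma> r * \<sigma> r = r * r"
    using \<Gamma>D(5)[OF assms(1,2,2)] \<Gamma>D(7)[OF assms(1,3)] by simp
  then have "\<sigma> r = r \<or> \<sigma> r = - r"
    by (simp add: square_eq_iff)
  then show ?thesis
    by (auto simp: sqrt_character_def bit_sign_def)
qed

lemma \<Gamma>_bit_sign: "\<sigma> \<in> \<Gamma> \<Longrightarrow> \<sigma> (bit_sign a) = bit_sign a" and bit_sign_in_M: "bit_sign a \<in> M"
  using \<Gamma>D(6,9)[of \<sigma>] M_closed(1,5) by (auto simp: bit_sign_def)

lemma sqrt_character_mult:
  assumes "\<sigma> \<in> \<Gamma>" "r \<in> M" "r * r \<in> K" "s \<in> M" "s * s \<in> K" "r \<noteq> 0" "s \<noteq> 0"
  shows "sqrt_character (r * s) \<sigma> = sqrt_character r \<sigma> + sqrt_character s \<sigma>"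
proof -
  have "(r * s) * (r * s) = (r * r) * (s * s)"
    by (simp only: ac_simps)
  then have "(r * s) * (r * s) \<in> K"
    using K_closed(4)[OF assms(3,5)] by (simp only:)
  then have "bit_sign (sqrt_character (r * s) \<sigma>) * (r * s) = \<sigma> (r * s)"
    using sqrt_conjugate[OF assms(1) M_closed(4)[OF assms(2,4)]] by simp
  also have "\<dots> = bit_sign (sqrt_character r \<sigma>) * bit_sign (sqrt_character s \<sigma>) * (r * s)"
    using \<Gamma>D(5)[OF assms(1,2,4)] sqrt_conjugate[OF assms(1-3)] sqrt_conjugate[OF assms(1,4,5)] by simp
  finally show ?thesis
    using assms(6,7) by (simp flip: bit_sign_add add: bit_sign_eq_iff)
qed

lemma bit_character_sqrt:
  assumes "r \<in> M" "r * r \<in> K" "r \<noteq> 0"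
  shows "bit_character (galois_pair K) (sqrt_character r)"
  unfolding bit_character_def
proof (intro conjI ballI)
  show "continuous_map (topo (galois_pair K)) (discrete_topology UNIV) (sqrt_character r)"
    unfolding sqrt_character_def[abs_def]
    by (rule continuous_map_discrete_comp[OF continuous_map_evaluation[OF assms(1)]])
  fix \<sigma> \<tau> assume "\<sigma> \<in> carrier (galois_pair K)" "\<tau> \<in> carrier (galois_pair K)"
  then have \<sigma>: "\<sigma> \<in> \<Gamma>" and \<tau>: "\<tau> \<in> \<Gamma>"
    by (simp_all add: galois_pair_simps)
  have "(\<sigma> \<otimes>\<^bsub>galois_pair K\<^esub> \<tau>) r = \<sigma> (bit_sign (sqrt_character r \<tau>) * r)"
    using galois_pair_mult[OF assms(1)] sqrt_conjugate[OF \<tau> assms(1,2)] by simp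
  also have "\<dots> = bit_sign (sqrt_character r \<tau> + sqrt_character r \<sigma>) * r"
    using \<Gamma>D(5)[OF \<sigma> bit_sign_in_M assms(1)] sqrt_conjugate[OF \<sigma> assms(1,2)] \<Gamma>_bit_sign[OF \<sigma>]
    by (simp add: bit_sign_add)
  finally have "(\<sigma> \<otimes>\<^bsub>galois_pair K\<^esub> \<tau>) r = bit_sign (sqrt_character r \<tau> + sqrt_character r \<sigma>) * r" .
  moreover have "bit_sign a * r = r \<longleftrightarrow> a = 0" for a
    using assms(3) by (auto simp: bit_sign_def)
  ultimately show "sqrt_character r (\<sigma> \<otimes>\<^bsub>galois_pair K\<^esub> \<tau>) = sqrt_character r \<sigma> + sqrt_character r \<tau>"
    by (simp add: sqrt_character_def add.commute)
qed

lemma galois_2_ext_sqrt_of_base: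
  assumes "galois_2_ext K L" "r * r \<in> K"
  obtains L' where "galois_2_ext K L'" "L \<subseteq> L'" "r \<in> L'"
proof (rule galois_2_ext_sqrt[OF subfield_K assms(1)])
  show "r * r \<in> L"
    using galois_2_extD(2)[OF assms(1)] assms(2) by blast
  \<comment> \<open>Elements of \<open>K\<close> are fixed, so t = 1 serves.\<close>
  show "\<exists>t\<in>L. \<sigma> (r * r) = r * r * (t * t)" if "\<sigma> \<in> Aut_over K L" for \<sigma>
    using Aut_overD(7)[OF that galois_2_extD(1)[OF assms(1)] assms(2)]
      subfield_Q2barD(1)[OF galois_2_extD(1)[OF assms(1)]] by (intro bexI[of _ 1]) simp_all
qed (rule that)

lemma sqrt_of_base_in_M:
  assumes "r * r \<in> K"
  shows "r \<in> M"
  using galois_2_ext_sqrt_of_base[OF galois_2_ext_refl[OF subfield_K] assms] max_pro_2_ext_incl by metis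

text \<open>
  A norm from \<open>K(r)\<close> equal to \<open>s\<^sup>2\<close> gives an extension \<open>K(r, s, w)\<close> with group inside the dihedral
  group of order 8, whose central coordinate bounds the cup product.
\<close>

lemma sqrt_of_norm_in_M:
  assumes "r * r \<in> K" "s * s \<in> K" "c \<in> K" "e \<in> K" "c * c - r * r * (e * e) = s * s" "s \<noteq> 0"
    and w: "w * w = c + e * r"
  shows "w \<in> M"
proof -
  obtain L\<^sub>1 where "galois_2_ext K L\<^sub>1" "r \<in> L\<^sub>1"
    using galois_2_ext_sqrt_of_base[OF galois_2_ext_refl[OF subfield_K] assms(1)] by metis
  then obtain L where KL: "galois_2_ext K L" and r: "r \<in> L" and s: "s \<in> L"
    using galois_2_ext_sqrt_of_base[OF _ assms(2)] by (metis subsetD)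
  note L = galois_2_extD[OF KL] and L_closed = subfield_Q2barD[OF galois_2_extD(1)[OF KL]]
  have ce: "c \<in> L" "e \<in> L"
    using assms(3,4) L(2) by auto
  have norm: "(c + e * r) * (c - e * r) = s * s"
    using assms(5) by (simp add: algebra_simps)
  have d: "w * w \<in> L" "w * w \<noteq> 0"
    using ce r norm assms(6) by (auto simp: w L_closed)
  have "\<exists>t\<in>L. \<sigma> (w * w) = w * w * (t * t)" if \<sigma>: "\<sigma> \<in> Aut_over K L" for \<sigma>
  proof -
    note a = Aut_overD[OF \<sigma> L(1)]
    have "\<sigma> r * \<sigma> r = r * r"
      using a(5)[OF r r] a(7)[OF assms(1)] by simp
    then have "\<sigma> r = r \<or> \<sigma> r = - r"
      by (simp add: square_eq_iff)
    moreover have \<sigma>w: "\<sigma> (w * w) = c + e * \<sigma> r"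
      using ce r assms(3,4) by (simp add: w a L_closed)
    ultimately consider "\<sigma> (w * w) = w * w" | "\<sigma> (w * w) = c - e * r"
      by (auto simp: w)
    then show ?thesis
    proof cases
      case 1
      then show ?thesis
        using L_closed(1) by (intro bexI[of _ 1]) simp_all
    next
      case 2
      \<comment> \<open>The conjugate of w^2 is s^2 / w^2, that is, w^2 times the square of s / w^2.
        This factor lies in \<open>L\<close> because both \<open>r\<close> and \<open>s\<close> have
        been adjoined.\<close>
      have "w * w * (c - e * r) = s * s"
        using norm by (simp add: w)
      then have "c - e * r = s * s / (w * w)"
        using d(2) by (simp add: nonzero_eq_divide_eq mult.commute)
      also have "\<dots> = w * w * ((s / (w * w)) * (s / (w * w)))"
        using d(2) by simp
      finally show ?thesis
        using 2 s d(1) L_closed(8) by (metis)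
    qed
  qed
  then obtain L' where "galois_2_ext K L'" "w \<in> L'"
    using galois_2_ext_sqrt[OF subfield_K KL d(1)] by metis
  then show ?thesis
    by (rule max_pro_2_ext_incl)
qed

text \<open>The elements w and s/w are square roots of c + er and c - er, and an automorphism sends
  w to one of them up to sign, according to its action on \<open>r\<close>. That sign is the bit
  \<open>b\<close>.\<close>

lemma bounds_cup_of_norm:
  assumes r: "r * r \<in> K" "r \<noteq> 0" and s: "s * s \<in> K" "s \<noteq> 0"
    and ce: "c \<in> K" "e \<in> K" and norm: "c * c - r * r * (e * e) = s * s"
  shows "\<exists>b. bounds_cup (galois_pair K) (sqrt_character s) (sqrt_character r) b"
proof -
  obtain w where w: "w * w = c + e * r"
    using Q2bar_sqrt by blast
  have wM: "w \<in> M"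
    using sqrt_of_norm_in_M[OF r(1) s(1) ce norm s(2) w] .
  note rM = sqrt_of_base_in_M[OF r(1)] and sM = sqrt_of_base_in_M[OF s(1)]
  have norm': "w * w * (c - e * r) = s * s"
    using norm by (simp add: w algebra_simps)
  then have "w \<noteq> 0"
    using s(2) by auto
  define b where "b \<sigma> = (if \<sigma> w = (if \<sigma> r = r then w else s / w) then 0 else 1 :: bit)" for \<sigma> :: "Q2bar \<Rightarrow> Q2bar"
  let ?r = "sqrt_character r" and ?s = "sqrt_character s"
  have b: "\<sigma> w = bit_sign (b \<sigma>) * (if ?r \<sigma> = 0 then w else s / w)" if \<sigma>: "\<sigma> \<in> \<Gamma>" for \<sigma>
  proof -
    note a = \<Gamma>D[OF \<sigma>]
    have \<sigma>w: "\<sigma> w * \<sigma> w = c + e * \<sigma> r"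
      using a(5)[OF wM wM] ce rM K_in_M by (simp add: w a M_closed)
    show ?thesis
    proof (cases "\<sigma> r = r")
      case True
      then have "\<sigma> w * \<sigma> w = w * w"
        using \<sigma>w w by simp
      then show ?thesis
        using True by (auto simp: square_eq_iff b_def bit_sign_def sqrt_character_def)
    next
      case False
      then have "\<sigma> r = - r"
        using sqrt_conjugate[OF \<sigma> rM r(1)] by (auto simp: bit_sign_def split: if_splits)
      then have "\<sigma> w * \<sigma> w = c - e * r"
        using \<sigma>w by simp
      also have "\<dots> = (s / w) * (s / w)"
        using norm' \<open>w \<noteq> 0\<close> by (simp add: nonzero_eq_divide_eq mult.commute)
      finally have "\<sigma> w = s / w \<or> \<sigma> w = - (s / w)"
        by (simp only: square_eq_iff)
      then show ?thesis
        using False by (auto simp: b_def bit_sign_def sqrt_character_def)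
    qed
  qed
  have "continuous_map (topo (galois_pair K)) (discrete_topology UNIV) b"
    unfolding b_def[abs_def]
    by (rule continuous_map_discrete_comp2[OF continuous_map_evaluation[OF wM] continuous_map_evaluation[OF rM]])
  moreover have "b (\<sigma> \<otimes>\<^bsub>galois_pair K\<^esub> \<tau>) = b \<sigma> + b \<tau> + ?s \<sigma> * ?r \<tau>"
    if \<sigma>\<tau>: "\<sigma> \<in> carrier (galois_pair K)" "\<tau> \<in> carrier (galois_pair K)" for \<sigma> \<tau>
  proof -
    let ?\<rho> = "\<sigma> \<otimes>\<^bsub>galois_pair K\<^esub> \<tau>"
    have \<sigma>: "\<sigma> \<in> \<Gamma>" and \<tau>: "\<tau> \<in> \<Gamma>"
      using \<sigma>\<tau> by (simp_all add: galois_pair_simps)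
    note a = \<Gamma>D[OF \<sigma>]
    have \<rho>r: "?r ?\<rho> = ?r \<sigma> + ?r \<tau>"
      using bit_character_sqrt[OF rM r] \<sigma>\<tau> by (simp add: bit_character_def)
    have \<rho>: "?\<rho> w = bit_sign (b \<tau>) * \<sigma> (if ?r \<tau> = 0 then w else s / w)"
      using b[OF \<tau>] a(5)[OF bit_sign_in_M] \<Gamma>_bit_sign[OF \<sigma>] wM sM
      by (simp add: galois_pair_mult M_closed)
    have "?\<rho> w = bit_sign (b \<sigma> + b \<tau> + ?s \<sigma> * ?r \<tau>) * (if ?r ?\<rho> = 0 then w else s / w)"
    proof (cases "?r \<tau> = 0")
      case True
      then show ?thesis
        using \<rho> b[OF \<sigma>] by (simp add: \<rho>r bit_sign_add)
    next
      case False
      then have "?r \<tau> = 1"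
        by simp
      \<comment> \<open>If \<tau> moves \<open>r\<close>, then \<sigma> acts on s/w instead of w,
        and its sign on \<open>s\<close> appears. This extra sign is the cup product term.\<close>
      then have 1: "?\<rho> w = bit_sign (b \<tau>) * (bit_sign (?s \<sigma>) * s / (bit_sign (b \<sigma>) * (if ?r \<sigma> = 0 then w else s / w)))"
        using \<rho> b[OF \<sigma>] a(12)[OF sM wM] sqrt_conjugate[OF \<sigma> sM s(1)] by simp
      have inv: "x / bit_sign (b \<sigma>) = bit_sign (b \<sigma>) * x" for x
        by (simp add: bit_sign_def)
      have "?\<rho> w = bit_sign (b \<tau>) * bit_sign (?s \<sigma>) * bit_sign (b \<sigma>) * (if ?r \<sigma> = 0 then s / w else w)"
        unfolding 1 using inv[of s] \<open>w \<noteq> 0\<close> s(2) by (simp add: bit_sign_def)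
      then show ?thesis
        using \<open>?r \<tau> = 1\<close> by (cases "?r \<sigma>") (simp_all add: \<rho>r bit_sign_add)
    qed
    moreover have "(if ?r ?\<rho> = 0 then w else s / w) \<noteq> 0"
      using \<open>w \<noteq> 0\<close> s(2) by simp
    moreover have "(if bit_sign x * z = z then 0 else 1) = x" if "z \<noteq> 0" for x z
      using that by (cases x) (simp_all add: bit_sign_def)
    moreover have "b ?\<rho> = (if ?\<rho> w = (if ?r ?\<rho> = 0 then w else s / w) then 0 else 1)"
      by (simp add: b_def sqrt_character_def)
    ultimately show ?thesis
      by (simp only:)
  qed
  ultimately have "bounds_cup (galois_pair K) ?s ?r b"
    by (simp add: bounds_cup_def)
  then show ?thesis
    by (rule exI[of _ b])
qed

end

text \<open>
  The character of a pair of 2-adic type is defined by a definite description, which is only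
  meaningful once all roots of unity of 2-power order are known to lie in \<open>K(2)\<close>.
\<close>

locale two_adic_field_roots = two_adic_field K for K +
  fixes \<zeta> :: "nat \<Rightarrow> Q2bar"
  assumes zeta_0: "\<zeta> 0 = 1" and zeta_1: "\<zeta> (Suc 0) = - 1"
    and zeta_square: "\<zeta> (Suc n) * \<zeta> (Suc n) = \<zeta> n"
begin

section \<open>Roots of unity of 2-power order\<close>

lemma zeta_power_half: "\<zeta> (Suc n) ^ (2 ^ n) = - 1"
proof (induction n)
  case (Suc n)
  have "\<zeta> (Suc (Suc n)) ^ (2 ^ Suc n) = (\<zeta> (Suc (Suc n)) * \<zeta> (Suc (Suc n))) ^ (2 ^ n)"
    by (simp add: power_mult power2_eq_square)
  then show ?case
    using Suc zeta_square by simp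
qed (simp add: zeta_1)

lemma zeta_power_double: "\<zeta> (Suc n) ^ (2 * k) = \<zeta> n ^ k"
  by (simp add: power_mult power2_eq_square zeta_square)

lemma zeta_power_order: "\<zeta> n ^ (2 ^ n) = 1"
proof (cases n)
  case (Suc k)
  then show ?thesis
    using zeta_power_half[of k] by (simp add: power_mult power_even_eq mult.commute[of 2])
qed (simp add: zeta_0)

lemma zeta_neq_0: "\<zeta> n \<noteq> 0"
  using zeta_power_order[of n] by (metis power_0_left zero_neq_one power_eq_0_iff zero_less_power pos2)

text \<open>Squaring descends from level n + 1 to level n and gives divisibility by 2^n; the last
  factor 2 comes from the 2^n-th power being -1.\<close>

lemma zeta_power_eq_1_iff: "\<zeta> n ^ j = 1 \<longleftrightarrow> 2 ^ n dvd j"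
proof (induction n arbitrary: j)
  case (Suc n)
  show ?case
  proof
    assume 1: "\<zeta> (Suc n) ^ j = 1"
    have "\<zeta> n ^ j = (\<zeta> (Suc n) ^ j) ^ 2"
      unfolding zeta_power_double[of n j, symmetric] by (metis power_mult mult.commute)
    then have "2 ^ n dvd j"
      using 1 Suc.IH by simp
    then obtain m where m: "j = 2 ^ n * m"
      by blast
    have "(- 1 :: Q2bar) ^ m = 1"
      using 1 unfolding m power_mult zeta_power_half .
    moreover have "(1 :: Q2bar) \<noteq> - 1"
      by (metis uminus_eq_self_Q2bar zero_neq_one)
    ultimately have "even m"
      by (metis neg_one_odd_power)
    then show "2 ^ Suc n dvd j"
      using m by auto
  next
    assume "2 ^ Suc n dvd j"
    then show "\<zeta> (Suc n) ^ j = 1"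
      by (auto simp: dvd_def power_mult zeta_power_order simp del: power_Suc)
  qed
qed (simp add: zeta_0)

lemma zeta_power_eq_iff: "\<zeta> n ^ j = \<zeta> n ^ k \<longleftrightarrow> j mod 2 ^ n = k mod 2 ^ n"
proof -
  have *: "\<zeta> n ^ j = \<zeta> n ^ k \<longleftrightarrow> j mod 2 ^ n = k mod 2 ^ n" if "j \<le> k" for j k
  proof -
    have "\<zeta> n ^ k = \<zeta> n ^ j * \<zeta> n ^ (k - j)"
      using that by (simp flip: power_add)
    then have "\<zeta> n ^ j = \<zeta> n ^ k \<longleftrightarrow> \<zeta> n ^ (k - j) = 1"
      using zeta_neq_0 by (metis mult.right_neutral mult_cancel_left power_not_zero)
    also have "\<dots> \<longleftrightarrow> j mod 2 ^ n = k mod 2 ^ n"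
      using that by (metis zeta_power_eq_1_iff mod_eq_dvd_iff_nat)
    finally show ?thesis .
  qed
  show ?thesis
    using *[of j k] *[of k j] by (metis nat_le_linear)
qed

text \<open>By induction x^2 is a power of the root one level below, so x is a power of the current
  root up to sign, and -1 is itself such a power.\<close>

lemma root_of_unity_is_zeta_power:
  assumes "x ^ (2 ^ n) = 1"
  obtains k where "k < 2 ^ n" "x = \<zeta> n ^ k"
proof -
  have "\<exists>k. x = \<zeta> n ^ k"
    using assms
  proof (induction n arbitrary: x)
    case (Suc n)
    then have "(x * x) ^ (2 ^ n) = 1"
      by (simp add: power_mult power2_eq_square)
    then obtain k where "x * x = \<zeta> n ^ k"
      using Suc.IH by blast
    also have "\<dots> = \<zeta> (Suc n) ^ k * \<zeta> (Suc n) ^ k"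
      unfolding zeta_square[of n, symmetric] by (rule power_mult_distrib)
    finally have "x = \<zeta> (Suc n) ^ k \<or> x = - (\<zeta> (Suc n) ^ k)"
      by (simp add: square_eq_iff)
    moreover have "- (\<zeta> (Suc n) ^ k) = \<zeta> (Suc n) ^ (2 ^ n + k)"
      by (simp add: power_add zeta_power_half)
    ultimately show ?case
      by metis
  qed (simp add: zeta_0)
  then obtain k where "x = \<zeta> n ^ k"
    by blast
  moreover have "\<zeta> n ^ k = \<zeta> n ^ (k mod 2 ^ n)"
    unfolding zeta_power_eq_iff by simp
  ultimately show thesis
    using that[of "k mod 2 ^ n"] by simp
qed

text \<open>An automorphism raises a root of order 2^(n+1) to some power k, and k is odd because -1
  is fixed. With k = 2j + 1 the root is multiplied by the square of its j-th power, as the square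
  root criterion demands.\<close>

lemma zeta_in_galois_2_ext: "\<exists>L. galois_2_ext K L \<and> \<zeta> (Suc n) \<in> L"
proof (induction n)
  case 0
  then show ?case
    using galois_2_ext_refl[OF subfield_K] K_closed(1,5) by (metis zeta_1)
next
  case (Suc n)
  then obtain L where KL: "galois_2_ext K L" and z: "\<zeta> (Suc n) \<in> L"
    by blast
  note L = galois_2_extD[OF KL] and L_closed = subfield_Q2barD[OF galois_2_extD(1)[OF KL]]
  have "\<exists>t\<in>L. \<sigma> (\<zeta> (Suc (Suc n)) * \<zeta> (Suc (Suc n))) = \<zeta> (Suc (Suc n)) * \<zeta> (Suc (Suc n)) * (t * t)"
    if \<sigma>: "\<sigma> \<in> Aut_over K L" for \<sigma>
  proof -
    note a = Aut_overD[OF \<sigma> L(1)]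
    have "\<sigma> (\<zeta> (Suc n)) ^ (2 ^ Suc n) = 1"
      using a(13)[OF z] a(6) zeta_power_order[of "Suc n"] by metis
    then obtain k where k: "\<sigma> (\<zeta> (Suc n)) = \<zeta> (Suc n) ^ k"
      by (rule root_of_unity_is_zeta_power)
    have "(- 1 :: Q2bar) = \<sigma> (\<zeta> (Suc n) ^ (2 ^ n))"
      using a(9)[OF L_closed(1)] a(6) by (simp add: zeta_power_half)
    also have "\<dots> = (\<zeta> (Suc n) ^ (2 ^ n)) ^ k"
      using a(13)[OF z] k by (simp flip: power_mult add: mult.commute)
    finally have "(- 1 :: Q2bar) = (- 1) ^ k"
      by (simp only: zeta_power_half)
    moreover have "(1 :: Q2bar) \<noteq> - 1"
      by (metis uminus_eq_self_Q2bar zero_neq_one)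
    ultimately have "odd k"
      by (metis neg_one_even_power)
    then obtain j where j: "k = Suc (2 * j)"
      by (metis oddE Suc_eq_plus1)
    have "\<sigma> (\<zeta> (Suc n)) = \<zeta> (Suc n) * (\<zeta> (Suc n) ^ j * \<zeta> (Suc n) ^ j)"
      by (simp add: k j power_mult power2_eq_square power_mult_distrib mult_2 power_add)
    then show ?thesis
      unfolding zeta_square using L_closed(9)[OF z] by blast
  qed
  moreover have "\<zeta> (Suc (Suc n)) * \<zeta> (Suc (Suc n)) \<in> L"
    using z by (simp only: zeta_square)
  ultimately show ?case
    using galois_2_ext_sqrt[OF subfield_K KL] by metis
qed

lemma zeta_in_M: "\<zeta> n \<in> M"
  using zeta_in_galois_2_ext max_pro_2_ext_incl M_closed(1) zeta_0 by (metis not0_implies_Suc)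

text \<open>The definite description has exactly one solution. The exponents \<open>p\<close> of
  \<sigma> on the roots \<open>\<zeta>\<close> are coherent and form a 2-adic integer u. The
  exponents \<open>q\<close> of preimages form an inverse of it, and the exact orders of the roots
  give uniqueness.\<close>

lemma cyclotomic_character:
  assumes \<sigma>: "\<sigma> \<in> \<Gamma>"
  shows "cyclotomic_character \<sigma> dvd 1"
    and "\<And>n x. x ^ (2 ^ n) = 1 \<Longrightarrow> \<sigma> x = x ^ nat (res (cyclotomic_character \<sigma>) n)"
proof -
  note a = \<Gamma>D[OF \<sigma>]
  have inj: "\<sigma> x = \<sigma> y \<longleftrightarrow> x = y" if "x \<in> M" "y \<in> M" for x y
    using inj_on_eq_iff[OF bij_betw_imp_inj_on[OF a(2)] that] .
  have "\<exists>k. k < 2 ^ n \<and> \<sigma> (\<zeta> n) = \<zeta> n ^ k" for n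
  proof -
    have "\<sigma> (\<zeta> n) ^ (2 ^ n) = 1"
      using a(13)[OF zeta_in_M] a(6) zeta_power_order by metis
    then show ?thesis
      by (metis root_of_unity_is_zeta_power)
  qed
  then obtain p where p: "\<And>n. p n < 2 ^ n" "\<And>n. \<sigma> (\<zeta> n) = \<zeta> n ^ p n"
    by metis
  have "\<exists>k. k < 2 ^ n \<and> \<sigma> (\<zeta> n ^ k) = \<zeta> n" for n
  proof -
    have "\<zeta> n \<in> \<sigma> ` M"
      using a(2) zeta_in_M by (simp add: bij_betw_def)
    then obtain y where y: "y \<in> M" "\<zeta> n = \<sigma> y"
      by blast
    then have "\<sigma> (y ^ (2 ^ n)) = \<sigma> 1"
      using a(13)[OF y(1)] a(6) zeta_power_order[of n] by simp
    then have "y ^ (2 ^ n) = 1"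
      using inj M_closed(1,9) y(1) by blast
    then show ?thesis
      using y(2) by (metis root_of_unity_is_zeta_power)
  qed
  then obtain q where q: "\<And>n. q n < 2 ^ n" "\<And>n. \<sigma> (\<zeta> n ^ q n) = \<zeta> n"
    by metis
  have "p n = p (Suc n) mod 2 ^ n" for n
  proof -
    have "\<zeta> n ^ p n = \<sigma> (\<zeta> (Suc n)) * \<sigma> (\<zeta> (Suc n))"
      using a(5)[OF zeta_in_M zeta_in_M] p(2) by (metis zeta_square)
    also have "\<dots> = \<zeta> n ^ p (Suc n)"
      unfolding p(2)[of "Suc n"] zeta_square[of n, symmetric] by (simp add: power_mult_distrib)
    finally show ?thesis
      using p(1)[of n] by (simp add: zeta_power_eq_iff)
  qed
  then have "int (p n) = int (p (Suc n)) mod 2 ^ n" for n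
    by (metis of_nat_mod of_nat_numeral of_nat_power)
  then obtain u where u: "\<And>n. res u n = int (p n)"
    using two_adic_of_coherent[of "\<lambda>n. int (p n)"] by blast
  have "q n = q (Suc n) mod 2 ^ n" for n
  proof -
    have "\<sigma> (\<zeta> n ^ q n) = \<sigma> (\<zeta> (Suc n) ^ q (Suc n)) * \<sigma> (\<zeta> (Suc n) ^ q (Suc n))"
      unfolding q(2) zeta_square ..
    also have "\<dots> = \<sigma> (\<zeta> n ^ q (Suc n))"
      unfolding zeta_square[of n, symmetric] power_mult_distrib
      using a(5) M_closed(9) zeta_in_M by simp
    finally have "\<zeta> n ^ q n = \<zeta> n ^ q (Suc n)"
      using inj M_closed(9) zeta_in_M by simp
    then show ?thesis
      using q(1)[of n] by (simp add: zeta_power_eq_iff)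
  qed
  then have "int (q n) = int (q (Suc n)) mod 2 ^ n" for n
    by (metis of_nat_mod of_nat_numeral of_nat_power)
  then obtain v where v: "\<And>n. res v n = int (q n)"
    using two_adic_of_coherent[of "\<lambda>n. int (q n)"] by blast
  have "u * v = 1"
  proof (rule two_adic_eqI)
    fix n
    have "\<zeta> n ^ (p n * q n) = \<zeta> n ^ 1"
      using a(13)[OF zeta_in_M, of n "q n"] p(2)[of n] q(2)[of n] by (simp add: power_mult)
    then have "p n * q n mod 2 ^ n = 1 mod 2 ^ n"
      by (simp only: zeta_power_eq_iff)
    then have "int (p n * q n mod 2 ^ n) = int (1 mod 2 ^ n)"
      by (rule arg_cong)
    then show "res (u * v) n = res 1 n"
      by (simp add: times_two_adic.rep_eq one_two_adic.rep_eq u v zmod_int)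
  qed
  then have unit: "u dvd 1"
    by (metis dvd_triv_left)
  have spec: "\<sigma> x = x ^ nat (res u n)" if "x ^ (2 ^ n) = 1" for n x
  proof -
    from that obtain k where k: "x = \<zeta> n ^ k"
      by (rule root_of_unity_is_zeta_power)
    then have "\<sigma> x = (\<zeta> n ^ p n) ^ k"
      using a(13)[OF zeta_in_M] p(2) by simp
    then show ?thesis
      by (simp add: k u mult.commute flip: power_mult)
  qed
  have "u' = u" if "\<forall>n x. x ^ (2 ^ n) = 1 \<longrightarrow> \<sigma> x = x ^ nat (res u' n)" for u'
  proof (rule two_adic_eqI)
    fix n
    have "\<zeta> n ^ nat (res u' n) = \<zeta> n ^ nat (res u n)"
      using that spec zeta_power_order by metis
    moreover have "nat (res w n) < 2 ^ n" for w
      using res_bounds[of w n] by (simp add: nat_less_iff)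
    ultimately have "nat (res u' n) = nat (res u n)"
      by (simp add: zeta_power_eq_iff)
    then show "res u' n = res u n"
      using res_bounds(1) by (metis int_nat_eq)
  qed
  then have "cyclotomic_character \<sigma> = u"
    unfolding cyclotomic_character_def using unit spec by (intro the_equality) blast+
  then show "cyclotomic_character \<sigma> dvd 1"
    and "\<And>n x. x ^ (2 ^ n) = 1 \<Longrightarrow> \<sigma> x = x ^ nat (res (cyclotomic_character \<sigma>) n)"
    using unit spec by simp_all
qed

text \<open>The fourth root of unity \<open>i\<close> reads the cyclotomic character modulo 4:
  residue 1 fixes it, residue 3 sends it to i^3 = -i. Thus e is the Kummer character of -1.\<close>

lemma chr_bit_galois_pair:
  assumes \<sigma>: "\<sigma> \<in> \<Gamma>" and i: "i * i = - 1"
  shows "chr_bit (galois_pair K) \<sigma> = sqrt_character i \<sigma>"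
proof -
  have "i ^ (2 ^ 2) = (i * i) * (i * i)"
    by (simp add: power4_eq_xxxx mult.assoc)
  then have "i ^ (2 ^ 2) = 1"
    by (simp add: i)
  then have si: "\<sigma> i = i ^ nat (res (cyclotomic_character \<sigma>) 2)"
    by (rule cyclotomic_character(2)[OF \<sigma>])
  have "i ^ 3 = - i" "- i \<noteq> i"
    using i by (auto simp: power3_eq_cube)
  then show ?thesis
    using res_unit_cases[OF cyclotomic_character(1)[OF \<sigma>]] si
    by (auto simp: chr_bit_def sign_bit_def sqrt_character_def galois_pair_simps)
qed

end

context two_adic_field
begin

lemma cube_trivial_galois_pair: "cube_trivial (galois_pair K)"
proof -
  obtain \<zeta> :: "nat \<Rightarrow> Q2bar" where "\<zeta> 0 = 1" "\<zeta> (Suc 0) = - 1" "\<And>n. \<zeta> (Suc n) * \<zeta> (Suc n) = \<zeta> n"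
    using Q2bar_two_power_roots by blast
  then interpret two_adic_field_roots K \<zeta>
    by unfold_locales
  obtain i r s :: Q2bar where i: "i * i = - 1" and r: "r * r = 2" and s: "s * s = 5"
    using Q2bar_sqrt by metis
  obtain t where t: "t \<in> K" "t * t = - 7"
    using Q2bar_sqrt_minus_7 base by blast
  have nz: "i \<noteq> 0" "r \<noteq> 0" "s \<noteq> 0"
  proof -
    have nz: "x \<noteq> 0" if "x * x \<noteq> 0" for x :: Q2bar
      using that by auto
    show "i \<noteq> 0" "r \<noteq> 0" "s \<noteq> 0"
      by (rule nz, simp add: i r s)+
  qed
  have m1: "- 1 \<in> K"
    by (simp add: K_closed)
  have iK: "i * i \<in> K" and rK: "r * r \<in> K" and sK: "s * s \<in> K"
    using numeral_in_K m1 by (simp_all add: i r s)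
  note iM = sqrt_of_base_in_M[OF iK] and rM = sqrt_of_base_in_M[OF rK] and sM = sqrt_of_base_in_M[OF sK]
  let ?G = "galois_pair K" and ?x = "sqrt_character r" and ?y = "sqrt_character s"
  have e: "chr_bit ?G \<sigma> = sqrt_character i \<sigma>" if "\<sigma> \<in> carrier ?G" for \<sigma>
    using chr_bit_galois_pair[OF _ i] that by (simp add: galois_pair_simps)
  obtain b where "bounds_cup ?G ?x (sqrt_character i) b"
    using bounds_cup_of_norm[OF iK nz(1) rK nz(2) K_closed(1) K_closed(1)] by (auto simp: i r)
  then have b: "bounds_cup ?G ?x (chr_bit ?G) b"
    by (rule bounds_cup_cong) (simp_all add: e)
  \<comment> \<open>The numeral \<open>num.Bit0 num.One\<close> is 2; the norm of 1 + 2i is 1 + 4 =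
    5.\<close>
  obtain d where "bounds_cup ?G ?y (sqrt_character i) d"
    using bounds_cup_of_norm[OF iK nz(1) sK nz(3) K_closed(1) numeral_in_K[of "num.Bit0 num.One"]]
    by (auto simp: i s)
  then have d: "bounds_cup ?G ?y (chr_bit ?G) d"
    by (rule bounds_cup_cong) (simp_all add: e)
  have ir2: "(i * r) * (i * r) = - 2" and is5: "(i * s) * (i * s) = - 5"
  proof -
    have "(i * r) * (i * r) = (i * i) * (r * r)" "(i * s) * (i * s) = (i * i) * (s * s)"
      by (simp_all only: ac_simps)
    then show "(i * r) * (i * r) = - 2" "(i * s) * (i * s) = - 5"
      by (simp_all add: i r s)
  qed
  have irK: "(i * r) * (i * r) \<in> K" and isK: "(i * s) * (i * s) \<in> K"
    unfolding ir2 is5 using K_closed(5)[OF numeral_in_K] by blast+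
  have norm: "t * t - (i * r) * (i * r) * (1 * 1) = (i * s) * (i * s)"
    unfolding t(2) ir2 is5 by simp
  have "i * r \<noteq> 0" "i * s \<noteq> 0"
    using nz by simp_all
  from bounds_cup_of_norm[OF irK this(1) isK this(2) t(1) K_closed(1) norm]
  obtain a where "bounds_cup ?G (sqrt_character (i * s)) (sqrt_character (i * r)) a"
    by blast
  \<comment> \<open>The Kummer characters of -5 and -2 are y + e and x + e, since square roots
    multiply.\<close>
  then have a: "bounds_cup ?G (\<lambda>g. ?y g + chr_bit ?G g) (\<lambda>g. ?x g + chr_bit ?G g) a"
    by (rule bounds_cup_cong)
      (use e iM iK rM rK sM sK nz in \<open>simp_all add: sqrt_character_mult galois_pair_simps add.commute\<close>)
  show ?thesis
    unfolding cube_trivial_def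
    using bit_character_sqrt[OF rM rK nz(2)] bit_character_sqrt[OF sM sK nz(3)] a b d by blast
qed

end

section \<open>The logarithmic level of pairs in $\mathrm{ET}_2$\<close>

lemma ET2_univ_cyclotomic_pair: "ET2_univ \<G> \<Longrightarrow> cyclotomic_pair \<G>"
  by (induction rule: ET2_univ.induct)

lemma cube_trivial_iso:
  assumes "cyclotomic_pair \<G>" "pair_iso \<G> \<H>" "cube_trivial \<H>"
  shows "cube_trivial \<G>"
proof -
  obtain f where "f \<in> cont_hom \<G> \<H>" "\<And>g. g \<in> carrier \<G> \<Longrightarrow> chr \<H> (f g) = chr \<G> g"
    using pair_isoE[OF assms(2) cyclotomic_pairD(1,2)[OF assms(1)]] by metis
  then show ?thesis
    using assms(3) by (rule cube_trivial_pullback)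
qed

lemma ET2_univ_dichotomy: "ET2_univ \<G> \<Longrightarrow> cube_trivial \<G> \<or> has_real_involution \<G>"
proof (induction rule: ET2_univ.induct)
  case (trivial \<G>)
  then show ?case
    using cube_trivial_iso_trivial_pair by blast
next
  case (Z \<G> \<alpha>)
  then show ?case
    using cube_trivial_iso_Z_pair by blast
next
  case (E \<G>)
  then show ?case
    using has_real_involution_iso_E_pair by blast
next
  case (two_adic_type \<G> K)
  then interpret two_adic_field K
    by unfold_locales
  show ?case
    using cube_trivial_iso[OF two_adic_type(1,3) cube_trivial_galois_pair] ..
next
  case (free_product \<G> \<G>\<^sub>1 \<G>\<^sub>2)
  then show ?case
    using free_product_dichotomy ET2_univ_cyclotomic_pair by blast
next
  case (extension \<G> \<H>)
  then show ?case
    using extension_pair_dichotomy ET2_univ_cyclotomic_pair by blast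
qed

theorem theorem16p1:
  fixes \<G> :: "'a cyc_pair"
  assumes "ET2 \<G>"
  shows "log_level \<G> \<in> {1, 2, 3, \<infinity>}"
proof -
  obtain \<H> where \<G>: "cyclotomic_pair \<G>" and \<H>: "ET2_univ \<H>" and iso: "pair_iso \<G> \<H>"
    using assms by (auto simp: ET2_def)
  \<comment> \<open>The dichotomy holds for the copy on \<open>univ\<close>. Cochains return to
    \<open>\<G>\<close> along the isomorphism, an involution along its inverse.\<close>
  from ET2_univ_dichotomy[OF \<H>] show ?thesis
  proof
    assume "cube_trivial \<H>"
    then have "cube_trivial \<G>"
      by (rule cube_trivial_iso[OF \<G> iso])
    then show ?thesis
      using log_level_cube_trivial[OF \<G>] by auto
  next
    assume real: "has_real_involution \<H>"
    obtain k where k: "k \<in> cont_hom \<H> \<G>" and chr: "\<And>h. h \<in> carrier \<H> \<Longrightarrow> chr \<G> (k h) = chr \<H> h"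
      using pair_isoE[OF iso cyclotomic_pairD(1,2)[OF \<G>]] by metis
    have "group \<H>"
      using cyclotomic_pairD(1)[OF ET2_univ_cyclotomic_pair[OF \<H>]] .
    then have "monoid \<H>"
      by (rule group.is_monoid)
    moreover have "k \<in> hom \<H> \<G>"
      using k by (simp add: cont_hom_def)
    ultimately have "has_real_involution \<G>"
      using has_real_involution_image[OF _ cyclotomic_pairD(1)[OF \<G>] _ chr real] by blast
    then show ?thesis
      using log_level_real_involution[OF \<G>] by simp
  qed
qed

end
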